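(* Let $F$ be the cumulative distribution function of a non-negative random variable $W$, not almost surely equal to $0$, with finite first and second moments. For $n\ge1$ let \[ w_i^{(n)}=F^{-1}\left(1-\frac in\right),\quad i\in\{1,\dots,n\},\qquad l_n=\sum_{i=1}^n w_i^{(n)},\qquad z_i^{(n)}=\frac{w_i^{(n)}}{\sqrt{l_n}}, \] and let $K_{\mathrm{NR}}^{(n)}(t)$ be the number of connected components at time $t\ge0$ of the multiplicative random graph process on the vertex set $\{1,\dots,n\}$ in which vertex $i$ has mass $z_i^{(n)}$. Then, for every $[0,c]\subset\left[0,\frac{\mathbb{E}[W]}{\mathbb{E}[W^2]}\right)$, \[ \left(\frac1n K_{\mathrm{NR}}^{(n)}(t)\right)_{t\in[0,c]}\Rightarrow\left(1-\frac t2\,\mathbb{E}[W]\right)_{t\in[0,c]}\quad\text{in } D([0,c],\mathbb{R})\text{ as } n\to\infty . \] In addition, \[ \left(\sqrt n\left(\frac1n K_{\mathrm{NR}}^{(n)}(t)-\Big(1-\frac t2\,\mathbb{E}[W]\Big)\right)\right)_{t\in[0,c]}\Rightarrow\left(B\Big(\frac{t\,\mathbb{E}[W]}{2}\Big)\right)_{t\in[0,c]} \] in $D([0,c],\mathbb{R})$ as $n\to\infty$, where $B$ is a (standard one-dimensional) Brownian motion.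
   Context: $F^{-1}$ is the generalized inverse $F^{-1}(x)=\inf\{s\in\mathbb{R}_+: F(s)\ge x\}$ for $x\in(0,1)$, with the convention $F^{-1}(0)=0$. The multiplicative random graph process on $\{1,\dots,n\}$ with masses $z_1,\dots,z_n\ge0$ is the graph-valued continuous-time Markov process which starts with no edges at time $0$ and in which the edge between each pair $i\ne j$ appears (and then stays forever) after an exponential time with rate $z_iz_j$, independently of the other edges (an edge with rate $0$ never appears, so a vertex of mass $0$ is an isolated vertex and counts as one connected component). Since $\mathbb{E}[W]>0$, $l_n>0$ for all large $n$, and only such $n$ are considered. $D([0,c],\mathbb{R})$ is the space of càdlàg real-valued functions on $[0,c]$ with the Skorokhod $J_1$ topology, and $\Rightarrow$ denotes convergence in distribution. *)

theory Defs
  imports "HOL-Probability.Probability"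
begin

section \<open>Weights\<close>

definition gen_inverse :: "(real \<Rightarrow> real) \<Rightarrow> real \<Rightarrow> real" where
  "gen_inverse F x = (if x = 0 then 0 else Inf {s. 0 \<le> s \<and> x \<le> F s})"

definition weight :: "(real \<Rightarrow> real) \<Rightarrow> nat \<Rightarrow> nat \<Rightarrow> real" where
  "weight F n i = gen_inverse F (1 - real i / real n)"

definition total_weight :: "(real \<Rightarrow> real) \<Rightarrow> nat \<Rightarrow> real" where
  "total_weight F n = (\<Sum>i=1..n. weight F n i)"

definition mass :: "(real \<Rightarrow> real) \<Rightarrow> nat \<Rightarrow> nat \<Rightarrow> real" where
  "mass F n i = weight F n i / sqrt (total_weight F n)"

section \<open>The multiplicative random graph process\<close>

definition all_edges_on :: "nat set \<Rightarrow> nat set set" where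
  "all_edges_on V = {{i, j} | i j. i \<in> V \<and> j \<in> V \<and> i \<noteq> j}"

text \<open>Law of an exponential time of rate \<open>r \<ge> 0\<close>; a clock of rate \<open>0\<close> never rings.\<close>

definition exponential_time :: "real \<Rightarrow> ereal measure" where
  "exponential_time r =
     (if r > 0 then distr (density lborel (exponential_density r)) borel ereal
      else return borel \<infinity>)"

text \<open>\<open>T e \<omega>\<close> is the time at which the edge \<open>e\<close> appears and \<open>G t \<omega>\<close> is the edge set at time \<open>t\<close>.\<close>

definition multiplicative_graph_process ::
    "'a measure \<Rightarrow> nat set \<Rightarrow> (nat \<Rightarrow> real) \<Rightarrow> (real \<Rightarrow> 'a \<Rightarrow> nat set set) \<Rightarrow> bool" where
  "multiplicative_graph_process P V z G \<longleftrightarrow>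
     prob_space P \<and>
     (\<exists>T :: nat set \<Rightarrow> 'a \<Rightarrow> ereal.
        prob_space.indep_vars P (\<lambda>_. borel) T (all_edges_on V) \<and>
        (\<forall>i\<in>V. \<forall>j\<in>V. i \<noteq> j \<longrightarrow> distr P borel (T {i, j}) = exponential_time (z i * z j)) \<and>
        (\<forall>t\<ge>0. \<forall>\<omega>\<in>space P. G t \<omega> = {e \<in> all_edges_on V. T e \<omega> \<le> ereal t}))"

definition reachable_in :: "nat set \<Rightarrow> nat set set \<Rightarrow> (nat \<times> nat) set" where
  "reachable_in V E = {(i, j). i \<in> V \<and> j \<in> V \<and> (i, j) \<in> {(a, b). {a, b} \<in> E}\<^sup>*}"

definition num_components :: "nat set \<Rightarrow> nat set set \<Rightarrow> nat" where
  "num_components V E = card (V // reachable_in V E)"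

section \<open>The space \<open>D([0,c])\<close> with the \<open>J\<^sub>1\<close> topology\<close>

text \<open>A function on \<open>[0,c]\<close> is represented by its extension with the value \<open>undefined\<close> outside
  \<open>[0,c]\<close>. The right-continuity condition is void at \<open>t = c\<close> and the left-limit condition is void
  at \<open>t = 0\<close>, because the corresponding filters are trivial.\<close>

definition skorokhod_space :: "real \<Rightarrow> (real \<Rightarrow> real) set" where
  "skorokhod_space c = {f \<in> extensional {0..c}. \<forall>t\<in>{0..c}.
     (f \<longlongrightarrow> f t) (at t within {t..c}) \<and> (\<exists>l. (f \<longlongrightarrow> l) (at t within {0..<t}))}"

definition time_changes :: "real \<Rightarrow> (real \<Rightarrow> real) set" where
  "time_changes c = {\<mu>. strict_mono_on {0..c} \<mu> \<and> continuous_on {0..c} \<mu> \<and> \<mu> ` {0..c} = {0..c}}"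

definition skorokhod_close :: "real \<Rightarrow> (real \<Rightarrow> real) \<Rightarrow> (real \<Rightarrow> real) \<Rightarrow> real \<Rightarrow> bool" where
  "skorokhod_close c f g e \<longleftrightarrow>
     0 < e \<and> (\<exists>\<mu>\<in>time_changes c. \<forall>t\<in>{0..c}. \<bar>\<mu> t - t\<bar> \<le> e \<and> \<bar>f (\<mu> t) - g t\<bar> \<le> e)"

text \<open>The value \<open>0\<close> off the space is junk: the library's metric locale wants a total function that
  is nonnegative everywhere.\<close>

definition skorokhod_dist :: "real \<Rightarrow> (real \<Rightarrow> real) \<Rightarrow> (real \<Rightarrow> real) \<Rightarrow> real" where
  "skorokhod_dist c f g =
     (if f \<in> skorokhod_space c \<and> g \<in> skorokhod_space c
      then Inf {e. skorokhod_close c f g e}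
      else 0)"

definition skorokhod_topology :: "real \<Rightarrow> (real \<Rightarrow> real) topology" where
  "skorokhod_topology c = Metric_space.mtopology (skorokhod_space c) (skorokhod_dist c)"

lemma skorokhod_space_bounded:
  assumes "f \<in> skorokhod_space c"
  shows "\<exists>B. \<forall>t\<in>{0..c}. \<bar>f t\<bar> \<le> B"
proof (cases "0 \<le> c")
  case True
  define P where "P = (\<lambda>a b. \<exists>B. \<forall>t\<in>{a..b} \<inter> {0..c}. \<bar>f t\<bar> \<le> B)"
  have "P 0 c"
    using True
  proof (induction rule: Bolzano)
    case (trans x y z)
    from trans(1,2) obtain B1 B2 where
      "\<forall>t\<in>{x..y} \<inter> {0..c}. \<bar>f t\<bar> \<le> B1" "\<forall>t\<in>{y..z} \<inter> {0..c}. \<bar>f t\<bar> \<le> B2"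
      unfolding P_def by blast
    then have "\<bar>f t\<bar> \<le> max B1 B2" if "t \<in> {x..z} \<inter> {0..c}" for t
      using that by (cases "t \<le> y") (auto simp: le_max_iff_disj)
    then show ?case
      unfolding P_def by blast
  next
    case (local x)
    then have x: "x \<in> {0..c}" by auto
    with assms obtain l where
      r: "(f \<longlongrightarrow> f x) (at x within {x..c})" and l: "(f \<longlongrightarrow> l) (at x within {0..<x})"
      unfolding skorokhod_space_def by blast
    from tendstoD[OF r zero_less_one] obtain d1 where d1: "d1 > 0"
      "\<forall>t\<in>{x..c}. t \<noteq> x \<and> dist t x < d1 \<longrightarrow> dist (f t) (f x) < 1"
      unfolding eventually_at by blast
    from tendstoD[OF l zero_less_one] obtain d2 where d2: "d2 > 0"
      "\<forall>t\<in>{0..<x}. t \<noteq> x \<and> dist t x < d2 \<longrightarrow> dist (f t) l < 1"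
      unfolding eventually_at by blast
    have "P a b" if ab: "a \<le> x \<and> x \<le> b \<and> b - a < min d1 d2" for a b
    proof -
      have "\<bar>f t\<bar> \<le> \<bar>f x\<bar> + \<bar>l\<bar> + 1" if t: "t \<in> {a..b} \<inter> {0..c}" for t
      proof (cases t x rule: linorder_cases)
        case less
        then have "dist (f t) l < 1" using d2(2) t ab by (auto simp: dist_real_def)
        then show ?thesis by (auto simp: dist_real_def)
      next
        case greater
        then have "dist (f t) (f x) < 1" using d1(2) t ab by (auto simp: dist_real_def)
        then show ?thesis by (auto simp: dist_real_def)
      qed simp
      then show ?thesis unfolding P_def by blast
    qed
    then show ?case
      using d1(1) d2(1) by (intro exI[of _ "min d1 d2"]) auto
  qed
  then show ?thesis unfolding P_def by auto
qed simp

lemma time_changes_id: "(\<lambda>t. t) \<in> time_changes c"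
  by (auto simp: time_changes_def strict_mono_on_def)

lemma skorokhod_close_ex:
  assumes "f \<in> skorokhod_space c" "g \<in> skorokhod_space c"
  shows "\<exists>e. skorokhod_close c f g e"
proof -
  obtain A B where AB: "\<forall>t\<in>{0..c}. \<bar>f t\<bar> \<le> A" "\<forall>t\<in>{0..c}. \<bar>g t\<bar> \<le> B"
    using assms[THEN skorokhod_space_bounded] by blast
  have "\<bar>f t - g t\<bar> \<le> max 1 (A + B)" if "t \<in> {0..c}" for t
    using bspec[OF AB(1) that] bspec[OF AB(2) that] by linarith
  then show ?thesis
    unfolding skorokhod_close_def
    by (intro exI[of _ "max 1 (A + B)"] conjI bexI[of _ "\<lambda>t. t"] time_changes_id) auto
qed

lemma skorokhod_close_commute:
  assumes "skorokhod_close c f g e"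
  shows "skorokhod_close c g f e"
proof -
  from assms obtain u where e: "0 < e" and u: "strict_mono_on {0..c} u" "continuous_on {0..c} u"
    "u ` {0..c} = {0..c}" and *: "\<forall>t\<in>{0..c}. \<bar>u t - t\<bar> \<le> e \<and> \<bar>f (u t) - g t\<bar> \<le> e"
    unfolding skorokhod_close_def time_changes_def by blast
  define v where "v = the_inv_into {0..c} u"
  have inj: "inj_on u {0..c}" by (rule strict_mono_on_imp_inj_on[OF u(1)])
  have uv: "u (v t) = t" "v t \<in> {0..c}" if "t \<in> {0..c}" for t
    using that f_the_inv_into_f[OF inj, of t] the_inv_into_into[OF inj, of t "{0..c}"]
    by (simp_all add: u(3) v_def)
  have vu: "v (u t) = t" if "t \<in> {0..c}" for t
    using the_inv_into_f_f[OF inj that] by (simp add: v_def)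
  have "strict_mono_on {0..c} v"
  proof (rule strict_mono_onI)
    fix r s assume rs: "r \<in> {0..c}" "s \<in> {0..c}" "r < s"
    show "v r < v s"
    proof (rule ccontr)
      assume "\<not> v r < v s"
      then have "u (v s) \<le> u (v r)"
        using strict_mono_onD[OF u(1), of "v s" "v r"] uv(2)[OF rs(1)] uv(2)[OF rs(2)]
        by (cases "v s = v r") auto
      then show False using uv(1) rs by auto
    qed
  qed
  moreover have "continuous_on {0..c} v"
    using continuous_on_inv_into[OF u(2) _ inj] by (simp add: u(3) v_def)
  moreover have "v ` {0..c} = {0..c}"
  proof
    show "v ` {0..c} \<subseteq> {0..c}" using uv(2) by blast
    show "{0..c} \<subseteq> v ` {0..c}"
    proof
      fix t assume t: "t \<in> {0..c}"
      then have "u t \<in> {0..c}" using u(3) by blast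
      then show "t \<in> v ` {0..c}" using vu[OF t] by (intro image_eqI[of t v "u t"]) auto
    qed
  qed
  ultimately have "v \<in> time_changes c" by (simp add: time_changes_def)
  moreover have "\<bar>v t - t\<bar> \<le> e \<and> \<bar>g (v t) - f t\<bar> \<le> e" if "t \<in> {0..c}" for t
    using bspec[OF * uv(2)[OF that]] uv(1)[OF that] by (simp add: abs_minus_commute)
  ultimately show ?thesis
    unfolding skorokhod_close_def using e by blast
qed

lemma skorokhod_close_trans:
  assumes "skorokhod_close c f g d" "skorokhod_close c g h e"
  shows "skorokhod_close c f h (d + e)"
proof -
  from assms obtain u v where d: "0 < d" and e: "0 < e"
    and u: "u \<in> time_changes c" "\<forall>t\<in>{0..c}. \<bar>u t - t\<bar> \<le> d \<and> \<bar>f (u t) - g t\<bar> \<le> d"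
    and v: "v \<in> time_changes c" "\<forall>t\<in>{0..c}. \<bar>v t - t\<bar> \<le> e \<and> \<bar>g (v t) - h t\<bar> \<le> e"
    unfolding skorokhod_close_def by blast
  have vI: "v t \<in> {0..c}" if "t \<in> {0..c}" for t
    using v(1) that unfolding time_changes_def by blast
  have "(\<lambda>t. u (v t)) \<in> time_changes c"
    unfolding time_changes_def
  proof (intro CollectI conjI)
    show "strict_mono_on {0..c} (\<lambda>t. u (v t))"
    proof (rule strict_mono_onI)
      fix r s assume rs: "r \<in> {0..c}" "s \<in> {0..c}" "r < s"
      have mono: "strict_mono_on {0..c} u" "strict_mono_on {0..c} v"
        using u(1) v(1) by (simp_all add: time_changes_def)
      show "u (v r) < u (v s)"
        by (rule strict_mono_onD[OF mono(1) vI[OF rs(1)] vI[OF rs(2)] strict_mono_onD[OF mono(2) rs]])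
    qed
    show "continuous_on {0..c} (\<lambda>t. u (v t))"
    proof (rule continuous_on_compose2[of "{0..c}" u "{0..c}" v])
      show "continuous_on {0..c} u" "continuous_on {0..c} v"
        using u(1) v(1) by (simp_all add: time_changes_def)
      show "v ` {0..c} \<subseteq> {0..c}" using vI by blast
    qed
    have "(\<lambda>t. u (v t)) ` {0..c} = u ` v ` {0..c}" by (simp add: image_image)
    then show "(\<lambda>t. u (v t)) ` {0..c} = {0..c}"
      using u(1) v(1) by (simp add: time_changes_def)
  qed
  moreover have "\<bar>u (v t) - t\<bar> \<le> d + e \<and> \<bar>f (u (v t)) - h t\<bar> \<le> d + e" if "t \<in> {0..c}" for t
    using bspec[OF u(2) vI[OF that]] bspec[OF v(2) that] by linarith
  ultimately show ?thesis
    unfolding skorokhod_close_def using d e by (intro conjI bexI[of _ "\<lambda>t. u (v t)"] ballI) auto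
qed

lemma skorokhod_dist_eq:
  assumes "f \<in> skorokhod_space c" "g \<in> skorokhod_space c"
  shows "skorokhod_dist c f g = Inf (Collect (skorokhod_close c f g))"
  using assms by (simp add: skorokhod_dist_def)

lemma skorokhod_dist_le:
  assumes "f \<in> skorokhod_space c" "g \<in> skorokhod_space c" "skorokhod_close c f g e"
  shows "skorokhod_dist c f g \<le> e"
  unfolding skorokhod_dist_eq[OF assms(1,2)] using assms(3)
  by (intro cInf_lower bdd_belowI[of _ 0]) (auto simp: skorokhod_close_def)

lemma skorokhod_dist_less:
  assumes "f \<in> skorokhod_space c" "g \<in> skorokhod_space c" "skorokhod_dist c f g < e"
  shows "\<exists>d<e. skorokhod_close c f g d"
  using assms(3) skorokhod_close_ex[OF assms(1,2)]
  unfolding skorokhod_dist_eq[OF assms(1,2)] by (subst (asm) cInf_less_iff)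
    (auto intro!: bdd_belowI[of _ 0] simp: skorokhod_close_def)

lemma skorokhod_dist_zero:
  assumes f: "f \<in> skorokhod_space c" and g: "g \<in> skorokhod_space c"
    and zero: "skorokhod_dist c f g = 0"
  shows "f = g"
proof (rule extensionalityI[of _ "{0..c}"])
  show "f \<in> extensional {0..c}" "g \<in> extensional {0..c}"
    using f g by (auto simp: skorokhod_space_def)
  fix t assume t: "t \<in> {0..c}"
  have close: "\<exists>u\<in>time_changes c. \<forall>s\<in>{0..c}. \<bar>u s - s\<bar> \<le> e \<and> \<bar>f (u s) - g s\<bar> \<le> e" if e: "e > 0" for e
  proof -
    obtain d where d: "d < e" "skorokhod_close c f g d"
      using skorokhod_dist_less[OF f g, of e] zero e by auto
    then obtain u where u: "u \<in> time_changes c"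
      and *: "\<forall>s\<in>{0..c}. \<bar>u s - s\<bar> \<le> d \<and> \<bar>f (u s) - g s\<bar> \<le> d"
      unfolding skorokhod_close_def by blast
    have "\<bar>u s - s\<bar> \<le> e \<and> \<bar>f (u s) - g s\<bar> \<le> e" if "s \<in> {0..c}" for s
      using bspec[OF * that] d(1) by linarith
    with u show ?thesis by blast
  qed
  show "f t = g t"
  proof (rule ccontr)
    assume "f t \<noteq> g t"
    define e where "e = \<bar>f t - g t\<bar> / 3"
    have e: "e > 0" using \<open>f t \<noteq> g t\<close> by (simp add: e_def)
    have fr: "(f \<longlongrightarrow> f t) (at t within {t..c})" and gr: "(g \<longlongrightarrow> g t) (at t within {t..c})"
      using f g t by (auto simp: skorokhod_space_def)
    from tendstoD[OF fr e] obtain d1 where d1: "d1 > 0"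
      "\<forall>s\<in>{t..c}. s \<noteq> t \<and> dist s t < d1 \<longrightarrow> dist (f s) (f t) < e"
      unfolding eventually_at by blast
    from tendstoD[OF gr e] obtain d2 where d2: "d2 > 0"
      "\<forall>s\<in>{t..c}. s \<noteq> t \<and> dist s t < d2 \<longrightarrow> dist (g s) (g t) < e"
      unfolding eventually_at by blast
    show False
    proof (cases "t = c")
      case True
      obtain u where u: "u \<in> time_changes c" and *: "\<forall>s\<in>{0..c}. \<bar>u s - s\<bar> \<le> e \<and> \<bar>f (u s) - g s\<bar> \<le> e"
        using close[OF e] by blast
      have "u c = c"
      proof (rule ccontr)
        assume "u c \<noteq> c"
        have img: "u ` {0..c} = {0..c}" and mono: "strict_mono_on {0..c} u"
          using u by (auto simp: time_changes_def)
        have c: "c \<in> {0..c}" using t by auto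
        then obtain s where s: "s \<in> {0..c}" "u s = c" using img by (metis imageE)
        then have "s < c" using \<open>u c \<noteq> c\<close> by (cases "s = c") auto
        then have "c < u c" using strict_mono_onD[OF mono s(1) c] s(2) by simp
        moreover have "u c \<in> {0..c}" using img c by blast
        ultimately show False by simp
      qed
      then have "\<bar>f t - g t\<bar> \<le> e" using * t True by force
      then show False using e by (simp add: e_def)
    next
      case False
      define h where "h = min (min d1 d2) (c - t) / 3"
      have h: "h > 0" using d1(1) d2(1) False t by (auto simp: h_def)
      have hb: "3 * h \<le> d1" "3 * h \<le> d2" "3 * h \<le> c - t" by (auto simp: h_def)
      obtain u where u: "u \<in> time_changes c"
        and *: "\<forall>s\<in>{0..c}. \<bar>u s - s\<bar> \<le> min e (h / 2) \<and> \<bar>f (u s) - g s\<bar> \<le> min e (h / 2)"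
        using close[of "min e (h / 2)"] e h by auto
      define s where "s = t + h"
      have s: "s \<in> {0..c}" "s \<in> {t..c}" "s \<noteq> t" "dist s t < d2"
        using t h hb by (auto simp: s_def dist_real_def)
      have us: "u s \<in> {t..c}" "u s \<noteq> t" "dist (u s) t < d1" "\<bar>f (u s) - g s\<bar> \<le> e"
        using bspec[OF * s(1)] h hb by (auto simp: s_def dist_real_def abs_if split: if_splits)
      have "\<bar>f (u s) - f t\<bar> < e" "\<bar>g s - g t\<bar> < e"
        using d1(2) d2(2) s us by (auto simp: dist_real_def)
      then have "\<bar>f t - g t\<bar> < 3 * e" using us(4) by linarith
      then show False by (simp add: e_def)
    qed
  qed
qed

lemma Metric_space_skorokhod: "Metric_space (skorokhod_space c) (skorokhod_dist c)"
proof
  fix f g h :: "real \<Rightarrow> real"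
  show "0 \<le> skorokhod_dist c f g"
  proof (cases "f \<in> skorokhod_space c \<and> g \<in> skorokhod_space c")
    case True
    show ?thesis
    proof -
      have "Collect (skorokhod_close c f g) \<noteq> {}" using skorokhod_close_ex[of f c g] True by simp
      moreover have "0 \<le> e" if "e \<in> Collect (skorokhod_close c f g)" for e
        using that by (simp add: skorokhod_close_def)
      ultimately have "0 \<le> Inf (Collect (skorokhod_close c f g))" by (rule cInf_greatest)
      then show ?thesis using True by (simp add: skorokhod_dist_eq)
    qed
  qed (auto simp: skorokhod_dist_def)
  have "skorokhod_close c f g = skorokhod_close c g f"
    using skorokhod_close_commute by blast
  then show "skorokhod_dist c f g = skorokhod_dist c g f"
    by (cases "f \<in> skorokhod_space c \<and> g \<in> skorokhod_space c")
      (auto simp: skorokhod_dist_eq, auto simp: skorokhod_dist_def)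
  assume fg: "f \<in> skorokhod_space c" "g \<in> skorokhod_space c"
  show "skorokhod_dist c f g = 0 \<longleftrightarrow> f = g"
  proof
    assume "f = g"
    have "skorokhod_dist c f f \<le> 0 + e" if "e > 0" for e
      unfolding add_0
    proof (rule skorokhod_dist_le[OF fg(1) fg(1)])
      show "skorokhod_close c f f e"
        unfolding skorokhod_close_def using that
        by (intro conjI bexI[of _ "\<lambda>t. t"] time_changes_id) auto
    qed
    then have "skorokhod_dist c f f \<le> 0" by (rule field_le_epsilon)
    then show "skorokhod_dist c f g = 0"
      using \<open>0 \<le> skorokhod_dist c f g\<close> \<open>f = g\<close> by simp
  qed (rule skorokhod_dist_zero[OF fg])
  assume h: "h \<in> skorokhod_space c"
  show "skorokhod_dist c f h \<le> skorokhod_dist c f g + skorokhod_dist c g h"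
  proof (rule field_le_epsilon)
    fix e :: real assume e: "e > 0"
    obtain d1 where d1: "d1 < skorokhod_dist c f g + e / 2" "skorokhod_close c f g d1"
      using skorokhod_dist_less[OF fg, of "skorokhod_dist c f g + e / 2"] e by auto
    obtain d2 where d2: "d2 < skorokhod_dist c g h + e / 2" "skorokhod_close c g h d2"
      using skorokhod_dist_less[OF fg(2) h, of "skorokhod_dist c g h + e / 2"] e by auto
    have "skorokhod_dist c f h \<le> d1 + d2"
      by (rule skorokhod_dist_le[OF fg(1) h skorokhod_close_trans[OF d1(2) d2(2)]])
    then show "skorokhod_dist c f h \<le> skorokhod_dist c f g + skorokhod_dist c g h + e"
      using d1(1) d2(1) by linarith
  qed
qed

section \<open>Convergence in distribution\<close>

definition borel_of :: "'b topology \<Rightarrow> 'b measure" where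
  "borel_of X = sigma (topspace X) {U. openin X U}"

text \<open>The random elements may live on different probability spaces. Measurability is part of the
  definition, so that the expectations are never the default value of a non-integrable function;
  finitely many terms of the sequence are disregarded.\<close>

definition converges_in_distribution ::
    "'b topology \<Rightarrow> (nat \<Rightarrow> 'a measure) \<Rightarrow> (nat \<Rightarrow> 'a \<Rightarrow> 'b) \<Rightarrow> 'c measure \<Rightarrow> ('c \<Rightarrow> 'b) \<Rightarrow> bool" where
  "converges_in_distribution X P Y Q Z \<longleftrightarrow>
     (\<forall>\<^sub>F n in sequentially. prob_space (P n) \<and> Y n \<in> P n \<rightarrow>\<^sub>M borel_of X) \<and>
     prob_space Q \<and> Z \<in> Q \<rightarrow>\<^sub>M borel_of X \<and>
     (\<forall>\<phi> :: 'b \<Rightarrow> real. continuous_map X euclideanreal \<phi> \<and> bounded (\<phi> ` topspace X) \<longrightarrow>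
        (\<lambda>n. \<integral>\<omega>. \<phi> (Y n \<omega>) \<partial>P n) \<longlonglongrightarrow> (\<integral>\<omega>. \<phi> (Z \<omega>) \<partial>Q))"

section \<open>Brownian motion\<close>

definition standard_brownian_motion :: "'a measure \<Rightarrow> (real \<Rightarrow> 'a \<Rightarrow> real) \<Rightarrow> bool" where
  "standard_brownian_motion Q B \<longleftrightarrow>
     prob_space Q \<and>
     (\<forall>t\<ge>0. B t \<in> borel_measurable Q) \<and>
     (AE \<omega> in Q. B 0 \<omega> = 0) \<and>
     (\<forall>s t. 0 \<le> s \<and> s < t \<longrightarrow>
        distributed Q lborel (\<lambda>\<omega>. B t \<omega> - B s \<omega>) (normal_density 0 (sqrt (t - s)))) \<and>
     (\<forall>k (\<tau> :: nat \<Rightarrow> real). 0 \<le> \<tau> 0 \<and> (\<forall>i<k. \<tau> i < \<tau> (Suc i)) \<longrightarrow>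
        prob_space.indep_vars Q (\<lambda>_. borel) (\<lambda>i \<omega>. B (\<tau> (Suc i)) \<omega> - B (\<tau> i) \<omega>) {..<k}) \<and>
     (\<forall>\<omega>\<in>space Q. continuous_on {0..} (\<lambda>t. B t \<omega>))"

end

(* Let N(t) be the number of edges at time t. Then K(t) = n - N(t) + (surplus), and the surplus is at
   most the number of edges lying on a cycle. Below the critical time, removing one vertex at a time
   shows that i and j are connected with probability at most c z_i z_j / (1 - c sum z^2), whence the
   expected number of edges on cycles stays bounded and the surplus disappears at the scale sqrt n.

   N(t) counts independent clocks. Its mean is t l_n / 2 + O(1), and l_n = n E[W] + o(sqrt n) because the
   error of the monotone Riemann sum is at most the integral of the quantile function over
   (1 - 1/n, 1), which is o(n^{-1/2}) by the second moment. The fourth moments of the increments of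
   N - E[N] and a dyadic chaining argument control the modulus of continuity in expectation; below the
   scale 1/n the monotonicity of N suffices. The increments over a fixed grid are asymptotically
   independent normal by characteristic functions. Both facts together give convergence of the
   expectations of bounded Lipschitz functions on D([0,c]), which is enough. *)

theory Submission
  imports Defs "HOL-Real_Asymp.Real_Asymp"
begin

section \<open>The space \<open>D([0,c])\<close>\<close>

text \<open>The sum of the squared masses is asymptotically at most E[W^2] / E[W]. This is where the
  critical time comes from: below it, \<open>c\<close> times the sum stays under 1 and the recursion
  for connection probabilities closes. No bound on the largest rate is used. Everything goes through
  the total rate, of order n, and the sum of the squared rates, which is at most the square of the
  sum of the squared masses and hence bounded. The chaining must stop at a mesh of order 1/n: a
  count with expectation A has a fourth central moment of order A + A^2, and the Poisson-like term A
  dominates for small A. No compactness argument on the path space occurs. The rescaled component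
  path is compared, in expected uniform distance, with a step path of finitely many increments.
  Genuine time changes are needed only because a path with jumps is the J_1 limit, though not the
  uniform limit, of its grid versions; this makes a random path measurable as soon as its
  coordinates are.\<close>

text \<open>With finitely many clocks the set of those that have rung is locally constant on either
  side of \<open>t\<close>: to the right it equals its value at \<open>t\<close> because the
  comparison is weak, to the left it equals the set with the strict comparison. Component paths,
  grid paths and continuous paths (no clocks) are instances.\<close>

lemma skorokhod_space_step:
  fixes \<tau> :: "'e \<Rightarrow> ereal"
  assumes E: "finite E" and h: "continuous_on {0..c} h"
  shows "(\<lambda>t\<in>{0..c}. H {e \<in> E. \<tau> e \<le> ereal t} + h t) \<in> skorokhod_space c"
proof -
  let ?f = "\<lambda>t\<in>{0..c}. H {e \<in> E. \<tau> e \<le> ereal t} + h t"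
  have "(?f \<longlongrightarrow> ?f t) (at t within {t..c}) \<and> (\<exists>l. (?f \<longlongrightarrow> l) (at t within {0..<t}))"
    if t: "t \<in> {0..c}" for t
  proof
    have ht: "(h \<longlongrightarrow> h t) (at t within {0..c})"
      using h t by (simp add: continuous_on_def)
    have er: "((\<lambda>s. ereal s) \<longlongrightarrow> ereal t) (at t within S)" for S
      by (intro tendsto_intros)
    have "\<forall>\<^sub>F s in at t within {t..c}. \<forall>e\<in>E. \<not> \<tau> e \<le> t \<longrightarrow> ereal s < \<tau> e"
      using E order_tendstoD(2)[OF er] by (intro eventually_ball_finite) (auto simp: not_le)
    moreover have "\<forall>\<^sub>F s in at t within {t..c}. s \<in> {t..c}"
      by (simp add: eventually_at_filter)
    ultimately have "\<forall>\<^sub>F s in at t within {t..c}. H {e \<in> E. \<tau> e \<le> ereal t} + h s = ?f s"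
    proof eventually_elim
      case (elim s)
      have "\<tau> e \<le> ereal s \<longleftrightarrow> \<tau> e \<le> ereal t" if "e \<in> E" for e
        using elim that order_trans[of "\<tau> e" "ereal t" "ereal s"] by (auto simp: not_le[symmetric])
      then have "{e \<in> E. \<tau> e \<le> ereal s} = {e \<in> E. \<tau> e \<le> ereal t}" by blast
      then show ?case using elim t by auto
    qed
    moreover have "((\<lambda>s. H {e \<in> E. \<tau> e \<le> ereal t} + h s) \<longlongrightarrow> ?f t) (at t within {t..c})"
      using t by (auto intro!: tendsto_intros tendsto_within_subset[OF ht])
    ultimately show "(?f \<longlongrightarrow> ?f t) (at t within {t..c})"
      by (blast intro: Lim_transform_eventually)
  next
    have ht: "(h \<longlongrightarrow> h t) (at t within {0..c})"
      using h t by (simp add: continuous_on_def)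
    have er: "((\<lambda>s. ereal s) \<longlongrightarrow> ereal t) (at t within S)" for S
      by (intro tendsto_intros)
    have "\<forall>\<^sub>F s in at t within {0..<t}. \<forall>e\<in>E. \<tau> e < t \<longrightarrow> \<tau> e < ereal s"
      using E order_tendstoD(1)[OF er] by (intro eventually_ball_finite) auto
    moreover have "\<forall>\<^sub>F s in at t within {0..<t}. s \<in> {0..<t}"
      by (simp add: eventually_at_filter)
    ultimately have "\<forall>\<^sub>F s in at t within {0..<t}. H {e \<in> E. \<tau> e < ereal t} + h s = ?f s"
    proof eventually_elim
      case (elim s)
      have "\<tau> e \<le> ereal s \<longleftrightarrow> \<tau> e < ereal t" if "e \<in> E" for e
        using elim that le_less_trans[of "\<tau> e" "ereal s" "ereal t"] by (auto simp: less_imp_le)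
      then have "{e \<in> E. \<tau> e \<le> ereal s} = {e \<in> E. \<tau> e < ereal t}" by blast
      then show ?case using elim t by auto
    qed
    moreover have "((\<lambda>s. H {e \<in> E. \<tau> e < ereal t} + h s) \<longlongrightarrow> H {e \<in> E. \<tau> e < ereal t} + h t)
        (at t within {0..<t})"
      by (intro tendsto_intros tendsto_within_subset[OF ht]) (use t in auto)
    ultimately show "\<exists>l. (?f \<longlongrightarrow> l) (at t within {0..<t})"
      by (blast intro: Lim_transform_eventually)
  qed
  then show ?thesis by (simp add: skorokhod_space_def)
qed

text \<open>The identity is an admissible time change. \<open>skorokhod_close\<close> asks for a
  positive bound, so \<open>e\<close> is reached through \<open>e + d\<close> with \<open>d\<close>
  tending to 0.\<close>

lemma skorokhod_dist_le_sup:
  assumes f: "f \<in> skorokhod_space c" and g: "g \<in> skorokhod_space c"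
    and "0 \<le> e" and le: "\<And>t. t \<in> {0..c} \<Longrightarrow> \<bar>f t - g t\<bar> \<le> e"
  shows "skorokhod_dist c f g \<le> e"
proof (rule field_le_epsilon)
  fix d :: real assume "d > 0"
  have "\<bar>f t - g t\<bar> \<le> e + d" if "t \<in> {0..c}" for t
    using le[OF that] \<open>d > 0\<close> by linarith
  then have "skorokhod_close c f g (e + d)"
    unfolding skorokhod_close_def using \<open>0 \<le> e\<close> \<open>d > 0\<close>
    by (intro conjI bexI[of _ "\<lambda>t. t"] time_changes_id) auto
  then show "skorokhod_dist c f g \<le> e + d"
    by (rule skorokhod_dist_le[OF f g])
qed

section \<open>Time changes and approximation of cadlag functions on a grid\<close>

lemma tent_lipschitz:
  fixes r s t t' :: real
  assumes "r > 0"
  shows "\<bar>max 0 (1 - \<bar>t' - s\<bar> / r) - max 0 (1 - \<bar>t - s\<bar> / r)\<bar> \<le> \<bar>t' - t\<bar> / r"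
proof -
  have "\<bar>max 0 (1 - \<bar>t' - s\<bar> / r) - max 0 (1 - \<bar>t - s\<bar> / r)\<bar> \<le> \<bar>\<bar>t' - s\<bar> / r - \<bar>t - s\<bar> / r\<bar>"
    by linarith
  also have "\<dots> = \<bar>\<bar>t' - s\<bar> - \<bar>t - s\<bar>\<bar> / r"
    using assms by (simp add: diff_divide_distrib[symmetric] abs_divide)
  also have "\<dots> \<le> \<bar>t' - t\<bar> / r"
    using assms by (intro divide_right_mono) auto
  finally show ?thesis .
qed

text \<open>The time change adds to the identity one tent at each prescribed point, vanishing at the other ones.\<close>

lemma time_change_interpolating:
  assumes S: "finite S" "0 \<in> S" "c \<in> S" and R: "R 0 = 0" "R c = c" and c: "0 \<le> c"
    and r: "0 < r" "\<And>s s'. s \<in> S \<Longrightarrow> s' \<in> S \<Longrightarrow> s \<noteq> s' \<Longrightarrow> r \<le> \<bar>s - s'\<bar>"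
    and small: "(\<Sum>s\<in>S. \<bar>R s - s\<bar>) < r"
  obtains \<mu> where "\<mu> \<in> time_changes c" "\<And>s. s \<in> S \<Longrightarrow> \<mu> s = R s"
    "\<And>t. \<bar>\<mu> t - t\<bar> \<le> (\<Sum>s\<in>S. \<bar>R s - s\<bar>)"
proof -
  define \<mu> where "\<mu> t = t + (\<Sum>s\<in>S. (R s - s) * max 0 (1 - \<bar>t - s\<bar> / r))" for t
  \<comment> \<open>The tents have slope 1 / r, so by \<open>small\<close> the difference of \<mu>
    and the identity has a Lipschitz constant below 1, and \<mu> stays strictly increasing.\<close>
  have mono: "\<mu> t < \<mu> t'" if "t < t'" for t t'
  proof -
    have "\<bar>(\<mu> t' - t') - (\<mu> t - t)\<bar> =
        \<bar>\<Sum>s\<in>S. (R s - s) * (max 0 (1 - \<bar>t' - s\<bar> / r) - max 0 (1 - \<bar>t - s\<bar> / r))\<bar>"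
      by (simp add: \<mu>_def sum_subtractf right_diff_distrib)
    also have "\<dots> \<le> (\<Sum>s\<in>S. \<bar>R s - s\<bar> * (\<bar>t' - t\<bar> / r))"
      by (intro order_trans[OF sum_abs] sum_mono, unfold abs_mult)
        (intro mult_left_mono tent_lipschitz r abs_ge_zero)
    also have "\<dots> = (\<Sum>s\<in>S. \<bar>R s - s\<bar>) * ((t' - t) / r)"
      using that by (simp only: sum_distrib_right abs_of_pos diff_gt_0_iff_gt)
    also have "\<dots> < r * ((t' - t) / r)"
      using that r small by (intro mult_strict_right_mono) auto
    also have "\<dots> = t' - t" using r by simp
    finally show ?thesis by linarith
  qed
  have at: "\<mu> s = R s" if "s \<in> S" for s
  proof -
    have "(\<Sum>s'\<in>S. (R s' - s') * max 0 (1 - \<bar>s - s'\<bar> / r)) = (\<Sum>s'\<in>S. if s' = s then R s - s else 0)"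
    proof (rule sum.cong[OF refl])
      fix s' assume "s' \<in> S"
      then show "(R s' - s') * max 0 (1 - \<bar>s - s'\<bar> / r) = (if s' = s then R s - s else 0)"
        using r(2)[OF that, of s'] r(1) by (auto simp: max_def field_simps)
    qed
    then show ?thesis using S(1) that by (simp add: \<mu>_def)
  qed
  have dev: "\<bar>\<mu> t - t\<bar> \<le> (\<Sum>s\<in>S. \<bar>R s - s\<bar>)" for t
  proof -
    have "\<bar>\<mu> t - t\<bar> \<le> (\<Sum>s\<in>S. \<bar>R s - s\<bar> * 1)"
      unfolding \<mu>_def add_diff_cancel_left' using r(1)
      by (intro order_trans[OF sum_abs] sum_mono, unfold abs_mult)
        (intro mult_left_mono abs_ge_zero, auto)
    then show ?thesis by simp
  qed
  have cont: "continuous_on A \<mu>" for A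
    unfolding \<mu>_def by (intro continuous_intros) (use r in auto)
  have "\<mu> \<in> time_changes c"
    unfolding time_changes_def
  proof (intro CollectI conjI)
    show "strict_mono_on {0..c} \<mu>" by (auto intro!: strict_mono_onI mono)
    show "continuous_on {0..c} \<mu>" by (rule cont)
    have ends: "\<mu> 0 = 0" "\<mu> c = c" using at S R by auto
    show "\<mu> ` {0..c} = {0..c}"
    proof
      have "mono \<mu>" using mono by (intro strict_mono_mono strict_monoI)
      then show "\<mu> ` {0..c} \<subseteq> {0..c}"
        using monoD[of \<mu> 0] monoD[of \<mu> _ c] unfolding ends by force
      show "{0..c} \<subseteq> \<mu> ` {0..c}"
      proof
        fix y assume "y \<in> {0..c}"
        then obtain x where "0 \<le> x" "x \<le> c" "\<mu> x = y"
          using IVT'[of \<mu> 0 y c] ends c cont by auto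
        then show "y \<in> \<mu> ` {0..c}" by auto
      qed
    qed
  qed
  then show ?thesis using at dev that by blast
qed

text \<open>Bisection: near \<open>x\<close> the function stays within e / 2 of its left limit on
  the left and of \<open>f x\<close> on the right, so the single point \<open>x\<close> separates
  the two regimes. The interval \<open>{t<..t'}\<close> is open on the left because a jump at
  \<open>t\<close> is already contained in \<open>f t\<close>, whereas a jump at \<open>t'\<close>
  is not.\<close>

lemma skorokhod_space_partition:
  assumes f: "f \<in> skorokhod_space c" and c: "0 \<le> c" and e: "e > 0"
  obtains S where "finite S" "0 \<in> S" "c \<in> S"
    "\<And>t t'. 0 \<le> t \<Longrightarrow> t \<le> t' \<Longrightarrow> t' \<le> c \<Longrightarrow> {t<..t'} \<inter> S = {} \<Longrightarrow> \<bar>f t - f t'\<bar> \<le> e"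
proof -
  define P where "P a b \<longleftrightarrow> (\<exists>S. finite S \<and>
    (\<forall>t t'. t \<in> {a..b} \<inter> {0..c} \<and> t' \<in> {a..b} \<inter> {0..c} \<and> t \<le> t' \<and> {t<..t'} \<inter> S = {} \<longrightarrow> \<bar>f t - f t'\<bar> \<le> e))"
    for a b
  have "P 0 c"
    using c
  proof (induction rule: Bolzano)
    case (trans x y z)
    from trans(1) obtain S1 where S1: "finite S1"
      and 1: "\<And>t t'. t \<in> {x..y} \<inter> {0..c} \<and> t' \<in> {x..y} \<inter> {0..c} \<and> t \<le> t' \<and> {t<..t'} \<inter> S1 = {} \<Longrightarrow> \<bar>f t - f t'\<bar> \<le> e"
      unfolding P_def by metis
    from trans(2) obtain S2 where S2: "finite S2"
      and 2: "\<And>t t'. t \<in> {y..z} \<inter> {0..c} \<and> t' \<in> {y..z} \<inter> {0..c} \<and> t \<le> t' \<and> {t<..t'} \<inter> S2 = {} \<Longrightarrow> \<bar>f t - f t'\<bar> \<le> e"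
      unfolding P_def by metis
    show ?case unfolding P_def
    \<comment> \<open>The midpoint \<open>y\<close> joins the exceptional set, so that an admissible
      pair lies entirely before \<open>y\<close> or entirely at or after it.\<close>
    proof (intro exI[of _ "insert y (S1 \<union> S2)"] conjI allI impI)
      fix t t' assume *: "t \<in> {x..z} \<inter> {0..c} \<and> t' \<in> {x..z} \<inter> {0..c} \<and> t \<le> t' \<and> {t<..t'} \<inter> insert y (S1 \<union> S2) = {}"
      then have "t' < y \<or> y \<le> t" by auto
      then show "\<bar>f t - f t'\<bar> \<le> e"
        using * by (elim disjE) (rule 1 2; auto)+
    qed (use S1 S2 in auto)
  next
    case (local x)
    then have x: "x \<in> {0..c}" by auto
    with f obtain l where
      r: "(f \<longlongrightarrow> f x) (at x within {x..c})" and l: "(f \<longlongrightarrow> l) (at x within {0..<x})"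
      unfolding skorokhod_space_def by blast
    have e2: "e / 2 > 0" using e by simp
    from tendstoD[OF r e2] obtain d1 where d1: "d1 > 0"
      "\<forall>t\<in>{x..c}. t \<noteq> x \<and> dist t x < d1 \<longrightarrow> dist (f t) (f x) < e / 2"
      unfolding eventually_at by blast
    from tendstoD[OF l e2] obtain d2 where d2: "d2 > 0"
      "\<forall>t\<in>{0..<x}. t \<noteq> x \<and> dist t x < d2 \<longrightarrow> dist (f t) l < e / 2"
      unfolding eventually_at by blast
    have "P a b" if ab: "a \<le> x \<and> x \<le> b \<and> b - a < min d1 d2" for a b
      unfolding P_def
    proof (intro exI[of _ "{x}"] conjI allI impI)
      fix t t' assume *: "t \<in> {a..b} \<inter> {0..c} \<and> t' \<in> {a..b} \<inter> {0..c} \<and> t \<le> t' \<and> {t<..t'} \<inter> {x} = {}"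
      have right: "\<bar>f u - f x\<bar> < e / 2" if "u \<in> {a..b} \<inter> {0..c}" "x \<le> u" for u
        using d1(2) that ab e by (cases "u = x") (auto simp: dist_real_def)
      have left: "\<bar>f u - l\<bar> < e / 2" if "u \<in> {a..b} \<inter> {0..c}" "u < x" for u
        using d2(2) that ab by (auto simp: dist_real_def)
      from * have "t' < x \<or> x \<le> t" by auto
      then show "\<bar>f t - f t'\<bar> \<le> e"
      proof
        assume "t' < x"
        then have "\<bar>f t - l\<bar> < e / 2" "\<bar>f t' - l\<bar> < e / 2" using left * by auto
        then show ?thesis by linarith
      next
        assume "x \<le> t"
        then have "\<bar>f t - f x\<bar> < e / 2" "\<bar>f t' - f x\<bar> < e / 2" using right * by auto
        then show ?thesis by linarith
      qed
    qed simp
    then show ?case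
      using d1(1) d2(1) by (intro exI[of _ "min d1 d2"]) auto
  qed
  then obtain S where "finite S" and
    "\<And>t t'. t \<in> {0..c} \<Longrightarrow> t' \<in> {0..c} \<Longrightarrow> t \<le> t' \<Longrightarrow> {t<..t'} \<inter> S = {} \<Longrightarrow> \<bar>f t - f t'\<bar> \<le> e"
    unfolding P_def by auto
  then show ?thesis
    by (intro that[of "insert 0 (insert c S)"]) auto
qed

text \<open>The value of \<open>f\<close> at the last multiple of \<open>c / m\<close> before \<open>t\<close>, written through the number of
  positive multiples passed, so that \<open>skorokhod_space_step\<close> applies.\<close>

definition grid_floor :: "real \<Rightarrow> nat \<Rightarrow> real \<Rightarrow> nat" where
  "grid_floor c m t = card {k \<in> {1..m}. ereal (real k * c / real m) \<le> ereal t}"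

definition grid_path :: "real \<Rightarrow> nat \<Rightarrow> (nat \<Rightarrow> real) \<Rightarrow> real \<Rightarrow> real" where
  "grid_path c m x = (\<lambda>t\<in>{0..c}. x (grid_floor c m t))"

lemma grid_path_in_space: "grid_path c m x \<in> skorokhod_space c"
  using skorokhod_space_step[of "{1..m}" c "\<lambda>_. 0" "\<lambda>A. x (card A)" "\<lambda>k. ereal (real k * c / real m)"]
  by (simp add: grid_path_def grid_floor_def cong: restrict_cong)

lemma grid_floor_eq:
  assumes c: "c > 0" and m: "m > 0" and t: "t \<in> {0..c}"
  shows "int (grid_floor c m t) = \<lfloor>t / (c / real m)\<rfloor>"
proof -
  define j where "j = nat \<lfloor>t / (c / real m)\<rfloor>"
  have j: "int j = \<lfloor>t / (c / real m)\<rfloor>" using c t by (simp add: j_def)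
  have "t / (c / real m) \<le> real m" using c t m by (simp add: field_simps)
  then have jm: "j \<le> m" unfolding j_def by linarith
  have "ereal (real k * c / real m) \<le> ereal t \<longleftrightarrow> k \<le> j" for k
  proof -
    have "real k * c / real m \<le> t \<longleftrightarrow> real k \<le> t / (c / real m)"
      using c m by (simp add: field_simps)
    also have "\<dots> \<longleftrightarrow> int k \<le> \<lfloor>t / (c / real m)\<rfloor>" by (simp add: le_floor_iff)
    finally show ?thesis unfolding j[symmetric] by simp
  qed
  then have "{k \<in> {1..m}. ereal (real k * c / real m) \<le> ereal t} = {1..j}"
    using jm by (simp only: atLeastAtMost_iff set_eq_iff mem_Collect_eq) (meson order_trans)
  then show ?thesis using j by (simp add: grid_floor_def)
qed

lemma grid_floor_le: "grid_floor c m t \<le> m"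
  using card_mono[of "{1..m}" "{k \<in> {1..m}. ereal (real k * c / real m) \<le> ereal t}"]
  unfolding grid_floor_def card_atLeastAtMost diff_Suc_1 by blast

lemma grid_floor_bounds:
  assumes c: "c > 0" and m: "m > 0" and t: "t \<in> {0..c}"
  shows "real (grid_floor c m t) * c / real m \<le> t" "t < real (Suc (grid_floor c m t)) * c / real m"
proof -
  have *: "real (grid_floor c m t) = of_int \<lfloor>t / (c / real m)\<rfloor>"
    using grid_floor_eq[OF assms] by (metis of_int_of_nat_eq)
  have "of_int \<lfloor>t / (c / real m)\<rfloor> \<le> t / (c / real m)" "t / (c / real m) < of_int \<lfloor>t / (c / real m)\<rfloor> + 1"
    by linarith+
  then have "of_int \<lfloor>t / (c / real m)\<rfloor> * (c / real m) \<le> t"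
    "t < (of_int \<lfloor>t / (c / real m)\<rfloor> + 1) * (c / real m)"
    using c m by (simp_all only: pos_le_divide_eq pos_divide_less_eq divide_pos_pos of_nat_0_less_iff)
  then show "real (grid_floor c m t) * c / real m \<le> t" "t < real (Suc (grid_floor c m t)) * c / real m"
    unfolding of_nat_Suc * by (simp_all only: times_divide_eq_right add.commute)
qed

text \<open>Uniform approximation fails at jumps off the grid. The time change therefore moves every
  point \<open>s\<close> of a finite partition up to the next grid point \<open>R s\<close>.
  Rounding up and rounding down are adjoint, so \<open>s \<le> t\<close> iff
  \<open>s \<le> g (\<mu> t)\<close> for partition points: none of them separates \<open>t\<close>
  from \<open>g (\<mu> t)\<close>, the time at which the grid path at \<open>\<mu> t\<close> reads
  \<open>f\<close>.\<close>

lemma grid_path_tendsto: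
  assumes f: "f \<in> skorokhod_space c" and c: "0 \<le> c"
  shows "(\<lambda>m. skorokhod_dist c (grid_path c m (\<lambda>k. f (real k * c / real m))) f) \<longlonglongrightarrow> 0"
proof (cases "c = 0")
  case True
  have "grid_path c m (\<lambda>k. f (real k * c / real m)) = f" for m
    using f True by (auto simp: grid_path_def skorokhod_space_def extensional_def)
  then show ?thesis
    using Metric_space.zero[OF Metric_space_skorokhod f f] by simp
next
  case False
  then have c0: "c > 0" using c by simp
  show ?thesis
  proof (rule tendstoI)
    fix e :: real assume "e > 0"
    define \<epsilon> where "\<epsilon> = e / 2"
    have \<epsilon>: "\<epsilon> > 0" "\<epsilon> < e" using \<open>e > 0\<close> by (auto simp: \<epsilon>_def)
    obtain S' where S': "finite S'" "0 \<in> S'" "c \<in> S'"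
      and osc': "\<And>t t'. 0 \<le> t \<Longrightarrow> t \<le> t' \<Longrightarrow> t' \<le> c \<Longrightarrow> {t<..t'} \<inter> S' = {} \<Longrightarrow> \<bar>f t - f t'\<bar> \<le> \<epsilon>"
      using skorokhod_space_partition[OF f c \<epsilon>(1)] by metis
    define S where "S = S' \<inter> {0..c}"
    have S: "finite S" "0 \<in> S" "c \<in> S" "S \<subseteq> {0..c}" using S' c by (auto simp: S_def)
    have osc: "\<bar>f t - f t'\<bar> \<le> \<epsilon>" if "0 \<le> t" "t \<le> t'" "t' \<le> c" "{t<..t'} \<inter> S = {}" for t t'
      using that by (intro osc') (auto simp: S_def)
    define D where "D = (\<lambda>(s, s'). \<bar>s - s'\<bar>) ` {(s, s'). s \<in> S \<and> s' \<in> S \<and> s \<noteq> s'}"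
    define r where "r = Min (insert 1 D)"
    have "finite {(s, s'). s \<in> S \<and> s' \<in> S \<and> s \<noteq> s'}"
      using S(1) by (intro finite_subset[OF _ finite_cartesian_product[OF S(1) S(1)]]) auto
    then have D: "finite (insert 1 D)" by (simp add: D_def)
    have "\<And>x. x \<in> insert 1 D \<Longrightarrow> 0 < x" by (auto simp: D_def)
    then have r0: "r > 0" unfolding r_def using D by (subst Min_gr_iff) auto
    have r: "r \<le> \<bar>s - s'\<bar>" if "s \<in> S" "s' \<in> S" "s \<noteq> s'" for s s'
      unfolding r_def by (rule Min_le[OF D]) (use that in \<open>auto simp: D_def\<close>)
    have "(\<lambda>m. real (card S) * (c / real m)) \<longlonglongrightarrow> 0"
      by real_asymp
    then have "\<forall>\<^sub>F m in sequentially. real (card S) * (c / real m) < min r \<epsilon>"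
      using r0 \<epsilon> by (intro order_tendstoD) auto
    then show "\<forall>\<^sub>F m in sequentially. dist (skorokhod_dist c (grid_path c m (\<lambda>k. f (real k * c / real m))) f) 0 < e"
      using eventually_gt_at_top[of 0]
    proof eventually_elim
      case (elim m)
      define \<delta> where "\<delta> = c / real m"
      have \<delta>: "\<delta> > 0" using c0 elim by (simp add: \<delta>_def)
      define R where "R s = \<delta> * of_int \<lceil>s / \<delta>\<rceil>" for s
      define g where "g x = \<delta> * of_int \<lfloor>x / \<delta>\<rfloor>" for x
      have Rc: "R 0 = 0" "R c = c" using c0 elim by (simp_all add: R_def \<delta>_def)
      have "\<bar>R s - s\<bar> \<le> \<delta>" for s
      proof -
        have "s / \<delta> \<le> of_int \<lceil>s / \<delta>\<rceil>" "of_int \<lceil>s / \<delta>\<rceil> \<le> s / \<delta> + 1" by linarith+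
        then have "\<delta> * (s / \<delta>) \<le> R s" "R s \<le> \<delta> * (s / \<delta> + 1)"
          unfolding R_def using \<delta> by (intro mult_left_mono; simp)+
        then show ?thesis using \<delta> by (simp add: distrib_left)
      qed
      then have sum: "(\<Sum>s\<in>S. \<bar>R s - s\<bar>) \<le> real (card S) * \<delta>"
        using sum_bounded_above[of S "\<lambda>s. \<bar>R s - s\<bar>" \<delta>] by simp
      then have "(\<Sum>s\<in>S. \<bar>R s - s\<bar>) < r" using elim by (simp add: \<delta>_def)
      then obtain \<mu> where \<mu>: "\<mu> \<in> time_changes c" "\<And>s. s \<in> S \<Longrightarrow> \<mu> s = R s"
        "\<And>t. \<bar>\<mu> t - t\<bar> \<le> (\<Sum>s\<in>S. \<bar>R s - s\<bar>)"
        using time_change_interpolating[OF S(1-3) Rc c r0 r] by blast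
      have RG: "R s \<le> x \<longleftrightarrow> s \<le> g x" for s x
      proof -
        have "R s \<le> x \<longleftrightarrow> of_int \<lceil>s / \<delta>\<rceil> \<le> x / \<delta>"
          using \<delta> by (simp add: R_def field_simps)
        also have "\<dots> \<longleftrightarrow> s / \<delta> \<le> of_int \<lfloor>x / \<delta>\<rfloor>" by (simp add: le_floor_iff[symmetric] ceiling_le_iff)
        also have "\<dots> \<longleftrightarrow> s \<le> g x" using \<delta> by (simp add: g_def field_simps)
        finally show ?thesis .
      qed
      have close: "\<bar>grid_path c m (\<lambda>k. f (real k * c / real m)) (\<mu> t) - f t\<bar> \<le> \<epsilon>" if t: "t \<in> {0..c}" for t
      proof -
        have mt: "\<mu> t \<in> {0..c}" using \<mu>(1) t by (auto simp: time_changes_def)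
        have "int (grid_floor c m (\<mu> t)) = \<lfloor>\<mu> t / \<delta>\<rfloor>"
          using grid_floor_eq[OF c0 _ mt] elim by (simp add: \<delta>_def)
        then have "real (grid_floor c m (\<mu> t)) * c / real m = g (\<mu> t)"
          by (metis \<delta>_def g_def mult.commute of_int_of_nat_eq times_divide_eq_right)
        then have 1: "grid_path c m (\<lambda>k. f (real k * c / real m)) (\<mu> t) = f (g (\<mu> t))"
          using mt by (simp add: grid_path_def)
        have mono: "strict_mono_on {0..c} \<mu>" using \<mu>(1) by (simp add: time_changes_def)
        have same: "s \<le> t \<longleftrightarrow> s \<le> g (\<mu> t)" if "s \<in> S" for s
        proof -
          have "s \<in> {0..c}" using that S(4) by blast
          then have "s \<le> t \<longleftrightarrow> \<mu> s \<le> \<mu> t"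
            using strict_mono_onD[OF mono _ t] strict_mono_onD[OF mono t, of s] t
            by (metis less_eq_real_def linorder_not_less)
          then show ?thesis using RG[of s "\<mu> t"] \<mu>(2)[OF that] by simp
        qed
        have g0: "0 \<le> g (\<mu> t)" "g (\<mu> t) \<le> c"
          using same[OF S(2)] t RG[of "g (\<mu> t)" "\<mu> t"] mt \<delta>
          by (auto simp: g_def R_def)
        consider "t \<le> g (\<mu> t)" | "g (\<mu> t) \<le> t" by linarith
        then have "\<bar>f (g (\<mu> t)) - f t\<bar> \<le> \<epsilon>"
        proof cases
          case 1
          have "{t<..g (\<mu> t)} \<inter> S = {}" using same by force
          then show ?thesis using osc[of t "g (\<mu> t)"] 1 g0 t by (simp add: abs_minus_commute)
        next
          case 2
          have "{g (\<mu> t)<..t} \<inter> S = {}" using same by force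
          then show ?thesis using osc[of "g (\<mu> t)" t] 2 g0 t by simp
        qed
        then show ?thesis using 1 by simp
      qed
      have "\<bar>\<mu> t - t\<bar> \<le> \<epsilon>" for t
        using \<mu>(3)[of t] sum elim by (simp add: \<delta>_def)
      then have "skorokhod_close c (grid_path c m (\<lambda>k. f (real k * c / real m))) f \<epsilon>"
        unfolding skorokhod_close_def using close \<epsilon>(1) \<mu>(1) by blast
      then have "skorokhod_dist c (grid_path c m (\<lambda>k. f (real k * c / real m))) f \<le> \<epsilon>"
        by (rule skorokhod_dist_le[OF grid_path_in_space f])
      moreover have "0 \<le> skorokhod_dist c (grid_path c m (\<lambda>k. f (real k * c / real m))) f"
        by (rule Metric_space.nonneg[OF Metric_space_skorokhod])
      ultimately show ?case using \<epsilon>(2) by simp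
    qed
  qed
qed

section \<open>Measurability of random paths\<close>

text \<open>The event \<open>Y \<omega> \<in> U\<close> means that for some \<open>k\<close> the
  approximations eventually lie in \<open>V k\<close>, the points whose ball of radius 1 / (k + 1)
  stays in \<open>U\<close>. Measurability of \<open>X m\<close> is asked for arbitrary sets
  \<open>A\<close>, so that nothing has to be known about \<open>V k\<close>; random elements with
  countably many values can afford this.\<close>

lemma measurable_borel_of_limit:
  assumes D: "Metric_space D d"
    and Y: "\<And>\<omega>. \<omega> \<in> space M \<Longrightarrow> Y \<omega> \<in> D" and X: "\<And>m \<omega>. \<omega> \<in> space M \<Longrightarrow> X m \<omega> \<in> D"
    and sets: "\<And>m A. {\<omega> \<in> space M. X m \<omega> \<in> A} \<in> sets M"
    and lim: "\<And>\<omega>. \<omega> \<in> space M \<Longrightarrow> (\<lambda>m. d (X m \<omega>) (Y \<omega>)) \<longlonglongrightarrow> 0"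
  shows "Y \<in> M \<rightarrow>\<^sub>M borel_of (Metric_space.mtopology D d)"
  unfolding borel_of_def
proof (rule measurable_measure_of)
  interpret Metric_space D d by (rule D)
  show "{U. openin mtopology U} \<subseteq> Pow (topspace mtopology)"
    using openin_subset by blast
  show "Y \<in> space M \<rightarrow> topspace mtopology" using Y by simp
  fix U assume "U \<in> {U. openin mtopology U}"
  then have U: "openin mtopology U" by simp
  define V where "V k = {x \<in> D. mball x (1 / real (Suc k)) \<subseteq> U}" for k
  have "Y \<omega> \<in> U \<longleftrightarrow> (\<exists>k N. \<forall>m\<ge>N. X m \<omega> \<in> V k)" if \<omega>: "\<omega> \<in> space M" for \<omega>
  proof
    assume "Y \<omega> \<in> U"
    then obtain r where r: "r > 0" "mball (Y \<omega>) r \<subseteq> U"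
      using U by (auto simp: openin_mtopology)
    obtain k where k: "1 / real (Suc k) < r / 2"
      using nat_approx_posE[of "r / 2"] r by (auto simp: field_simps)
    have "\<forall>\<^sub>F m in sequentially. d (X m \<omega>) (Y \<omega>) < r / 2"
      using lim[OF \<omega>] r by (intro order_tendstoD) auto
    then obtain N where N: "\<And>m. m \<ge> N \<Longrightarrow> d (X m \<omega>) (Y \<omega>) < r / 2"
      by (auto simp: eventually_sequentially)
    have "X m \<omega> \<in> V k" if "m \<ge> N" for m
    proof -
      have "mball (X m \<omega>) (1 / real (Suc k)) \<subseteq> mball (Y \<omega>) r"
      proof
        fix z assume "z \<in> mball (X m \<omega>) (1 / real (Suc k))"
        then have z: "z \<in> D" "d (X m \<omega>) z < r / 2" using k by auto
        have "d (Y \<omega>) z \<le> d (Y \<omega>) (X m \<omega>) + d (X m \<omega>) z"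
          using X[OF \<omega>] Y[OF \<omega>] z by (intro triangle) auto
        also have "\<dots> < r" using z N[OF that] commute[of "Y \<omega>"] by simp
        finally show "z \<in> mball (Y \<omega>) r" using z Y[OF \<omega>] by simp
      qed
      then show ?thesis using r X[OF \<omega>] by (auto simp: V_def)
    qed
    then show "\<exists>k N. \<forall>m\<ge>N. X m \<omega> \<in> V k" by blast
  next
    assume "\<exists>k N. \<forall>m\<ge>N. X m \<omega> \<in> V k"
    then obtain k N where kN: "\<And>m. m \<ge> N \<Longrightarrow> X m \<omega> \<in> V k" by blast
    have "\<forall>\<^sub>F m in sequentially. d (X m \<omega>) (Y \<omega>) < 1 / real (Suc k)"
      using lim[OF \<omega>] by (intro order_tendstoD) auto
    then have "\<forall>\<^sub>F m in sequentially. d (X m \<omega>) (Y \<omega>) < 1 / real (Suc k) \<and> m \<ge> N"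
      using eventually_ge_at_top[of N] by eventually_elim auto
    then obtain m where "d (X m \<omega>) (Y \<omega>) < 1 / real (Suc k)" "m \<ge> N"
      using eventually_happens'[OF sequentially_bot] by blast
    then show "Y \<omega> \<in> U" using kN[of m] X[OF \<omega>] Y[OF \<omega>] by (auto simp: V_def)
  qed
  then have "Y -` U \<inter> space M = {\<omega> \<in> space M. \<exists>k N. \<forall>m. N \<le> m \<longrightarrow> X m \<omega> \<in> V k}"
    by blast
  also have "\<dots> \<in> sets M"
    by (intro sets.sets_Collect_countable_Ex sets.sets_Collect_countable_All
        sets.sets_Collect_imp sets.sets_Collect_const sets)
  finally show "Y -` U \<inter> space M \<in> sets M" .
qed

lemma grid_path_cong:
  assumes "\<And>k. k \<le> m \<Longrightarrow> x k = y k"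
  shows "grid_path c m x = grid_path c m y"
  using assms grid_floor_le by (auto simp: grid_path_def intro!: restrict_ext)

text \<open>The grid values are rounded down to multiples of 1 / (m + 1). The approximating path is
  then a function of a list of integers, has countably many values, and every set has a measurable
  preimage. Rounding costs at most 1 / (m + 1) in uniform distance; the rest is
  \<open>grid_path_tendsto\<close>.\<close>

lemma skorokhod_measurableI:
  assumes c: "0 \<le> c" and Y: "\<And>\<omega>. \<omega> \<in> space M \<Longrightarrow> Y \<omega> \<in> skorokhod_space c"
    and meas: "\<And>t. t \<in> {0..c} \<Longrightarrow> (\<lambda>\<omega>. Y \<omega> t) \<in> borel_measurable M"
  shows "Y \<in> M \<rightarrow>\<^sub>M borel_of (skorokhod_topology c)"
  unfolding skorokhod_topology_def
proof (rule measurable_borel_of_limit[OF Metric_space_skorokhod Y])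
  define v where "v m \<omega> = map (\<lambda>k. \<lfloor>real (Suc m) * Y \<omega> (real k * c / real m)\<rfloor>) [0..<Suc m]" for m \<omega>
  define X where "X m \<omega> = grid_path c m (\<lambda>k. of_int (v m \<omega> ! k) / real (Suc m))" for m \<omega>
  show "X m \<omega> \<in> skorokhod_space c" for m \<omega>
    by (simp add: X_def grid_path_in_space)
  show "{\<omega> \<in> space M. X m \<omega> \<in> A} \<in> sets M" for m A
  proof -
    have "v m \<in> M \<rightarrow>\<^sub>M count_space UNIV"
      unfolding measurable_count_space_eq2_countable
    proof (intro conjI ballI)
      fix l :: "int list"
      show "v m -` {l} \<inter> space M \<in> sets M"
      proof (cases "length l = Suc m")
        case True
        have "v m -` {l} \<inter> space M =
            {\<omega> \<in> space M. \<forall>k\<in>{..m}. \<lfloor>real (Suc m) * Y \<omega> (real k * c / real m)\<rfloor> = l ! k}"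
          using True by (auto simp: v_def list_eq_iff_nth_eq less_Suc_eq_le simp del: upt_Suc)
        also have "\<dots> \<in> sets M"
        proof (intro sets.sets_Collect_finite_All)
          fix k assume k: "k \<in> {..m}"
          \<comment> \<open>For \<open>m = 0\<close> division by zero gives the point 0, which lies
            in the interval.\<close>
          have "real k * c / real m \<in> {0..c}"
            using c k by (cases "m = 0") (auto simp: field_simps mult_left_mono)
          note meas[OF this, measurable]
          show "{\<omega> \<in> space M. \<lfloor>real (Suc m) * Y \<omega> (real k * c / real m)\<rfloor> = l ! k} \<in> sets M"
            by measurable
        qed simp
        finally show ?thesis .
      next
        case False
        then have "v m -` {l} \<inter> space M = {}" by (auto simp: v_def simp del: upt_Suc)
        then show ?thesis by simp
      qed
    qed simp
    moreover have "{\<omega> \<in> space M. X m \<omega> \<in> A} =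
        v m -` {l. grid_path c m (\<lambda>k. of_int (l ! k) / real (Suc m)) \<in> A} \<inter> space M"
      by (auto simp: X_def)
    ultimately show ?thesis by (simp add: measurable_sets)
  qed
  fix \<omega> assume \<omega>: "\<omega> \<in> space M"
  let ?G = "\<lambda>m. grid_path c m (\<lambda>k. Y \<omega> (real k * c / real m))"
  show "(\<lambda>m. skorokhod_dist c (X m \<omega>) (Y \<omega>)) \<longlonglongrightarrow> 0"
  proof (rule tendsto_sandwich[of "\<lambda>_. 0" _ _ "\<lambda>m. 1 / real (Suc m) + skorokhod_dist c (?G m) (Y \<omega>)"])
    show "\<forall>\<^sub>F m in sequentially. 0 \<le> skorokhod_dist c (X m \<omega>) (Y \<omega>)"
      by (simp add: Metric_space.nonneg[OF Metric_space_skorokhod])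
    have "skorokhod_dist c (X m \<omega>) (Y \<omega>) \<le> 1 / real (Suc m) + skorokhod_dist c (?G m) (Y \<omega>)" for m
    proof -
      have "skorokhod_dist c (X m \<omega>) (?G m) \<le> 1 / real (Suc m)"
      proof (rule skorokhod_dist_le_sup)
        fix t assume t: "t \<in> {0..c}"
        define y where "y = Y \<omega> (real (grid_floor c m t) * c / real m)"
        have xy: "X m \<omega> t = of_int \<lfloor>real (Suc m) * y\<rfloor> / real (Suc m)" "?G m t = y"
          using t grid_floor_le[of c m t]
          by (simp_all add: X_def grid_path_def v_def y_def del: upt_Suc)
        have "\<bar>of_int \<lfloor>real (Suc m) * y\<rfloor> - real (Suc m) * y\<bar> \<le> 1" by linarith
        then have "\<bar>of_int \<lfloor>real (Suc m) * y\<rfloor> - real (Suc m) * y\<bar> / real (Suc m) \<le> 1 / real (Suc m)"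
          by (intro divide_right_mono) auto
        moreover have "of_int \<lfloor>real (Suc m) * y\<rfloor> / real (Suc m) - y
            = (of_int \<lfloor>real (Suc m) * y\<rfloor> - real (Suc m) * y) / real (Suc m)"
          by (simp add: diff_divide_distrib del: of_nat_Suc)
        ultimately have "\<bar>of_int \<lfloor>real (Suc m) * y\<rfloor> / real (Suc m) - y\<bar> \<le> 1 / real (Suc m)"
          by (simp add: abs_divide del: of_nat_Suc)
        with xy show "\<bar>X m \<omega> t - ?G m t\<bar> \<le> 1 / real (Suc m)" by simp
      qed (auto simp: X_def grid_path_in_space)
      then show ?thesis
        using Metric_space.triangle[OF Metric_space_skorokhod, of "X m \<omega>" c "?G m" "Y \<omega>"] Y[OF \<omega>]
        by (auto simp: X_def grid_path_in_space)
    qed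
    then show "\<forall>\<^sub>F m in sequentially. skorokhod_dist c (X m \<omega>) (Y \<omega>)
        \<le> 1 / real (Suc m) + skorokhod_dist c (?G m) (Y \<omega>)" by simp
    have "(\<lambda>m. 1 / real (Suc m)) \<longlonglongrightarrow> 0" by real_asymp
    from tendsto_add[OF this grid_path_tendsto[OF Y[OF \<omega>] c]]
    show "(\<lambda>m. 1 / real (Suc m) + skorokhod_dist c (?G m) (Y \<omega>)) \<longlonglongrightarrow> 0" by simp
  qed simp
qed


section \<open>Lipschitz test functions suffice for convergence in distribution\<close>

lemma measurable_continuous_map_borel_of:
  assumes "continuous_map X euclideanreal \<phi>"
  shows "\<phi> \<in> borel_measurable (borel_of X)"
proof (rule borel_measurableI)
  fix S :: "real set" assume "open S"
  then have "openin X {x \<in> topspace X. \<phi> x \<in> S}"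
    using openin_continuous_map_preimage[OF assms] by simp
  moreover have "\<phi> -` S \<inter> space (borel_of X) = {x \<in> topspace X. \<phi> x \<in> S}"
    by (auto simp: borel_of_def openin_subset space_measure_of_conv)
  ultimately show "\<phi> -` S \<inter> space (borel_of X) \<in> sets (borel_of X)"
    unfolding borel_of_def by (auto intro!: in_measure_of dest: openin_subset)
qed

lemma space_borel_of: "space (borel_of X) = topspace X"
  by (simp add: borel_of_def space_measure_of_conv)

lemma Lipschitz_continuous_map:
  assumes D: "Metric_space D d" and L: "0 \<le> L"
    and lip: "\<And>x y. x \<in> D \<Longrightarrow> y \<in> D \<Longrightarrow> \<bar>\<phi> x - \<phi> y\<bar> \<le> L * d x y"
  shows "continuous_map (Metric_space.mtopology D d) euclideanreal \<phi>"
proof -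
  have "\<exists>\<delta>>0. \<forall>x. x \<in> D \<and> d a x < \<delta> \<longrightarrow> dist (\<phi> a) (\<phi> x) < e" if "a \<in> D" "e > 0" for a e
  \<comment> \<open>Dividing by \<open>L + 1\<close> instead of \<open>L\<close> covers
    \<open>L = 0\<close>.\<close>
  proof (intro exI[of _ "e / (L + 1)"] conjI allI impI)
    fix x assume "x \<in> D \<and> d a x < e / (L + 1)"
    then have "(L + 1) * d a x < e" "L * d a x \<le> (L + 1) * d a x"
      using L Metric_space.nonneg[OF D, of a x] by (auto simp: field_simps intro!: mult_right_mono)
    then show "dist (\<phi> a) (\<phi> x) < e"
      using lip[of a x] that \<open>x \<in> D \<and> _\<close> by (simp add: dist_real_def)
  qed (use that L in auto)
  then show ?thesis
    using Metric_space.metric_continuous_map[OF D Met_TC.Metric_space_axioms, of \<phi>] by auto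
qed

text \<open>Each \<open>\<psi> k\<close> lies below \<phi> and has convergent expectations;
  dominated convergence brings its expectation at \<open>Z\<close> close to that of \<phi>. A lower
  bound is all that can come from functions below \<phi>, and it is enough, since the same bound for
  -\<phi> is the matching upper bound.\<close>

lemma converges_in_distribution_Lipschitz_lower:
  fixes D d
  defines "X \<equiv> Metric_space.mtopology D d"
  assumes D: "Metric_space D d"
    and Y: "\<forall>\<^sub>F n in sequentially. prob_space (P n) \<and> Y n \<in> P n \<rightarrow>\<^sub>M borel_of X"
    and Q: "prob_space Q" and Z: "Z \<in> Q \<rightarrow>\<^sub>M borel_of X"
    and lip: "\<And>\<phi> L B. (\<And>x y. x \<in> D \<Longrightarrow> y \<in> D \<Longrightarrow> \<bar>\<phi> x - \<phi> y\<bar> \<le> L * d x y) \<Longrightarrow> 0 \<le> L \<Longrightarrow>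
      (\<And>x. x \<in> D \<Longrightarrow> \<bar>\<phi> x\<bar> \<le> B) \<Longrightarrow> (\<lambda>n. \<integral>\<omega>. \<phi> (Y n \<omega>) \<partial>P n) \<longlonglongrightarrow> (\<integral>\<omega>. \<phi> (Z \<omega>) \<partial>Q)"
    and \<phi>: "continuous_map X euclideanreal \<phi>" and B: "\<And>x. x \<in> D \<Longrightarrow> \<bar>\<phi> x\<bar> \<le> B" and e: "e > 0"
  shows "\<forall>\<^sub>F n in sequentially. (\<integral>\<omega>. \<phi> (Z \<omega>) \<partial>Q) - e < (\<integral>\<omega>. \<phi> (Y n \<omega>) \<partial>P n)"
proof -
  interpret Metric_space D d by (rule D)
  interpret Q: prob_space Q by (rule Q)
  have ZD: "Z \<omega> \<in> D" if "\<omega> \<in> space Q" for \<omega>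
    using measurable_space[OF Z that] by (simp add: space_borel_of X_def)
  then have ne: "D \<noteq> {}" using Q.not_empty by blast
  \<comment> \<open>The inf-convolutions of \<open>\<phi>\<close> with multiples of the metric are Lipschitz and increase to \<open>\<phi>\<close>.\<close>
  define \<psi> where "\<psi> k x = (INF y\<in>D. \<phi> y + real k * d x y)" for k x
  have lb: "- B \<le> \<phi> y + real k * d x y" if "y \<in> D" for x y k
    using B[OF that] nonneg[of x y] mult_nonneg_nonneg[of "real k" "d x y"] by linarith
  have bdd: "bdd_below ((\<lambda>y. \<phi> y + real k * d x y) ` D)" for k x
    using lb by (intro bdd_belowI2[of _ "- B"])
  have \<psi>_le: "\<psi> k x \<le> \<phi> y + real k * d x y" if "y \<in> D" for x y k
    unfolding \<psi>_def by (rule cINF_lower[OF bdd that])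
  have \<psi>_ge: "- B \<le> \<psi> k x" for x k
    unfolding \<psi>_def using ne lb by (intro cINF_greatest) auto
  have \<psi>_le\<phi>: "\<psi> k x \<le> \<phi> x" if "x \<in> D" for x k
    using \<psi>_le[OF that, of k x] that by simp
  have half: "\<psi> k x \<le> \<psi> k y + real k * d x y" if "x \<in> D" "y \<in> D" for k x y
  proof -
    have "\<psi> k x - real k * d x y \<le> \<phi> z + real k * d y z" if "z \<in> D" for z
    proof -
      have "real k * d x z \<le> real k * (d x y + d y z)"
        using \<open>x \<in> D\<close> \<open>y \<in> D\<close> that by (intro mult_left_mono triangle) auto
      then show ?thesis using \<psi>_le[OF that, of k x] by (simp add: distrib_left)
    qed
    then have "\<psi> k x - real k * d x y \<le> \<psi> k y"
      unfolding \<psi>_def[of k y] using ne by (intro cINF_greatest) auto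
    then show ?thesis by simp
  qed
  have lip\<psi>: "\<bar>\<psi> k x - \<psi> k y\<bar> \<le> real k * d x y" if "x \<in> D" "y \<in> D" for k x y
    using half[OF that, of k] half[OF that(2,1), of k] by (simp add: commute[of y x] abs_le_iff)
  have bound\<psi>: "\<bar>\<psi> k x\<bar> \<le> B" if "x \<in> D" for k x
    using \<psi>_ge[of k x] \<psi>_le\<phi>[OF that, of k] B[OF that] by linarith
  have cont\<psi>: "continuous_map X euclideanreal (\<psi> k)" for k
    unfolding X_def using lip\<psi> by (intro Lipschitz_continuous_map[OF D, of "real k"]) auto
  have meas: "(\<lambda>\<omega>. f (V \<omega>)) \<in> borel_measurable R"
    if "continuous_map X euclideanreal f" "V \<in> R \<rightarrow>\<^sub>M borel_of X" for f R and V :: "'z \<Rightarrow> 'a"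
    using measurable_compose[OF that(2) measurable_continuous_map_borel_of[OF that(1)]] .
  have lim\<psi>: "(\<lambda>k. \<psi> k x) \<longlonglongrightarrow> \<phi> x" if x: "x \<in> D" for x
  proof (rule tendstoI)
    fix r :: real assume r: "r > 0"
    have "\<forall>a\<in>D. \<forall>\<epsilon>>0. \<exists>\<delta>>0. \<forall>x. x \<in> D \<and> d a x < \<delta> \<longrightarrow> dist (\<phi> a) (\<phi> x) < \<epsilon>"
      using \<phi> metric_continuous_map[OF Met_TC.Metric_space_axioms, of \<phi>] by (simp add: X_def)
    then have "\<exists>\<delta>>0. \<forall>y. y \<in> D \<and> d x y < \<delta> \<longrightarrow> \<bar>\<phi> x - \<phi> y\<bar> < r / 2"
      using x half_gt_zero[OF r] unfolding dist_real_def by blast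
    then obtain \<delta> where \<delta>: "\<delta> > 0" "\<And>y. y \<in> D \<Longrightarrow> d x y < \<delta> \<Longrightarrow> \<bar>\<phi> x - \<phi> y\<bar> < r / 2"
      by blast
    \<comment> \<open>With this \<open>k\<close>, a point at distance at least \<delta> pays at
      least 2 B, the largest possible drop of \<phi>; at a nearer point \<phi> drops by less than r
      / 2 by continuity.\<close>
    obtain k0 :: nat where k0: "2 * B / \<delta> < real k0" using reals_Archimedean2 by blast
    have "\<phi> x - r / 2 \<le> \<psi> k x" if "k \<ge> k0" for k
      unfolding \<psi>_def
    proof (rule cINF_greatest[OF ne])
      fix y assume y: "y \<in> D"
      show "\<phi> x - r / 2 \<le> \<phi> y + real k * d x y"
      proof (cases "d x y < \<delta>")
        case True
        then show ?thesis
          using \<delta>(2)[OF y True] mult_nonneg_nonneg[OF of_nat_0_le_iff[of k] nonneg[of x y]]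
          unfolding abs_less_iff by linarith
      next
        case False
        have "2 * B / \<delta> \<le> real k" using k0 that by simp
        then have "2 * B \<le> real k * \<delta>" using \<delta>(1) by (simp add: pos_divide_le_eq)
        also have "\<dots> \<le> real k * d x y" using False by (intro mult_left_mono) auto
        finally show ?thesis using B[OF x] B[OF y] r by linarith
      qed
    qed
    then have "dist (\<psi> k x) (\<phi> x) < r" if "k \<ge> k0" for k
      using \<psi>_le\<phi>[OF x, of k] r that unfolding dist_real_def by force
    then show "\<forall>\<^sub>F k in sequentially. dist (\<psi> k x) (\<phi> x) < r"
      by (auto simp: eventually_sequentially)
  qed
  have "(\<lambda>k. \<integral>\<omega>. \<psi> k (Z \<omega>) \<partial>Q) \<longlonglongrightarrow> (\<integral>\<omega>. \<phi> (Z \<omega>) \<partial>Q)"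
    by (rule integral_dominated_convergence[where w = "\<lambda>_. B"])
      (auto intro!: meas[OF \<phi> Z] meas[OF cont\<psi> Z] AE_I2 lim\<psi> ZD bound\<psi>)
  then have "\<forall>\<^sub>F k in sequentially. (\<integral>\<omega>. \<phi> (Z \<omega>) \<partial>Q) - e < (\<integral>\<omega>. \<psi> k (Z \<omega>) \<partial>Q)"
    using e by (intro order_tendstoD) auto
  then obtain k where k: "(\<integral>\<omega>. \<phi> (Z \<omega>) \<partial>Q) - e < (\<integral>\<omega>. \<psi> k (Z \<omega>) \<partial>Q)"
    using eventually_happens'[OF sequentially_bot] by blast
  have "(\<lambda>n. \<integral>\<omega>. \<psi> k (Y n \<omega>) \<partial>P n) \<longlonglongrightarrow> (\<integral>\<omega>. \<psi> k (Z \<omega>) \<partial>Q)"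
    by (rule lip[of "\<psi> k" "real k" B]) (auto intro: lip\<psi> bound\<psi>)
  then have "\<forall>\<^sub>F n in sequentially. (\<integral>\<omega>. \<phi> (Z \<omega>) \<partial>Q) - e < (\<integral>\<omega>. \<psi> k (Y n \<omega>) \<partial>P n)"
    using k by (intro order_tendstoD)
  then show ?thesis
    using Y
  proof eventually_elim
    case (elim n)
    interpret P: prob_space "P n" using elim by simp
    have YD: "Y n \<omega> \<in> D" if "\<omega> \<in> space (P n)" for \<omega>
      using measurable_space[of "Y n" "P n" "borel_of X"] elim that by (simp add: space_borel_of X_def)
    have Yn: "Y n \<in> P n \<rightarrow>\<^sub>M borel_of X" using elim by simp
    have "(\<integral>\<omega>. \<psi> k (Y n \<omega>) \<partial>P n) \<le> (\<integral>\<omega>. \<phi> (Y n \<omega>) \<partial>P n)"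
      by (intro integral_mono P.integrable_const_bound[of _ B] AE_I2 meas[OF \<phi> Yn] meas[OF cont\<psi> Yn])
        (auto intro!: \<psi>_le\<phi> bound\<psi> B YD)
    then show ?case using elim by simp
  qed
qed

lemma converges_in_distribution_LipschitzI:
  assumes D: "Metric_space D d"
    and Y: "\<forall>\<^sub>F n in sequentially. prob_space (P n) \<and> Y n \<in> P n \<rightarrow>\<^sub>M borel_of (Metric_space.mtopology D d)"
    and Q: "prob_space Q" and Z: "Z \<in> Q \<rightarrow>\<^sub>M borel_of (Metric_space.mtopology D d)"
    and lip: "\<And>\<phi> L B. (\<And>x y. x \<in> D \<Longrightarrow> y \<in> D \<Longrightarrow> \<bar>\<phi> x - \<phi> y\<bar> \<le> L * d x y) \<Longrightarrow> 0 \<le> L \<Longrightarrow>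
      (\<And>x. x \<in> D \<Longrightarrow> \<bar>\<phi> x\<bar> \<le> B) \<Longrightarrow> (\<lambda>n. \<integral>\<omega>. \<phi> (Y n \<omega>) \<partial>P n) \<longlonglongrightarrow> (\<integral>\<omega>. \<phi> (Z \<omega>) \<partial>Q)"
  shows "converges_in_distribution (Metric_space.mtopology D d) P Y Q Z"
  unfolding converges_in_distribution_def
proof (intro conjI allI impI Y Q Z)
  let ?X = "Metric_space.mtopology D d"
  fix \<phi> :: "'a \<Rightarrow> real" assume *: "continuous_map ?X euclideanreal \<phi> \<and> bounded (\<phi> ` topspace ?X)"
  then obtain B where B: "\<And>x. x \<in> D \<Longrightarrow> \<bar>\<phi> x\<bar> \<le> B"
    by (auto simp: bounded_iff Metric_space.topspace_mtopology[OF D])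
  have low: "\<forall>\<^sub>F n in sequentially. (\<integral>\<omega>. \<phi>' (Z \<omega>) \<partial>Q) - e < (\<integral>\<omega>. \<phi>' (Y n \<omega>) \<partial>P n)"
    if "continuous_map ?X euclideanreal \<phi>'" "\<And>x. x \<in> D \<Longrightarrow> \<bar>\<phi>' x\<bar> \<le> B" "e > 0" for \<phi>' B e
    by (rule converges_in_distribution_Lipschitz_lower[OF D Y Q Z _ that]) (rule lip)
  show "(\<lambda>n. \<integral>\<omega>. \<phi> (Y n \<omega>) \<partial>P n) \<longlonglongrightarrow> (\<integral>\<omega>. \<phi> (Z \<omega>) \<partial>Q)"
  proof (rule tendstoI)
    fix e :: real assume e: "e > 0"
    have 1: "\<forall>\<^sub>F n in sequentially. (\<integral>\<omega>. \<phi> (Z \<omega>) \<partial>Q) - e < (\<integral>\<omega>. \<phi> (Y n \<omega>) \<partial>P n)"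
      using * by (intro low[of \<phi> B] B e) auto
    have "\<forall>\<^sub>F n in sequentially. (\<integral>\<omega>. - \<phi> (Z \<omega>) \<partial>Q) - e < (\<integral>\<omega>. - \<phi> (Y n \<omega>) \<partial>P n)"
      using * B by (intro low[of "\<lambda>x. - \<phi> x" B] e continuous_map_minus) auto
    then have 2: "\<forall>\<^sub>F n in sequentially. - (\<integral>\<omega>. \<phi> (Z \<omega>) \<partial>Q) - e < - (\<integral>\<omega>. \<phi> (Y n \<omega>) \<partial>P n)"
      by simp
    from 1 2 show "\<forall>\<^sub>F n in sequentially. dist (\<integral>\<omega>. \<phi> (Y n \<omega>) \<partial>P n) (\<integral>\<omega>. \<phi> (Z \<omega>) \<partial>Q) < e"
      by eventually_elim (auto simp: dist_real_def abs_less_iff)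
  qed
qed

section \<open>Surplus of a graph\<close>

lemma finite_all_edges_on: "finite V \<Longrightarrow> finite (all_edges_on V)"
  by (rule finite_subset[of _ "Pow V"]) (auto simp: all_edges_on_def)

lemma all_edges_on_mono: "U \<subseteq> V \<Longrightarrow> all_edges_on U \<subseteq> all_edges_on V"
  unfolding all_edges_on_def by blast

lemma all_edges_onE:
  assumes "e \<in> all_edges_on V"
  obtains i j where "e = {i, j}" "i \<in> V" "j \<in> V" "i \<noteq> j"
  using assms by (auto simp: all_edges_on_def)

definition adj :: "nat set set \<Rightarrow> (nat \<times> nat) set" where
  "adj E = {(a, b). {a, b} \<in> E}"

lemma sym_adj: "sym (adj E)"
  by (auto simp: adj_def sym_def insert_commute)

lemma adj_mono: "E \<subseteq> E' \<Longrightarrow> adj E \<subseteq> adj E'"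
  by (auto simp: adj_def)

lemma adj_insert: "adj (insert {i, j} E) = insert (i, j) (insert (j, i) (adj E))"
  by (auto simp: adj_def doubleton_eq_iff)

lemma equiv_reachable_in: "equiv V (reachable_in V E)"
proof -
  have "sym ((adj E)\<^sup>*)" by (intro sym_rtrancl sym_adj)
  then show ?thesis
    unfolding reachable_in_def adj_def[symmetric]
    by (intro equivI) (auto simp: refl_on_def sym_def trans_def)
qed

text \<open>A walk in the enlarged graph either avoids the new edge or can be shortened until it
  crosses that edge exactly once, in one of the two directions.\<close>

lemma adj_rtrancl_insert:
  "(x, y) \<in> (adj (insert {i, j} E))\<^sup>* \<longleftrightarrow> (x, y) \<in> (adj E)\<^sup>* \<or>
     (x, i) \<in> (adj E)\<^sup>* \<and> (j, y) \<in> (adj E)\<^sup>* \<or> (x, j) \<in> (adj E)\<^sup>* \<and> (i, y) \<in> (adj E)\<^sup>*"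
  (is "?L x y \<longleftrightarrow> ?R x y")
proof
  assume "?L x y"
  then show "?R x y"
  proof (induction rule: rtrancl_induct)
    case (step y z)
    from step.hyps(2) consider "(y, z) \<in> adj E" | "y = i" "z = j" | "y = j" "z = i"
      by (auto simp: adj_insert)
    then show ?case
      using step.IH by cases (meson rtrancl.rtrancl_into_rtrancl | blast)+
  qed simp
next
  have sub: "(adj E)\<^sup>* \<subseteq> (adj (insert {i, j} E))\<^sup>*" by (intro rtrancl_mono adj_mono) blast
  have "(i, j) \<in> (adj (insert {i, j} E))\<^sup>*" "(j, i) \<in> (adj (insert {i, j} E))\<^sup>*"
    by (auto simp: adj_insert)
  moreover assume "?R x y"
  ultimately show "?L x y" using sub by (meson rtrancl_trans subsetD)
qed


lemma num_components_insert_connected: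
  assumes "(i, j) \<in> (adj E)\<^sup>*"
  shows "num_components V (insert {i, j} E) = num_components V E"
proof -
  have "(j, i) \<in> (adj E)\<^sup>*" using assms sym_rtrancl[OF sym_adj] by (meson symE)
  then have "reachable_in V (insert {i, j} E) = reachable_in V E"
    unfolding reachable_in_def adj_def[symmetric] adj_rtrancl_insert using assms
    by (auto intro: rtrancl_trans)
  then show ?thesis by (simp add: num_components_def)
qed

text \<open>The classes \<open>A\<close> and \<open>B\<close> of \<open>i\<close> and
  \<open>j\<close> are replaced by their union, and all other classes stay as they are.\<close>

lemma num_components_insert_disconnected:
  assumes V: "finite V" and ij: "i \<in> V" "j \<in> V" and nc: "(i, j) \<notin> (adj E)\<^sup>*"
  shows "num_components V E = Suc (num_components V (insert {i, j} E))"
proof -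
  define R where "R = reachable_in V E"
  define R' where "R' = reachable_in V (insert {i, j} E)"
  have eq: "equiv V R" "equiv V R'" unfolding R_def R'_def by (rule equiv_reachable_in)+
  define A where "A = R `` {i}"
  define B where "B = R `` {j}"
  have Rij: "(i, j) \<notin> R" using nc by (simp add: R_def reachable_in_def adj_def)
  have AB: "A \<in> V // R" "B \<in> V // R" "A \<noteq> B"
    using ij Rij eq_equiv_class_iff[OF eq(1) ij] by (auto simp: A_def B_def quotientI)
  have R'_iff: "(x, y) \<in> R' \<longleftrightarrow> (x, y) \<in> R \<or> x \<in> A \<and> y \<in> B \<or> x \<in> B \<and> y \<in> A" for x y
  proof -
    have "sym ((adj E)\<^sup>*)" by (intro sym_rtrancl sym_adj)
    then show ?thesis
      using ij unfolding A_def B_def R_def R'_def reachable_in_def adj_def[symmetric]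
      by (simp add: adj_rtrancl_insert) (meson symE)
  qed
  have cls: "R' `` {x} = (if x \<in> A \<union> B then A \<union> B else R `` {x})" if x: "x \<in> V" for x
  proof -
    have "R `` {x} = A" if "x \<in> A" using that equiv_class_eq[OF eq(1)] unfolding A_def by blast
    moreover have "R `` {x} = B" if "x \<in> B" using that equiv_class_eq[OF eq(1)] unfolding B_def by blast
    moreover have "x \<in> R `` {x}" using equiv_class_self[OF eq(1) x] .
    moreover have "A \<inter> B = {}" using quotient_disj[OF eq(1) AB(1,2)] AB(3) by blast
    moreover have "R' `` {x} = R `` {x} \<union> (if x \<in> A then B else {}) \<union> (if x \<in> B then A else {})"
      by (auto simp: R'_iff)
    ultimately show ?thesis by auto
  qed
  have inA: "i \<in> A" using equiv_class_self[OF eq(1) ij(1)] by (simp add: A_def)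
  have "V // R' = insert (A \<union> B) (V // R - {A, B})"
  proof (intro set_eqI iffI)
    fix C assume "C \<in> V // R'"
    then obtain x where x: "x \<in> V" "C = R' `` {x}" by (auto simp: quotient_def)
    show "C \<in> insert (A \<union> B) (V // R - {A, B})"
    proof (cases "x \<in> A \<union> B")
      case False
      then have "R `` {x} \<noteq> A" "R `` {x} \<noteq> B" using equiv_class_self[OF eq(1) x(1)] by auto
      then show ?thesis using x cls False by (simp add: quotientI)
    qed (use x cls in simp)
  next
    fix C assume C: "C \<in> insert (A \<union> B) (V // R - {A, B})"
    show "C \<in> V // R'"
    proof (cases "C = A \<union> B")
      case True
      then have "C = R' `` {i}" using cls[OF ij(1)] inA by simp
      then show ?thesis using ij by (simp add: quotientI)
    next
      case False
      with C obtain x where x: "x \<in> V" "C = R `` {x}" "C \<noteq> A" "C \<noteq> B" by (auto simp: quotient_def)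
      have "x \<notin> A" "x \<notin> B"
        using x equiv_class_eq[OF eq(1), of i x] equiv_class_eq[OF eq(1), of j x]
        by (auto simp: A_def B_def)
      then have "C = R' `` {x}" using cls[OF x(1)] x(2) by simp
      then show ?thesis using x(1) by (simp add: quotientI)
    qed
  qed
  moreover have "A \<union> B \<notin> V // R - {A, B}"
  proof
    assume "A \<union> B \<in> V // R - {A, B}"
    then have "A \<union> B = A" using quotient_disj[OF eq(1) _ AB(1)] inA by blast
    moreover have "A \<union> B \<noteq> A" using \<open>A \<union> B \<in> _\<close> by auto
    ultimately show False by simp
  qed
  moreover have "finite (V // R)" using finite_quotient[OF V] eq(1) equiv_type by blast
  ultimately have "card (V // R') = Suc (card (V // R - {A, B}))" by simp
  \<comment> \<open>Subtraction of natural numbers: the equation is informative because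
    \<open>A\<close> and \<open>B\<close> are distinct classes, so that there are at least two, as
    recorded below.\<close>
  also have "card (V // R - {A, B}) = card (V // R) - 2"
    using AB by (simp add: card_Diff_subset)
  finally have "card (V // R') = Suc (card (V // R) - 2)" .
  moreover have "card {A, B} \<le> card (V // R)"
    using AB \<open>finite (V // R)\<close> by (intro card_mono) auto
  ultimately show ?thesis using AB by (simp add: num_components_def R_def R'_def)
qed

lemma num_components_empty: "num_components V {} = card V"
proof -
  have "reachable_in V {} = Id_on V" by (auto simp: reachable_in_def)
  moreover have "V // Id_on V = (\<lambda>x. {x}) ` V" by (auto simp: quotient_def)
  ultimately show ?thesis by (simp add: num_components_def card_image)
qed

text \<open>In a graph without loops these are the edges that are not bridges, i.e. those lying on a
  cycle. Their number bounds the surplus, grows with the graph, and has an expectation that splits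
  over single edges.\<close>

definition cycle_edges :: "nat set set \<Rightarrow> nat set set" where
  "cycle_edges E = {e \<in> E. \<exists>i j. e = {i, j} \<and> (i, j) \<in> (adj (E - {e}))\<^sup>*}"

lemma cycle_edges_mono: "E \<subseteq> E' \<Longrightarrow> cycle_edges E \<subseteq> cycle_edges E'"
  unfolding cycle_edges_def using rtrancl_mono[OF adj_mono[of "E - {e}" "E' - {e}" for e]] by blast

text \<open>Insert the edges one at a time. An edge between different components lowers their number
  by one; an edge inside a component does not, but it becomes a new member of
  \<open>cycle_edges\<close>, where all earlier members remain.\<close>

lemma num_components_bounds:
  assumes V: "finite V" and E: "E \<subseteq> all_edges_on V"
  shows "card V \<le> num_components V E + card E"
    and "num_components V E + card E \<le> card V + card (cycle_edges E)"
proof -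
  have "finite E" using E finite_all_edges_on[OF V] finite_subset by blast
  then have "card V \<le> num_components V E + card E \<and>
      num_components V E + card E \<le> card V + card (cycle_edges E)"
    using E
  proof (induction E)
    case empty
    then show ?case by (simp add: num_components_empty)
  next
    case (insert e E)
    then obtain i j where e: "e = {i, j}" "i \<in> V" "j \<in> V" "i \<noteq> j" by (auto elim: all_edges_onE)
    have fin: "finite (cycle_edges (insert e E))" using insert.hyps by (simp add: cycle_edges_def)
    have sub: "cycle_edges E \<subseteq> cycle_edges (insert e E)" by (intro cycle_edges_mono) blast
    then have le: "card (cycle_edges E) \<le> card (cycle_edges (insert e E))" using fin by (rule card_mono[rotated])
    show ?case
    proof (cases "(i, j) \<in> (adj E)\<^sup>*")
      case True
      have "e \<in> cycle_edges (insert e E)" using True insert.hyps e(1) by (auto simp: cycle_edges_def)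
      moreover have "e \<notin> cycle_edges E" using insert.hyps by (simp add: cycle_edges_def)
      ultimately have "card (cycle_edges E) < card (cycle_edges (insert e E))"
        using sub fin by (intro psubset_card_mono) auto
      then show ?thesis
        using insert num_components_insert_connected[OF True, of V] e(1) by auto
    next
      case False
      then show ?thesis
        using insert num_components_insert_disconnected[OF V e(2,3) False] e(1) le by auto
    qed
  qed
  then show "card V \<le> num_components V E + card E"
    "num_components V E + card E \<le> card V + card (cycle_edges E)" by auto
qed

text \<open>Cut the walk at its last visit to \<open>i\<close>: what follows avoids
  \<open>i\<close>. The start is a free vertex \<open>x\<close> so that the induction along the walk
  goes through; the case of interest is \<open>x = i\<close>.\<close>

lemma adj_rtrancl_last_visit:
  assumes "(x, j) \<in> (adj E)\<^sup>*" "i \<noteq> j"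
  shows "x \<noteq> i \<and> (x, j) \<in> (adj {e \<in> E. i \<notin> e})\<^sup>* \<or>
    (\<exists>v. v \<noteq> i \<and> {i, v} \<in> E \<and> (v, j) \<in> (adj {e \<in> E. i \<notin> e})\<^sup>*)"
  using assms(1)
proof (induction rule: converse_rtrancl_induct)
  case base
  then show ?case using assms(2) by auto
next
  case (step x y)
  show ?case
  proof (cases "y \<noteq> i \<and> (y, j) \<in> (adj {e \<in> E. i \<notin> e})\<^sup>*")
    case True
    show ?thesis
    proof (cases "x = i")
      case True
      then show ?thesis using step.hyps \<open>y \<noteq> i \<and> _\<close> by (auto simp: adj_def)
    next
      case False
      then have "(x, y) \<in> adj {e \<in> E. i \<notin> e}" using step.hyps True by (auto simp: adj_def)
      then show ?thesis using True False by (meson converse_rtrancl_into_rtrancl)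
    qed
  qed (use step.IH in blast)
qed

lemma adj_rtrancl_first_step:
  assumes "(i, j) \<in> (adj E)\<^sup>*" "i \<noteq> j"
  obtains v where "v \<noteq> i" "{i, v} \<in> E" "(v, j) \<in> (adj {e \<in> E. i \<notin> e})\<^sup>*"
  using adj_rtrancl_last_visit[OF assms] by blast

section \<open>Sums over edges as sums over vertices\<close>

text \<open>Each edge is one ordered pair with \<open>i < j\<close> and one with
  \<open>j < i\<close>. Both halves have equal sums because \<open>f\<close> sees only the unordered
  pair, and the diagonal is what remains of the square.\<close>

lemma sum_all_edges_on:
  fixes g :: "nat \<Rightarrow> nat \<Rightarrow> real"
  assumes V: "finite V" and f: "\<And>i j. i \<in> V \<Longrightarrow> j \<in> V \<Longrightarrow> i \<noteq> j \<Longrightarrow> f {i, j} = g i j"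
  shows "2 * (\<Sum>e\<in>all_edges_on V. f e) = (\<Sum>i\<in>V. \<Sum>j\<in>V. g i j) - (\<Sum>i\<in>V. g i i)"
proof -
  define L where "L = {(i, j). i \<in> V \<and> j \<in> V \<and> i < j}"
  define U where "U = {(i, j). i \<in> V \<and> j \<in> V \<and> j < i}"
  have fin: "finite L" "finite U"
    by (rule finite_subset[OF _ finite_cartesian_product[OF V V]]; auto simp: L_def U_def)+
  have "bij_betw (\<lambda>(i, j). {i, j}) L (all_edges_on V)"
  proof (rule bij_betw_imageI)
    show "inj_on (\<lambda>(i, j). {i, j}) L" by (auto simp: inj_on_def L_def doubleton_eq_iff)
    show "(\<lambda>(i, j). {i, j}) ` L = all_edges_on V"
    proof
      show "all_edges_on V \<subseteq> (\<lambda>(i, j). {i, j}) ` L"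
      proof
        fix e assume "e \<in> all_edges_on V"
        then obtain i j where e: "e = {i, j}" "i \<in> V" "j \<in> V" "i \<noteq> j" by (rule all_edges_onE)
        show "e \<in> (\<lambda>(i, j). {i, j}) ` L"
        proof (cases "i < j")
          case True
          then show ?thesis using e by (intro image_eqI[of _ _ "(i, j)"]) (auto simp: L_def)
        next
          case False
          then show ?thesis using e by (intro image_eqI[of _ _ "(j, i)"]) (auto simp: L_def)
        qed
      qed
    qed (auto simp: L_def all_edges_on_def)
  qed
  from sum.reindex_bij_betw[OF this, of f]
  have "(\<Sum>e\<in>all_edges_on V. f e) = (\<Sum>p\<in>L. f (case p of (i, j) \<Rightarrow> {i, j}))" by simp
  also have "\<dots> = (\<Sum>(i, j)\<in>L. g i j)"
    by (rule sum.cong) (auto simp: L_def f)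
  finally have 1: "(\<Sum>e\<in>all_edges_on V. f e) = (\<Sum>(i, j)\<in>L. g i j)" .
  have bU: "bij_betw (\<lambda>(i, j). (j, i)) L U"
    by (rule bij_betwI[where g = "\<lambda>(i, j). (j, i)"]) (auto simp: L_def U_def)
  have "(\<Sum>(i, j)\<in>U. g i j) = (\<Sum>(i, j)\<in>L. g j i)"
    using sum.reindex_bij_betw[OF bU, of "\<lambda>(i, j). g i j"] by (simp add: case_prod_beta)
  also have "\<dots> = (\<Sum>(i, j)\<in>L. g i j)"
  proof (rule sum.cong)
    fix p assume "p \<in> L"
    then obtain i j where "p = (i, j)" "i \<in> V" "j \<in> V" "i \<noteq> j" by (auto simp: L_def)
    then show "(case p of (i, j) \<Rightarrow> g j i) = (case p of (i, j) \<Rightarrow> g i j)"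
      using f[of i j] f[of j i] by (simp add: insert_commute)
  qed simp
  finally have 2: "(\<Sum>(i, j)\<in>U. g i j) = (\<Sum>(i, j)\<in>L. g i j)" .
  have "(\<Sum>i\<in>V. \<Sum>j\<in>V. g i j) = (\<Sum>(i, j)\<in>V \<times> V. g i j)" by (simp add: sum.cartesian_product)
  also have "V \<times> V = (L \<union> U) \<union> (\<lambda>i. (i, i)) ` V" by (auto simp: L_def U_def)
  also have "(\<Sum>(i, j)\<in>\<dots>. g i j) = (\<Sum>(i, j)\<in>L \<union> U. g i j) + (\<Sum>(i, j)\<in>(\<lambda>i. (i, i)) ` V. g i j)"
    using fin V by (intro sum.union_disjoint) (auto simp: L_def U_def)
  also have "(\<Sum>(i, j)\<in>L \<union> U. g i j) = (\<Sum>(i, j)\<in>L. g i j) + (\<Sum>(i, j)\<in>U. g i j)"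
    using fin by (intro sum.union_disjoint) (auto simp: L_def U_def)
  also have "(\<Sum>(i, j)\<in>(\<lambda>i. (i, i)) ` V. g i j) = (\<Sum>i\<in>V. g i i)"
    by (subst sum.reindex) (auto simp: inj_on_def)
  finally show ?thesis using 1 2 by simp
qed

text \<open>For a product weight the double sum is a perfect square. Applied to the masses this
  gives the total rate, applied to their squares the sum of the squared rates.\<close>

lemma sum_all_edges_on_prod:
  fixes z :: "nat \<Rightarrow> real"
  assumes "finite V"
  shows "2 * (\<Sum>e\<in>all_edges_on V. prod z e) = (\<Sum>i\<in>V. z i)\<^sup>2 - (\<Sum>i\<in>V. (z i)\<^sup>2)"
  using sum_all_edges_on[OF assms, of "prod z" "\<lambda>i j. z i * z j"]
  by (simp add: power2_eq_square sum_product)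

section \<open>Weights\<close>

abbreviation unit_interval :: "real measure" where
  "unit_interval \<equiv> restrict_space lborel {0<..<1}"

lemma prob_space_unit_interval: "prob_space unit_interval"
  by (auto simp: emeasure_restrict_space space_restrict_space intro!: prob_spaceI)

context
  fixes M :: "'a measure" and W :: "'a \<Rightarrow> real" and F :: "real \<Rightarrow> real"
  assumes M: "prob_space M" and W[measurable]: "W \<in> borel_measurable M"
    and W0: "AE x in M. 0 \<le> W x"
    and F: "F = cdf (distr M borel W)"
begin

interpretation M: prob_space M by (rule M)
interpretation U: prob_space unit_interval by (rule prob_space_unit_interval)

text \<open>\<open>F\<close> vanishes on the negative axis because \<open>W\<close> is almost surely
  nonnegative, so for positive \<open>u\<close> the restriction to \<open>0 \<le> s\<close> is void.
  This identifies the generalized inverse with the library's quantile function \<open>I\<close> of a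
  \<open>cdf_distribution\<close>.\<close>

lemma gen_inverse_eq:
  assumes "0 < u"
  shows "gen_inverse F u = Inf {x. u \<le> F x}"
proof -
  have "F x = 0" if "x < 0" for x
  proof -
    have "{w \<in> space M. W w \<le> x} \<in> null_sets M"
      using W0 that by (subst AE_iff_null_sets) (auto elim: eventually_mono)
    moreover have "F x = measure M {w \<in> space M. W w \<le> x}"
      unfolding F cdf_def by (subst measure_distr) (auto intro!: arg_cong[where f = "measure M"])
    ultimately show ?thesis by (simp add: measure_eq_0_null_sets)
  qed
  then have "{s. 0 \<le> s \<and> u \<le> F s} = {x. u \<le> F x}"
    using assms by (metis (no_types, lifting) linorder_not_le)
  then show ?thesis using assms by (simp add: gen_inverse_def)
qed

text \<open>For \<open>u < 1\<close> the infimum is over a nonempty set, since \<open>F\<close>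
  tends to 1; the infimum of the empty set would be unspecified.\<close>

lemma gen_inverse_nonneg: "u < 1 \<Longrightarrow> 0 \<le> gen_inverse F u"
proof -
  assume u: "u < 1"
  interpret D: cdf_distribution "distr M borel W"
    by (simp add: cdf_distribution_def M.real_distribution_distr)
  show ?thesis
  proof (cases "u = 0")
    case False
    have "\<forall>\<^sub>F x in at_top. u < F x"
      using order_tendstoD(1)[OF D.cdf_lim_at_top_prob u] by (simp add: F)
    then have "\<forall>\<^sub>F x in at_top. u < F x \<and> 0 \<le> x"
      using eventually_ge_at_top[of 0] by eventually_elim auto
    then have "{s. 0 \<le> s \<and> u \<le> F s} \<noteq> {}"
      using eventually_happens'[OF trivial_limit_at_top_linorder] less_imp_le by fastforce
    then show ?thesis
      using False unfolding gen_inverse_def by (auto intro!: cInf_greatest)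
  qed (simp add: gen_inverse_def)
qed

lemma gen_inverse_mono: "mono_on {0<..<1} (gen_inverse F)"
proof -
  interpret D: cdf_distribution "distr M borel W"
    by (simp add: cdf_distribution_def M.real_distribution_distr)
  have "mono_on {0<..<1} D.I" by (rule D.mono_I)
  then show ?thesis
    by (auto simp: mono_on_def gen_inverse_eq F[symmetric])
qed

lemma distr_gen_inverse: "distr unit_interval borel (gen_inverse F) = distr M borel W"
proof -
  interpret D: cdf_distribution "distr M borel W"
    by (simp add: cdf_distribution_def M.real_distribution_distr)
  have "distr unit_interval borel (gen_inverse F) = distr unit_interval borel D.I"
    by (intro distr_cong) (auto simp: gen_inverse_eq space_restrict_space F[symmetric])
  then show ?thesis using D.distr_I_eq_M by simp
qed

lemma gen_inverse_measurable[measurable]: "gen_inverse F \<in> borel_measurable unit_interval"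
proof -
  interpret D: cdf_distribution "distr M borel W"
    by (simp add: cdf_distribution_def M.real_distribution_distr)
  have "D.I \<in> borel_measurable unit_interval" by measurable
  then show ?thesis
    by (rule measurable_cong[THEN iffD1, rotated]) (auto simp: gen_inverse_eq space_restrict_space F[symmetric])
qed

text \<open>The quantile transform: evaluated at a uniform variable, the generalized inverse has the
  law of \<open>W\<close>. Sums of weights thereby become Riemann sums for the moments of
  \<open>W\<close>.\<close>

lemma integral_gen_inverse:
  fixes h :: "real \<Rightarrow> real"
  assumes [measurable]: "h \<in> borel_measurable borel"
  shows "(\<integral>u. h (gen_inverse F u) \<partial>unit_interval) = (\<integral>x. h (W x) \<partial>M)" (is "?A = ?B")
    and "integrable unit_interval (\<lambda>u. h (gen_inverse F u)) \<longleftrightarrow> integrable M (\<lambda>x. h (W x))" (is "?C \<longleftrightarrow> ?D")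
proof -
  have "?A = integral\<^sup>L (distr unit_interval borel (gen_inverse F)) h"
    by (rule integral_distr[symmetric]) measurable
  also have "\<dots> = ?B" unfolding distr_gen_inverse by (rule integral_distr) measurable
  finally show "?A = ?B" .
  have "?C \<longleftrightarrow> integrable (distr unit_interval borel (gen_inverse F)) h"
    by (rule integrable_distr_eq[symmetric]) measurable
  also have "\<dots> \<longleftrightarrow> ?D" unfolding distr_gen_inverse by (rule integrable_distr_eq) measurable
  finally show "?C \<longleftrightarrow> ?D" .
qed

section \<open>Riemann sums of the quantile function\<close>

text \<open>The left end is the point where \<open>weight F n i\<close> evaluates the quantile
  function, the right end the one of index i - 1. By monotonicity the first weight bounds the
  quantile function on the cell from below, and for \<open>i \<ge> 2\<close> the second bounds it
  from above.\<close>

definition cell :: "nat \<Rightarrow> nat \<Rightarrow> real set" where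
  "cell n i = {1 - real i / real n..<1 - (real i - 1) / real n}"

lemma weight_nonneg:
  assumes "i \<in> {1..n}"
  shows "0 \<le> weight F n i"
  unfolding weight_def by (intro gen_inverse_nonneg) (use assms in simp)

lemma measure_cell:
  assumes "i \<in> {1..n}"
  shows "measure unit_interval (cell n i \<inter> {0<..<1}) = 1 / real n" "cell n i \<inter> {0<..<1} \<in> sets unit_interval"
proof -
  have 0: "0 \<le> 1 - real i / real n" "1 - (real i - 1) / real n \<le> 1"
    using assms by (auto simp: field_simps)
  have "cell n i \<in> sets lborel" by (simp add: cell_def)
  then show "cell n i \<inter> {0<..<1} \<in> sets unit_interval" by (auto simp: sets_restrict_space)
  have "measure unit_interval (cell n i \<inter> {0<..<1}) = measure lborel (cell n i \<inter> {0<..<1})"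
    by (rule measure_restrict_space) auto
  also have "\<dots> = measure lborel {1 - real i / real n..<1 - (real i - 1) / real n}"
  \<comment> \<open>The last cell contains 0, which lies outside the open unit interval; its measure
    is not affected.\<close>
  proof (cases "i = n")
    case True
    then have "cell n i = {0..<1 - (real i - 1) / real n}" using assms by (simp add: cell_def)
    moreover have "{0..<b} \<inter> {0<..<1} = {0<..<b}" if "b \<le> 1" for b :: real using that by auto
    ultimately have "cell n i \<inter> {0<..<1} = {0<..<1 - (real i - 1) / real n}" using 0(2) by metis
    then show ?thesis using True assms 0 by simp
  next
    case False
    then have "0 < 1 - real i / real n" using assms by (auto simp: field_simps)
    then have "cell n i \<inter> {0<..<1} = cell n i" using 0 by (auto simp: cell_def)
    then show ?thesis by (simp add: cell_def)
  qed
  also have "\<dots> = 1 / real n" using assms by (simp add: field_simps)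
  finally show "measure unit_interval (cell n i \<inter> {0<..<1}) = 1 / real n" .
qed

lemma cell_unique:
  assumes n: "n > 0" and u: "u \<in> {0<..<1}"
  obtains k where "k \<in> {1..n}" "\<And>i. u \<in> cell n i \<longleftrightarrow> i = k"
proof -
  have iff: "u \<in> cell n i \<longleftrightarrow> real i - 1 < real n * (1 - u) \<and> real n * (1 - u) \<le> real i" for i
    using n by (auto simp: cell_def field_simps)
  define k where "k = nat \<lceil>real n * (1 - u)\<rceil>"
  have pos: "0 < real n * (1 - u)" "real n * (1 - u) < real n" using n u by auto
  then have rk: "real k = of_int \<lceil>real n * (1 - u)\<rceil>" by (simp add: k_def)
  have k1: "real k - 1 < real n * (1 - u)" "real n * (1 - u) \<le> real k" unfolding rk by linarith+
  have "k \<in> {1..n}" using k1 pos by auto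
  moreover have "u \<in> cell n i \<longleftrightarrow> i = k" for i
  proof
    assume "u \<in> cell n i"
    then have "real i < real k + 1" "real k < real i + 1" using k1 unfolding iff by linarith+
    then show "i = k" by linarith
  qed (use k1 iff in simp)
  ultimately show ?thesis by (rule that)
qed

lemma integral_cells:
  fixes a :: "nat \<Rightarrow> real"
  assumes "A \<subseteq> {1..n}"
  shows "integrable unit_interval (\<lambda>u. \<Sum>i\<in>A. a i * indicator (cell n i \<inter> {0<..<1}) u)"
    and "(\<integral>u. (\<Sum>i\<in>A. a i * indicator (cell n i \<inter> {0<..<1}) u) \<partial>unit_interval) = (\<Sum>i\<in>A. a i) / real n"
proof -
  have int: "integrable unit_interval (\<lambda>u. a i * indicator (cell n i \<inter> {0<..<1}) u)" if "i \<in> A" for i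
    using measure_cell(2)[of i n] that assms U.emeasure_finite by (intro integrable_mult_right) (auto simp: less_top[symmetric])
  then show "integrable unit_interval (\<lambda>u. \<Sum>i\<in>A. a i * indicator (cell n i \<inter> {0<..<1}) u)"
    by (intro Bochner_Integration.integrable_sum)
  have "(\<integral>u. (\<Sum>i\<in>A. a i * indicator (cell n i \<inter> {0<..<1}) u) \<partial>unit_interval)
      = (\<Sum>i\<in>A. \<integral>u. a i * indicator (cell n i \<inter> {0<..<1}) u \<partial>unit_interval)"
    using int by (intro Bochner_Integration.integral_sum)
  also have "\<dots> = (\<Sum>i\<in>A. a i * (1 / real n))"
    using assms measure_cell[of _ n]
    by (intro sum.cong refl) (auto simp: space_restrict_space Int_assoc subset_eq)
  finally show "(\<integral>u. (\<Sum>i\<in>A. a i * indicator (cell n i \<inter> {0<..<1}) u) \<partial>unit_interval) = (\<Sum>i\<in>A. a i) / real n"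
    by (simp add: sum_divide_distrib)
qed

lemma sum_indicator_cells:
  fixes a :: "nat \<Rightarrow> real"
  assumes "u \<in> {0<..<1}" "\<And>i. u \<in> cell n i \<longleftrightarrow> i = k" "A \<subseteq> {1..n}"
  shows "(\<Sum>i\<in>A. a i * indicator (cell n i \<inter> {0<..<1}) u) = (if k \<in> A then a k else 0)"
proof -
  have "(\<Sum>i\<in>A. a i * indicator (cell n i \<inter> {0<..<1}) u) = (\<Sum>i\<in>A. if i = k then a k else 0)"
    using assms by (intro sum.cong) (auto simp: indicator_def)
  then show ?thesis using finite_subset[OF assms(3)] by simp
qed

text \<open>A lower Riemann sum of a monotone function, since every weight is the quantile at the
  left end of its cell.\<close>

lemma sum_weight_power_le:
  assumes k: "k \<ge> 1" and int: "integrable M (\<lambda>x. W x ^ k)" and n: "n > 0"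
  shows "(\<Sum>i=1..n. weight F n i ^ k) \<le> real n * (\<integral>x. W x ^ k \<partial>M)"
proof -
  have "(\<integral>u. (\<Sum>i\<in>{1..n}. weight F n i ^ k * indicator (cell n i \<inter> {0<..<1}) u) \<partial>unit_interval)
      \<le> (\<integral>u. gen_inverse F u ^ k \<partial>unit_interval)"
  proof (rule integral_mono)
    show "integrable unit_interval (\<lambda>u. gen_inverse F u ^ k)"
      using integral_gen_inverse(2)[of "\<lambda>x. x ^ k"] int by simp
    fix u assume "u \<in> space unit_interval"
    then have u: "u \<in> {0<..<1}" by (simp add: space_restrict_space)
    obtain j where j: "j \<in> {1..n}" "\<And>i. u \<in> cell n i \<longleftrightarrow> i = j" using cell_unique[OF n u] by blast
    have "u \<in> cell n j" using j by simp
    then have "1 - real j / real n \<le> u" by (simp add: cell_def)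
    have "weight F n j \<le> gen_inverse F u"
    \<comment> \<open>The last weight is the quantile at 0, which is 0 by convention and outside the
      range of \<open>gen_inverse_mono\<close>.\<close>
    proof (cases "j = n")
      case True
      then show ?thesis using gen_inverse_nonneg[of u] u n by (simp add: weight_def gen_inverse_def)
    next
      case False
      then have "1 - real j / real n \<in> {0<..<1}" using j(1) by (auto simp: field_simps)
      then show ?thesis
        unfolding weight_def using u \<open>1 - real j / real n \<le> u\<close> by (intro mono_onD[OF gen_inverse_mono])
    qed
    then have "weight F n j ^ k \<le> gen_inverse F u ^ k"
      using j(1) weight_nonneg[of j n] by (intro power_mono) auto
    then show "(\<Sum>i\<in>{1..n}. weight F n i ^ k * indicator (cell n i \<inter> {0<..<1}) u) \<le> gen_inverse F u ^ k"
      using sum_indicator_cells[OF u j(2), of "{1..n}"] j(1) by simp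
  qed (rule integral_cells(1), simp)
  then have "(\<Sum>i=1..n. weight F n i ^ k) / real n \<le> (\<integral>x. W x ^ k \<partial>M)"
    using integral_gen_inverse(1)[of "\<lambda>x. x ^ k"] integral_cells(2)[of "{1..n}" n] by simp
  then show ?thesis using n by (simp add: field_simps)
qed

text \<open>An upper Riemann sum: on cell \<open>i\<close> with \<open>i \<ge> 2\<close> the
  quantile is at most the weight of index i - 1. The first cell ends at 1, where the quantile may be
  infinite, so its integral is kept as the tail term.\<close>

lemma expectation_le_total_weight:
  assumes int: "integrable M W" and n: "n > 0"
  shows "(\<integral>x. W x \<partial>M) \<le> total_weight F n / real n +
    (\<integral>u. gen_inverse F u * indicator {1 - 1 / real n..} u \<partial>unit_interval)"
proof -
  have intJ: "integrable unit_interval (gen_inverse F)"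
    using integral_gen_inverse(2)[of "\<lambda>x. x"] int by simp
  have "(\<lambda>u. indicator {1 - 1 / real n..} u :: real) \<in> borel_measurable unit_interval"
    by (intro measurable_restrict_space1) measurable
  then have intT: "integrable unit_interval (\<lambda>u. gen_inverse F u * indicator {1 - 1 / real n..} u)"
    by (intro Bochner_Integration.integrable_bound[OF intJ] borel_measurable_times gen_inverse_measurable)
      (auto simp: indicator_def)
  let ?a = "\<lambda>i. weight F n (i - 1)"
  have sub: "{2..n} \<subseteq> {1..n}" by auto
  have "(\<integral>x. W x \<partial>M) = (\<integral>u. gen_inverse F u \<partial>unit_interval)"
    using integral_gen_inverse(1)[of "\<lambda>x. x"] by simp
  also have "\<dots> \<le> (\<integral>u. (\<Sum>i\<in>{2..n}. ?a i * indicator (cell n i \<inter> {0<..<1}) u)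
      + gen_inverse F u * indicator {1 - 1 / real n..} u \<partial>unit_interval)"
  proof (rule integral_mono[OF intJ])
    show "integrable unit_interval (\<lambda>u. (\<Sum>i\<in>{2..n}. ?a i * indicator (cell n i \<inter> {0<..<1}) u)
      + gen_inverse F u * indicator {1 - 1 / real n..} u)"
      by (intro Bochner_Integration.integrable_add integral_cells(1)[OF sub] intT)
    fix u assume "u \<in> space unit_interval"
    then have u: "u \<in> {0<..<1}" by (simp add: space_restrict_space)
    obtain j where j: "j \<in> {1..n}" "\<And>i. u \<in> cell n i \<longleftrightarrow> i = j" using cell_unique[OF n u] by blast
    have uj: "u \<in> cell n j" using j by simp
    have s: "(\<Sum>i\<in>{2..n}. ?a i * indicator (cell n i \<inter> {0<..<1}) u) = (if j \<in> {2..n} then ?a j else 0)"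
      by (rule sum_indicator_cells[OF u j(2)]) auto
    show "gen_inverse F u \<le> (\<Sum>i\<in>{2..n}. ?a i * indicator (cell n i \<inter> {0<..<1}) u)
      + gen_inverse F u * indicator {1 - 1 / real n..} u"
    proof (cases "j = 1")
      case True
      then have "u \<in> {1 - 1 / real n..}" using uj by (auto simp: cell_def)
      then show ?thesis unfolding s using True by simp
    next
      case False
      then have j2: "j \<in> {2..n}" using j(1) by auto
      then have r: "real (j - 1) = real j - 1" by (simp add: of_nat_diff)
      have "u \<le> 1 - real (j - 1) / real n" using uj unfolding r by (simp add: cell_def)
      moreover have "1 - real (j - 1) / real n \<in> {0<..<1}" using j2 by (auto simp: r field_simps)
      ultimately have "gen_inverse F u \<le> ?a j"
        unfolding weight_def using u by (intro mono_onD[OF gen_inverse_mono])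
      moreover have "0 \<le> gen_inverse F u * indicator {1 - 1 / real n..} u"
        using gen_inverse_nonneg[of u] u by (simp add: indicator_def)
      ultimately show ?thesis unfolding s using j2 by simp
    qed
  qed
  also have "\<dots> = (\<Sum>i\<in>{2..n}. ?a i) / real n + (\<integral>u. gen_inverse F u * indicator {1 - 1 / real n..} u \<partial>unit_interval)"
    by (simp only: Bochner_Integration.integral_add[OF integral_cells(1)[OF sub] intT] integral_cells(2)[OF sub])
  also have "(\<Sum>i\<in>{2..n}. ?a i) \<le> total_weight F n"
  proof -
    have "(\<Sum>i\<in>{2..n}. ?a i) = (\<Sum>i\<in>{1..n-1}. weight F n i)"
      by (rule sum.reindex_bij_witness[of _ Suc "\<lambda>i. i - 1"]) auto
    also have "\<dots> \<le> (\<Sum>i\<in>{1..n}. weight F n i)"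
      by (intro sum_mono2) (auto intro: weight_nonneg)
    finally show ?thesis by (simp add: total_weight_def)
  qed
  finally show ?thesis using n by (simp add: divide_right_mono)
qed

text \<open>The two Riemann sums place the deficit between 0 and the tail integral. A weighted
  inequality between arithmetic and geometric mean bounds sqrt n times the quantile on the tail by
  its square, whose tail integral vanishes by dominated convergence.\<close>

lemma total_weight_asymp:
  assumes int: "integrable M W" and int2: "integrable M (\<lambda>x. (W x)\<^sup>2)"
  shows "(\<lambda>n. sqrt (real n) * ((\<integral>x. W x \<partial>M) - total_weight F n / real n)) \<longlonglongrightarrow> 0"
proof (rule tendstoI)
  fix e :: real assume e: "e > 0"
  let ?J = "gen_inverse F"
  let ?T = "\<lambda>n u. indicator {1 - 1 / real n..} u :: real"
  have intJ: "integrable unit_interval ?J" "integrable unit_interval (\<lambda>u. (?J u)\<^sup>2)"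
    using integral_gen_inverse(2)[of "\<lambda>x. x"] integral_gen_inverse(2)[of "\<lambda>x. x\<^sup>2"] int int2 by auto
  have T[measurable]: "?T n \<in> borel_measurable unit_interval" for n
    by (intro measurable_restrict_space1) measurable
  have "(\<lambda>n. \<integral>u. (?J u)\<^sup>2 * ?T n u \<partial>unit_interval) \<longlonglongrightarrow> (\<integral>u. 0 \<partial>unit_interval)"
  proof (rule integral_dominated_convergence[where w = "\<lambda>u. (?J u)\<^sup>2"])
    show "AE u in unit_interval. (\<lambda>n. (?J u)\<^sup>2 * ?T n u) \<longlonglongrightarrow> 0"
    proof (rule AE_I2)
      fix u assume "u \<in> space unit_interval"
      then have "u < 1" by (simp add: space_restrict_space)
      moreover have "(\<lambda>n. 1 - 1 / real n) \<longlonglongrightarrow> 1" by real_asymp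
      ultimately have "\<forall>\<^sub>F n in sequentially. u < 1 - 1 / real n" by (intro order_tendstoD)
      then have "\<forall>\<^sub>F n in sequentially. (?J u)\<^sup>2 * ?T n u = 0"
        by eventually_elim auto
      then show "(\<lambda>n. (?J u)\<^sup>2 * ?T n u) \<longlonglongrightarrow> 0" by (rule tendsto_eventually)
    qed
    show "(\<lambda>u. (?J u)\<^sup>2 * ?T n u) \<in> borel_measurable unit_interval" for n
      by (intro borel_measurable_times borel_measurable_power gen_inverse_measurable T)
    show "AE u in unit_interval. norm ((?J u)\<^sup>2 * ?T n u) \<le> (?J u)\<^sup>2" for n
      by (intro AE_I2) (auto simp: indicator_def)
  qed (use intJ in auto)
  then have "\<forall>\<^sub>F n in sequentially. (\<integral>u. (?J u)\<^sup>2 * ?T n u \<partial>unit_interval) < e\<^sup>2"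
    using e by (intro order_tendstoD) auto
  then show "\<forall>\<^sub>F n in sequentially. dist (sqrt (real n) * ((\<integral>x. W x \<partial>M) - total_weight F n / real n)) 0 < e"
    using eventually_gt_at_top[of 0]
  proof eventually_elim
    case (elim n)
    have i1: "integrable unit_interval (\<lambda>u. ?J u * ?T n u)"
      by (intro Bochner_Integration.integrable_bound[OF intJ(1)] borel_measurable_times gen_inverse_measurable T)
        (auto simp: indicator_def)
    have i2: "integrable unit_interval (\<lambda>u. (?J u)\<^sup>2 * ?T n u)"
      by (intro Bochner_Integration.integrable_bound[OF intJ(2)] borel_measurable_times
          borel_measurable_power gen_inverse_measurable T) (auto simp: indicator_def)
    have i3: "integrable unit_interval (?T n)"
      by (rule U.integrable_const_bound[where B = 1, OF _ T]) (auto simp: indicator_def)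
    have c1: "{1 - 1 / real n..} \<inter> {0<..<1} = cell n 1 \<inter> {0<..<1}"
      by (auto simp: cell_def)
    have mT: "(\<integral>u. ?T n u \<partial>unit_interval) = 1 / real n"
    proof -
      have "(\<integral>u. ?T n u \<partial>unit_interval) = measure unit_interval ({1 - 1 / real n..} \<inter> space unit_interval)"
        by (simp)
      then show ?thesis using measure_cell(1)[of 1 n] elim by (simp add: space_restrict_space c1)
    qed
    have "sqrt (real n) * (\<integral>u. ?J u * ?T n u \<partial>unit_interval) = (\<integral>u. sqrt (real n) * (?J u * ?T n u) \<partial>unit_interval)"
      by simp
    also have "\<dots> \<le> (\<integral>u. ((?J u)\<^sup>2 * ?T n u) / (2 * e) + e * real n / 2 * ?T n u \<partial>unit_interval)"
    proof (rule integral_mono)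
      fix u
      \<comment> \<open>The weight \<open>e\<close> is chosen such that, over a tail of length 1/n,
        the square contributes less than e / 2 and the constant exactly e / 2.\<close>
      have "0 \<le> (?J u - e * sqrt (real n))\<^sup>2" by simp
      then have "2 * e * (sqrt (real n) * ?J u) \<le> (?J u)\<^sup>2 + e\<^sup>2 * real n"
        by (simp add: power2_diff power_mult_distrib algebra_simps)
      then have "sqrt (real n) * ?J u \<le> (?J u)\<^sup>2 / (2 * e) + e * real n / 2"
        using e by (simp add: field_simps power2_eq_square)
      then show "sqrt (real n) * (?J u * ?T n u) \<le> ((?J u)\<^sup>2 * ?T n u) / (2 * e) + e * real n / 2 * ?T n u"
        by (simp add: indicator_def)
    qed (use i1 i2 i3 in auto)
    also have "\<dots> = (\<integral>u. (?J u)\<^sup>2 * ?T n u \<partial>unit_interval) / (2 * e) + e / 2"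
    proof -
      have "(\<integral>u. ((?J u)\<^sup>2 * ?T n u) / (2 * e) + e * real n / 2 * ?T n u \<partial>unit_interval)
          = (\<integral>u. (?J u)\<^sup>2 * ?T n u \<partial>unit_interval) / (2 * e) + e * real n / 2 * (\<integral>u. ?T n u \<partial>unit_interval)"
        using i2 i3 by (subst Bochner_Integration.integral_add)
          (simp_all only: integral_mult_right_zero integral_divide_zero integrable_mult_right integrable_divide)
      then show ?thesis unfolding mT using elim by simp
    qed
    also have "\<dots> < e\<^sup>2 / (2 * e) + e / 2"
      using elim e by (intro add_strict_right_mono divide_strict_right_mono) auto
    also have "\<dots> = e" using e by (simp add: power2_eq_square)
    finally have tail: "sqrt (real n) * (\<integral>u. ?J u * ?T n u \<partial>unit_interval) < e" .
    have "(\<integral>x. W x \<partial>M) - total_weight F n / real n \<le> (\<integral>u. ?J u * ?T n u \<partial>unit_interval)"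
      using expectation_le_total_weight[OF int, of n] elim by simp
    then have "sqrt (real n) * ((\<integral>x. W x \<partial>M) - total_weight F n / real n) < e"
      using tail mult_left_mono[of _ _ "sqrt (real n)"] by fastforce
    moreover have "total_weight F n \<le> real n * (\<integral>x. W x \<partial>M)"
      using sum_weight_power_le[of 1 n] int elim by (simp add: total_weight_def)
    then have "0 \<le> sqrt (real n) * ((\<integral>x. W x \<partial>M) - total_weight F n / real n)"
      using elim by (simp add: field_simps)
    ultimately show ?case by simp
  qed
qed

end

section \<open>The edge clocks\<close>

text \<open>Induction over the index set. In the expansions of (S + x)^2 and (S + x)^4 every term
  with a first power of S or x has expectation 0 by independence; for this the mean of the partial
  sum is carried along. The bound 1 on \<xi> reduces the fourth moment of one summand to its
  variance, and the mixed term with factor 6 is the cross term of 3 (a + b)^2.\<close>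

lemma (in prob_space) fourth_moment_sum:
  fixes \<xi> :: "'i \<Rightarrow> 'a \<Rightarrow> real"
  assumes I: "finite I" and ind: "indep_vars (\<lambda>_. borel) \<xi> I"
    and bound: "\<And>i \<omega>. i \<in> I \<Longrightarrow> \<bar>\<xi> i \<omega>\<bar> \<le> 1"
    and mean: "\<And>i. i \<in> I \<Longrightarrow> expectation (\<xi> i) = 0"
    and var: "\<And>i. i \<in> I \<Longrightarrow> expectation (\<lambda>\<omega>. (\<xi> i \<omega>)\<^sup>2) \<le> v i"
  shows "expectation (\<lambda>\<omega>. (\<Sum>i\<in>I. \<xi> i \<omega>)\<^sup>2) \<le> sum v I"
    and "expectation (\<lambda>\<omega>. (\<Sum>i\<in>I. \<xi> i \<omega>) ^ 4) \<le> sum v I + 3 * (sum v I)\<^sup>2"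
proof -
  have *: "expectation (\<lambda>\<omega>. \<Sum>i\<in>I. \<xi> i \<omega>) = 0 \<and> expectation (\<lambda>\<omega>. (\<Sum>i\<in>I. \<xi> i \<omega>)\<^sup>2) \<le> sum v I \<and>
      expectation (\<lambda>\<omega>. (\<Sum>i\<in>I. \<xi> i \<omega>) ^ 4) \<le> sum v I + 3 * (sum v I)\<^sup>2 \<and> 0 \<le> sum v I"
    using I assms(2-)
  proof (induction I)
    case empty
    then show ?case by simp
  next
    case (insert k I)
    define S where "S \<omega> = (\<Sum>i\<in>I. \<xi> i \<omega>)" for \<omega>
    let ?x = "\<xi> k"
    have rv: "random_variable borel (\<xi> i)" if "i \<in> insert k I" for i
      using insert.prems(1) that by (auto simp: indep_vars_def)
    have [measurable]: "?x \<in> borel_measurable M" using rv by blast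
    have [measurable]: "S \<in> borel_measurable M" unfolding S_def using rv by (intro borel_measurable_sum) auto
    have Sb: "\<bar>S \<omega>\<bar> \<le> real (card I)" for \<omega>
      unfolding S_def using insert.prems(2) by (intro order_trans[OF sum_abs] sum_bounded_above[where K = 1, simplified]) auto
    have intS: "integrable M (\<lambda>\<omega>. S \<omega> ^ p)" for p
      by (rule integrable_const_bound[where B = "real (card I) ^ p"])
        (auto simp: power_abs intro!: power_mono Sb)
    have intx: "integrable M (\<lambda>\<omega>. ?x \<omega> ^ p)" for p
      by (rule integrable_const_bound[where B = 1])
        (auto simp: power_abs intro!: power_le_one insert.prems(2))
    have indx: "indep_var borel ?x borel S"
      unfolding S_def using insert by (intro indep_vars_sum) auto
    have prod: "expectation (\<lambda>\<omega>. S \<omega> ^ p * ?x \<omega> ^ r) = expectation (\<lambda>\<omega>. S \<omega> ^ p) * expectation (\<lambda>\<omega>. ?x \<omega> ^ r)"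
      and intp: "integrable M (\<lambda>\<omega>. S \<omega> ^ p * ?x \<omega> ^ r)" for p r
    proof -
      have "indep_var borel ((\<lambda>x. x ^ r) \<circ> ?x) borel ((\<lambda>x. x ^ p) \<circ> S)"
        by (intro indep_var_compose[OF indx]) auto
      then have i: "indep_var borel (\<lambda>\<omega>. ?x \<omega> ^ r) borel (\<lambda>\<omega>. S \<omega> ^ p)" by (simp add: comp_def)
      show "expectation (\<lambda>\<omega>. S \<omega> ^ p * ?x \<omega> ^ r) = expectation (\<lambda>\<omega>. S \<omega> ^ p) * expectation (\<lambda>\<omega>. ?x \<omega> ^ r)"
        using indep_var_lebesgue_integral[OF i intx intS] by (simp add: mult.commute)
      show "integrable M (\<lambda>\<omega>. S \<omega> ^ p * ?x \<omega> ^ r)"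
        using indep_var_integrable[OF i intx intS] by (simp add: mult.commute)
    qed
    have IH: "expectation S = 0" "expectation (\<lambda>\<omega>. (S \<omega>)\<^sup>2) \<le> sum v I"
      "expectation (\<lambda>\<omega>. S \<omega> ^ 4) \<le> sum v I + 3 * (sum v I)\<^sup>2" "0 \<le> sum v I"
      using insert.IH indep_vars_subset[OF insert.prems(1), of I] insert.prems(2-4) unfolding S_def by blast+
    have x0: "expectation ?x = 0" and x2: "expectation (\<lambda>\<omega>. (?x \<omega>)\<^sup>2) \<le> v k" using insert.prems by auto
    have x2_0: "0 \<le> expectation (\<lambda>\<omega>. (?x \<omega>)\<^sup>2)" by (rule integral_nonneg_AE) simp
    have x4: "expectation (\<lambda>\<omega>. ?x \<omega> ^ 4) \<le> v k"
    proof -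
      have "expectation (\<lambda>\<omega>. ?x \<omega> ^ 4) \<le> expectation (\<lambda>\<omega>. (?x \<omega>)\<^sup>2)"
      proof (rule integral_mono[OF intx intx])
        fix \<omega>
        have "(?x \<omega>)\<^sup>2 \<le> 1" using insert.prems(2)[of k \<omega>] by (simp add: abs_square_le_1)
        then have "(?x \<omega>)\<^sup>2 * (?x \<omega>)\<^sup>2 \<le> (?x \<omega>)\<^sup>2 * 1" by (intro mult_left_mono) auto
        then show "?x \<omega> ^ 4 \<le> (?x \<omega>)\<^sup>2" by (simp add: power_numeral_reduce algebra_simps)
      qed
      then show ?thesis using x2 by simp
    qed
    have sm: "(\<Sum>i\<in>insert k I. \<xi> i \<omega>) = S \<omega> + ?x \<omega>" for \<omega>
      using insert.hyps by (simp add: S_def add.commute)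
    have sv: "sum v (insert k I) = sum v I + v k" using insert.hyps by simp
    have e1: "expectation (\<lambda>\<omega>. S \<omega> + ?x \<omega>) = 0"
      using intS[of 1] intx[of 1] IH x0 by simp
    have "expectation (\<lambda>\<omega>. (S \<omega> + ?x \<omega>)\<^sup>2) =
        expectation (\<lambda>\<omega>. S \<omega> ^ 2 + 2 * (S \<omega> ^ 1 * ?x \<omega> ^ 1) + ?x \<omega> ^ 2)"
      by (rule Bochner_Integration.integral_cong) (auto simp: power2_sum)
    also have "\<dots> = expectation (\<lambda>\<omega>. S \<omega> ^ 2) + 2 * expectation (\<lambda>\<omega>. S \<omega> ^ 1 * ?x \<omega> ^ 1) + expectation (\<lambda>\<omega>. ?x \<omega> ^ 2)"
      using intS intx intp[of 1 1] intp[of 3 1] intp[of 1 3] intp[of 2 2] by simp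
    also have "\<dots> = expectation (\<lambda>\<omega>. (S \<omega>)\<^sup>2) + expectation (\<lambda>\<omega>. (?x \<omega>)\<^sup>2)"
      unfolding prod using x0 by simp
    finally have e2: "expectation (\<lambda>\<omega>. (S \<omega> + ?x \<omega>)\<^sup>2) \<le> sum v I + v k" using IH x2 by simp
    have "expectation (\<lambda>\<omega>. (S \<omega> + ?x \<omega>) ^ 4) =
        expectation (\<lambda>\<omega>. S \<omega> ^ 4 + 4 * (S \<omega> ^ 3 * ?x \<omega> ^ 1) + 6 * (S \<omega> ^ 2 * ?x \<omega> ^ 2)
          + 4 * (S \<omega> ^ 1 * ?x \<omega> ^ 3) + ?x \<omega> ^ 4)"
      by (rule Bochner_Integration.integral_cong) (auto simp: power_numeral_reduce algebra_simps)
    also have "\<dots> = expectation (\<lambda>\<omega>. S \<omega> ^ 4) + 4 * expectation (\<lambda>\<omega>. S \<omega> ^ 3 * ?x \<omega> ^ 1)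
        + 6 * expectation (\<lambda>\<omega>. S \<omega> ^ 2 * ?x \<omega> ^ 2) + 4 * expectation (\<lambda>\<omega>. S \<omega> ^ 1 * ?x \<omega> ^ 3)
        + expectation (\<lambda>\<omega>. ?x \<omega> ^ 4)"
      using intS intx intp[of 1 1] intp[of 3 1] intp[of 1 3] intp[of 2 2] by simp
    also have "\<dots> = expectation (\<lambda>\<omega>. S \<omega> ^ 4) + 6 * (expectation (\<lambda>\<omega>. (S \<omega>)\<^sup>2) * expectation (\<lambda>\<omega>. (?x \<omega>)\<^sup>2))
        + expectation (\<lambda>\<omega>. ?x \<omega> ^ 4)"
      unfolding prod using x0 IH(1) by simp
    also have "\<dots> \<le> (sum v I + 3 * (sum v I)\<^sup>2) + 6 * (sum v I * v k) + v k"
      using IH x2 x2_0 x4 by (intro add_mono mult_left_mono mult_mono) auto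
    also have "\<dots> \<le> (sum v I + v k) + 3 * (sum v I + v k)\<^sup>2"
      by (simp add: power2_sum algebra_simps)
    finally show ?case unfolding sm sv using e1 e2 IH(4) order_trans[OF x2_0 x2] by auto
  qed
  then show "expectation (\<lambda>\<omega>. (\<Sum>i\<in>I. \<xi> i \<omega>)\<^sup>2) \<le> sum v I"
    "expectation (\<lambda>\<omega>. (\<Sum>i\<in>I. \<xi> i \<omega>) ^ 4) \<le> sum v I + 3 * (sum v I)\<^sup>2" by auto
qed

text \<open>At rate 0 the clock sits at infinity and both sides are 0, so vertices of mass 0 need no
  separate treatment later.\<close>

lemma measure_exponential_time:
  assumes "0 \<le> r" "0 \<le> t"
  shows "measure (exponential_time r) {..ereal t} = 1 - exp (- t * r)"
proof (cases "r > 0")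
  case True
  let ?E = "density lborel (exponential_density r)"
  interpret E: prob_space ?E by (rule prob_space_exponential_density[OF True])
  have "measure (exponential_time r) {..ereal t} = measure ?E {x \<in> space ?E. x \<le> t}"
    using True by (simp add: exponential_time_def) (subst measure_distr; auto intro!: arg_cong[where f = "measure ?E"])
  also have "\<dots> = 1 - exp (- t * r)"
    using E.exponential_distributedD_le[of "\<lambda>x. x" r t] True assms
    by (simp add: distributed_def distr_id2 exponential_density_nonneg)
  finally show ?thesis .
next
  case False
  then show ?thesis using assms by (simp add: exponential_time_def measure_return)
qed

lemma exp_diff_le:
  fixes r s t :: real
  assumes "0 \<le> r" "0 \<le> s" "s \<le> t"
  shows "exp (- s * r) - exp (- t * r) \<le> (t - s) * r"
proof -
  have "exp (- s * r) - exp (- t * r) = exp (- s * r) * (1 - exp (- ((t - s) * r)))"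
    by (simp add: algebra_simps exp_add[symmetric])
  also have "\<dots> \<le> 1 * ((t - s) * r)"
    using assms exp_ge_add_one_self[of "- ((t - s) * r)"] by (intro mult_mono) auto
  finally show ?thesis by simp
qed

text \<open>Passes through 1 / (1 + x). The coefficient 1 of the square is cruder than 1 / 2, but
  only the order matters in the applications.\<close>

lemma exp_minus_le:
  fixes x :: real
  assumes x: "0 \<le> x"
  shows "exp (- x) \<le> 1 - x + x\<^sup>2"
proof -
  have "exp (- x) * (1 + x) \<le> exp (- x) * exp x"
    by (intro mult_left_mono exp_ge_add_one_self) simp
  then have "exp (- x) \<le> 1 / (1 + x)" using x by (simp add: exp_minus field_simps)
  also have "\<dots> \<le> 1 - x + x\<^sup>2"
  proof -
    have "0 \<le> x * x * x" using x by simp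
    then have "1 \<le> (1 - x + x\<^sup>2) * (1 + x)" by (simp add: algebra_simps power2_eq_square)
    then show ?thesis using x by (simp add: pos_divide_le_eq)
  qed
  finally show ?thesis .
qed

lemma (in prob_space) indep_var_prob_conj:
  assumes "indep_var N1 X1 N2 X2" "Measurable.pred N1 \<Phi>" "Measurable.pred N2 \<Psi>"
  shows "prob {\<omega> \<in> space M. \<Phi> (X1 \<omega>) \<and> \<Psi> (X2 \<omega>)} = prob {\<omega> \<in> space M. \<Phi> (X1 \<omega>)} * prob {\<omega> \<in> space M. \<Psi> (X2 \<omega>)}"
proof -
  have rv: "X1 \<in> M \<rightarrow>\<^sub>M N1" "X2 \<in> M \<rightarrow>\<^sub>M N2"
    using assms(1) by (auto dest: indep_var_rv1 indep_var_rv2)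
  let ?A = "{x \<in> space N1. \<Phi> x}" and ?B = "{x \<in> space N2. \<Psi> x}"
  have AB: "?A \<in> sets N1" "?B \<in> sets N2" using assms(2,3) by (auto simp: pred_def)
  have "(\<lambda>x. (X1 x, X2 x)) -` (?A \<times> ?B) \<inter> space M = {\<omega> \<in> space M. \<Phi> (X1 \<omega>) \<and> \<Psi> (X2 \<omega>)}"
    "X1 -` ?A \<inter> space M = {\<omega> \<in> space M. \<Phi> (X1 \<omega>)}" "X2 -` ?B \<inter> space M = {\<omega> \<in> space M. \<Psi> (X2 \<omega>)}"
    using measurable_space[OF rv(1)] measurable_space[OF rv(2)] by auto
  then show ?thesis using indep_varD[OF assms(1) AB] by simp
qed

text \<open>The target is discrete, so any property or functional of the random graph is measurable
  by composition.\<close>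

lemma measurable_edge_set:
  fixes X :: "'e \<Rightarrow> 'a \<Rightarrow> ereal"
  assumes "finite K" "\<And>e. e \<in> K \<Longrightarrow> X e \<in> borel_measurable M"
  shows "(\<lambda>\<omega>. {e \<in> K. X e \<omega> \<le> ereal t}) \<in> M \<rightarrow>\<^sub>M count_space (Pow K)"
proof (subst measurable_count_space_eq2)
  have "(\<lambda>\<omega>. {e \<in> K. X e \<omega> \<le> ereal t}) -` {A} \<inter> space M \<in> sets M" if "A \<in> Pow K" for A
  proof -
    have "(\<lambda>\<omega>. {e \<in> K. X e \<omega> \<le> ereal t}) -` {A} \<inter> space M =
        {\<omega> \<in> space M. \<forall>e\<in>K. X e \<omega> \<le> ereal t \<longleftrightarrow> e \<in> A}"
      using that by auto
    also have "\<dots> \<in> sets M"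
    proof (rule sets.sets_Collect_finite_All)
      fix e assume "e \<in> K"
      note assms(2)[OF this, measurable]
      show "{\<omega> \<in> space M. (X e \<omega> \<le> ereal t) = (e \<in> A)} \<in> sets M" by measurable
    qed (use assms in auto)
    finally show ?thesis .
  qed
  then show "(\<lambda>\<omega>. {e \<in> K. X e \<omega> \<le> ereal t}) \<in> space M \<rightarrow> Pow K \<and>
    (\<forall>A\<in>Pow K. (\<lambda>\<omega>. {e \<in> K. X e \<omega> \<le> ereal t}) -` {A} \<inter> space M \<in> sets M)" by auto
qed (use assms in simp)

section \<open>The random graph of one index with its clocks\<close>

locale edge_clocks = prob_space M for M :: "'a measure" +
  fixes V :: "nat set" and z :: "nat \<Rightarrow> real" and T :: "nat set \<Rightarrow> 'a \<Rightarrow> ereal"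
  assumes V: "finite V" and z0: "\<And>i. i \<in> V \<Longrightarrow> 0 \<le> z i"
    and indep: "indep_vars (\<lambda>_. borel) T (all_edges_on V)"
    and law: "\<And>i j. i \<in> V \<Longrightarrow> j \<in> V \<Longrightarrow> i \<noteq> j \<Longrightarrow> distr M borel (T {i, j}) = exponential_time (z i * z j)"
begin

abbreviation "edges \<equiv> all_edges_on V"

text \<open>The product over the two endpoints is a function of the unordered pair and involves no
  choice of an order.\<close>

abbreviation rate :: "nat set \<Rightarrow> real" where "rate e \<equiv> prod z e"

abbreviation graph :: "real \<Rightarrow> 'a \<Rightarrow> nat set set" where
  "graph t \<omega> \<equiv> {e \<in> edges. T e \<omega> \<le> ereal t}"

lemma finite_edges: "finite edges" by (rule finite_all_edges_on[OF V])

lemma T_measurable[measurable]: "e \<in> edges \<Longrightarrow> T e \<in> borel_measurable M"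
  using indep by (auto simp: indep_vars_def)

lemma rate_nonneg: "e \<in> edges \<Longrightarrow> 0 \<le> rate e"
  by (auto simp: all_edges_on_def z0)

lemma prob_T_le:
  assumes "e \<in> edges" "0 \<le> t"
  shows "prob {\<omega> \<in> space M. T e \<omega> \<le> ereal t} = 1 - exp (- t * rate e)"
proof -
  obtain i j where e: "e = {i, j}" "i \<in> V" "j \<in> V" "i \<noteq> j" using assms(1) by (rule all_edges_onE)
  have "prob {\<omega> \<in> space M. T e \<omega> \<le> ereal t} = measure (distr M borel (T e)) {..ereal t}"
    using assms by (subst measure_distr) (auto intro!: arg_cong[where f = prob])
  also have "\<dots> = 1 - exp (- t * (z i * z j))"
    unfolding e(1) law[OF e(2-4)] using e z0 assms by (intro measure_exponential_time) auto
  finally show ?thesis using e by simp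
qed

lemma prob_T_le_bound:
  assumes "e \<in> edges" "0 \<le> t"
  shows "prob {\<omega> \<in> space M. T e \<omega> \<le> ereal t} \<le> t * rate e"
  unfolding prob_T_le[OF assms] using exp_ge_add_one_self[of "- t * rate e"] by simp

lemma prob_T_between:
  assumes "e \<in> edges" "0 \<le> s" "s \<le> t"
  shows "prob {\<omega> \<in> space M. ereal s < T e \<omega> \<and> T e \<omega> \<le> ereal t} = exp (- s * rate e) - exp (- t * rate e)"
proof -
  have "{\<omega> \<in> space M. ereal s < T e \<omega> \<and> T e \<omega> \<le> ereal t} =
      {\<omega> \<in> space M. T e \<omega> \<le> ereal t} - {\<omega> \<in> space M. T e \<omega> \<le> ereal s}" by auto
  also have "prob \<dots> = prob {\<omega> \<in> space M. T e \<omega> \<le> ereal t} - prob {\<omega> \<in> space M. T e \<omega> \<le> ereal s}"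
    using assms by (intro finite_measure_Diff) (auto intro: order_trans)
  finally show ?thesis using assms by (simp add: prob_T_le)
qed

text \<open>The counts below use times strictly after 0, whereas the graph contains every clock up
  to \<open>t\<close>; this makes the two agree almost surely.\<close>

lemma AE_T_pos: "AE \<omega> in M. \<forall>e\<in>edges. 0 < T e \<omega>"
proof (rule AE_finite_allI[OF finite_edges])
  fix e assume e: "e \<in> edges"
  have "prob {\<omega> \<in> space M. T e \<omega> \<le> ereal 0} = 0" using prob_T_le[OF e, of 0] by simp
  moreover have "{\<omega> \<in> space M. T e \<omega> \<le> ereal 0} \<in> sets M" using e by measurable
  ultimately have "AE \<omega> in M. \<omega> \<notin> {\<omega> \<in> space M. T e \<omega> \<le> ereal 0}"
    using prob_eq_0 by blast
  then show "AE \<omega> in M. 0 < T e \<omega>"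
    using AE_space by eventually_elim (auto simp: not_le zero_ereal_def)
qed

lemma measurable_graph: "K \<subseteq> edges \<Longrightarrow> (\<lambda>\<omega>. {e \<in> K. T e \<omega> \<le> ereal t}) \<in> M \<rightarrow>\<^sub>M count_space (Pow K)"
  using finite_subset[OF _ finite_edges] by (intro measurable_edge_set) auto

lemma sets_graph:
  assumes "K \<subseteq> edges"
  shows "{\<omega> \<in> space M. \<Phi> {e \<in> K. T e \<omega> \<le> ereal t}} \<in> sets M"
proof -
  have "{\<omega> \<in> space M. \<Phi> {e \<in> K. T e \<omega> \<le> ereal t}} =
      (\<lambda>\<omega>. {e \<in> K. T e \<omega> \<le> ereal t}) -` {A \<in> Pow K. \<Phi> A} \<inter> space M" by auto
  also have "\<dots> \<in> sets M" by (rule measurable_sets[OF measurable_graph[OF assms]]) auto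
  finally show ?thesis .
qed

text \<open>The form in which independence enters the path arguments: arbitrary properties of the
  graphs on two disjoint families of edges.\<close>

lemma prob_graph_conj:
  assumes "A \<subseteq> edges" "B \<subseteq> edges" "A \<inter> B = {}"
  shows "prob {\<omega> \<in> space M. \<Phi> {e \<in> A. T e \<omega> \<le> ereal t} \<and> \<Psi> {e \<in> B. T e \<omega> \<le> ereal t}} =
    prob {\<omega> \<in> space M. \<Phi> {e \<in> A. T e \<omega> \<le> ereal t}} * prob {\<omega> \<in> space M. \<Psi> {e \<in> B. T e \<omega> \<le> ereal t}}"
proof -
  have fin: "finite A" "finite B" using assms finite_subset[OF _ finite_edges] by auto
  have pred: "Measurable.pred (PiM K (\<lambda>_. borel)) (\<lambda>f. \<Phi> {e \<in> K. f e \<le> ereal t})"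
    if "finite K" for K :: "nat set set" and \<Phi>
  proof -
    have "(\<lambda>f :: nat set \<Rightarrow> ereal. {e \<in> K. f e \<le> ereal t}) \<in> PiM K (\<lambda>_. borel) \<rightarrow>\<^sub>M count_space (Pow K)"
      by (rule measurable_edge_set[OF that, of "\<lambda>e f. f e"]) simp
    then show ?thesis by (rule measurable_compose) simp
  qed
  have ind: "indep_var (PiM A (\<lambda>_. borel)) (\<lambda>\<omega>. restrict (\<lambda>e. T e \<omega>) A) (PiM B (\<lambda>_. borel)) (\<lambda>\<omega>. restrict (\<lambda>e. T e \<omega>) B)"
    using assms by (intro indep_var_restrict[OF indep]) auto
  have "{e \<in> K. restrict (\<lambda>e. T e \<omega>) K e \<le> ereal t} = {e \<in> K. T e \<omega> \<le> ereal t}" for K \<omega> by auto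
  then show ?thesis
    using indep_var_prob_conj[OF ind pred[OF fin(1), of \<Phi>] pred[OF fin(2), of \<Psi>]] by simp
qed

text \<open>Removing \<open>i\<close> makes the first step of a path independent of the rest of it.\<close>

lemma prob_connected_le:
  assumes c: "0 \<le> c" and \<sigma>: "c * (\<Sum>i\<in>V. (z i)\<^sup>2) < 1"
    and U: "U \<subseteq> V" and ij: "i \<in> U" "j \<in> U" "i \<noteq> j"
  shows "prob {\<omega> \<in> space M. (i, j) \<in> (adj {e \<in> all_edges_on U. T e \<omega> \<le> ereal c})\<^sup>*}
    \<le> c * z i * z j / (1 - c * (\<Sum>i\<in>V. (z i)\<^sup>2))"
  using finite_subset[OF U V] U ij
\<comment> \<open>The induction is over the vertices still available to the path. The denominator of
  the bound refers to all of \<open>V\<close>, so one constant serves at every stage.\<close>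
proof (induction U arbitrary: i rule: finite_psubset_induct)
  case (psubset U)
  define \<sigma> where "\<sigma> = (\<Sum>i\<in>V. (z i)\<^sup>2)"
  \<comment> \<open>\<open>C\<close> solves the fixed-point equation
    \<open>C = c + c * C * \<sigma>\<close>: the direct edge, plus a first step to another vertex
    followed by a bound of the same form.\<close>
  define C where "C = c / (1 - c * \<sigma>)"
  have C: "0 \<le> C" "C = c + c * C * \<sigma>" using c assms(2) by (auto simp: C_def \<sigma>_def field_simps)
  let ?E = "\<lambda>v. {\<omega> \<in> space M. {i, v} \<in> {e \<in> {{i, v}}. T e \<omega> \<le> ereal c} \<and>
    (v, j) \<in> (adj {e \<in> all_edges_on (U - {i}). T e \<omega> \<le> ereal c})\<^sup>*}"
  have sub: "all_edges_on (U - {i}) \<subseteq> edges" using psubset.prems(1) by (intro all_edges_on_mono) auto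
  have edge: "{i, v} \<in> edges" if "v \<in> U - {i}" for v
    using that psubset.prems by (auto simp: all_edges_on_def)
  have mE: "?E v \<in> sets M" if "v \<in> U - {i}" for v
    using sets_graph[of "{{i, v}}" "\<lambda>A. {i, v} \<in> A"] sets_graph[OF sub, of "\<lambda>A. (v, j) \<in> (adj A)\<^sup>*"] edge[OF that]
    by (intro sets.sets_Collect_conj) auto
  have "{\<omega> \<in> space M. (i, j) \<in> (adj {e \<in> all_edges_on U. T e \<omega> \<le> ereal c})\<^sup>*} \<subseteq> (\<Union>v\<in>U - {i}. ?E v)"
  proof
    fix \<omega> assume \<omega>: "\<omega> \<in> {\<omega> \<in> space M. (i, j) \<in> (adj {e \<in> all_edges_on U. T e \<omega> \<le> ereal c})\<^sup>*}"
    then obtain v where v: "v \<noteq> i" "{i, v} \<in> {e \<in> all_edges_on U. T e \<omega> \<le> ereal c}"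
      "(v, j) \<in> (adj {e \<in> {e \<in> all_edges_on U. T e \<omega> \<le> ereal c}. i \<notin> e})\<^sup>*"
      using psubset.prems(4) by (auto elim: adj_rtrancl_first_step)
    have "{e \<in> {e \<in> all_edges_on U. T e \<omega> \<le> ereal c}. i \<notin> e} = {e \<in> all_edges_on (U - {i}). T e \<omega> \<le> ereal c}"
      by (auto simp: all_edges_on_def)
    moreover have "v \<in> U" using v(2) by (auto simp: all_edges_on_def doubleton_eq_iff)
    ultimately show "\<omega> \<in> (\<Union>v\<in>U - {i}. ?E v)" using v \<omega> by auto
  qed
  then have "prob {\<omega> \<in> space M. (i, j) \<in> (adj {e \<in> all_edges_on U. T e \<omega> \<le> ereal c})\<^sup>*} \<le> prob (\<Union>v\<in>U - {i}. ?E v)"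
    using mE psubset.hyps by (intro finite_measure_mono sets.finite_UN) auto
  also have "\<dots> \<le> (\<Sum>v\<in>U - {i}. prob (?E v))"
    using mE psubset.hyps by (intro finite_measure_subadditive_finite) auto
  also have "\<dots> \<le> (\<Sum>v\<in>U - {i}. if v = j then c * z i * z j else c * z i * z j * C * (z v)\<^sup>2)"
  proof (rule sum_mono)
    fix v assume v: "v \<in> U - {i}"
    have zs: "0 \<le> z i" "0 \<le> z j" "0 \<le> z v" using v psubset.prems by (auto intro: z0)
    have "prob (?E v) = prob {\<omega> \<in> space M. {i, v} \<in> {e \<in> {{i, v}}. T e \<omega> \<le> ereal c}} *
        prob {\<omega> \<in> space M. (v, j) \<in> (adj {e \<in> all_edges_on (U - {i}). T e \<omega> \<le> ereal c})\<^sup>*}"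
      using edge[OF v] sub by (intro prob_graph_conj) (auto simp: all_edges_on_def)
    also have "\<dots> \<le> (c * (z i * z v)) * (if v = j then 1 else c * z v * z j / (1 - c * \<sigma>))"
    proof (rule mult_mono)
      show "prob {\<omega> \<in> space M. {i, v} \<in> {e \<in> {{i, v}}. T e \<omega> \<le> ereal c}} \<le> c * (z i * z v)"
        using prob_T_le_bound[OF edge[OF v] c] v by auto
      show "prob {\<omega> \<in> space M. (v, j) \<in> (adj {e \<in> all_edges_on (U - {i}). T e \<omega> \<le> ereal c})\<^sup>*}
          \<le> (if v = j then 1 else c * z v * z j / (1 - c * \<sigma>))"
        using psubset.IH[of "U - {i}" v] psubset.prems v by (auto simp: \<sigma>_def)
    qed (use c zs in auto)
    also have "\<dots> = (if v = j then c * z i * z j else c * z i * z j * C * (z v)\<^sup>2)"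
      by (simp add: C_def power2_eq_square)
    finally show "prob (?E v) \<le> (if v = j then c * z i * z j else c * z i * z j * C * (z v)\<^sup>2)" .
  qed
  also have "\<dots> = c * z i * z j + (\<Sum>v\<in>U - {i} - {j}. c * z i * z j * C * (z v)\<^sup>2)"
    using psubset.hyps psubset.prems by (subst sum.remove[of _ j]) (auto intro!: sum.cong)
  also have "\<dots> \<le> c * z i * z j + (\<Sum>v\<in>V. c * z i * z j * C * (z v)\<^sup>2)"
    using psubset.prems c C z0 V by (intro add_left_mono sum_mono2) (auto intro!: mult_nonneg_nonneg)
  also have "\<dots> = z i * z j * (c + c * C * \<sigma>)"
    by (simp add: sum_distrib_left[symmetric] \<sigma>_def algebra_simps)
  also have "\<dots> = c * z i * z j / (1 - c * \<sigma>)" unfolding C(2)[symmetric] by (simp add: C_def)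
  finally show ?case by (simp add: \<sigma>_def)
qed


text \<open>A cycle through {i, j} yields a further edge {i, v} with v different from j and a
  connection from v to j that avoids i. These three ingredients use disjoint sets of edges, so the
  probability factors and is at most c^3 (z_i z_j z_v)^2 / (1 - c \<sigma>). Summing over v and over
  the edges produces the cube of \<sigma>.\<close>

lemma expectation_cycle_edges:
  assumes c: "0 \<le> c" and \<sigma>: "c * (\<Sum>i\<in>V. (z i)\<^sup>2) < 1"
  shows "expectation (\<lambda>\<omega>. real (card (cycle_edges (graph c \<omega>))))
    \<le> c ^ 3 * (\<Sum>i\<in>V. (z i)\<^sup>2) ^ 3 / (1 - c * (\<Sum>i\<in>V. (z i)\<^sup>2))"
proof -
  define \<sigma> where "\<sigma> = (\<Sum>i\<in>V. (z i)\<^sup>2)"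
  define C where "C = c ^ 3 / (1 - c * \<sigma>)"
  have \<sigma>0: "0 \<le> \<sigma>" by (simp add: \<sigma>_def sum_nonneg)
  have C: "0 \<le> C" using c assms(2) by (simp add: C_def \<sigma>_def)
  have event: "{\<omega> \<in> space M. e \<in> cycle_edges (graph c \<omega>)} \<in> sets M" for e
    using sets_graph[of edges "\<lambda>A. e \<in> cycle_edges A" c] by simp
  have prob_cycle: "prob {\<omega> \<in> space M. e \<in> cycle_edges (graph c \<omega>)} \<le> C * \<sigma> * prod (\<lambda>i. (z i)\<^sup>2) e"
    if "e \<in> edges" for e
  proof -
    obtain i j where e: "e = {i, j}" "i \<in> V" "j \<in> V" "i \<noteq> j"
      using \<open>e \<in> edges\<close> by (rule all_edges_onE)
    let ?c = "\<lambda>v \<omega>. (v, j) \<in> (adj {e \<in> all_edges_on (V - {i}). T e \<omega> \<le> ereal c})\<^sup>*"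
    \<comment> \<open>The presence of both \<open>e\<close> and {i, v} is stated through the random
      subset of these two edges, the form that \<open>prob_graph_conj\<close> takes.\<close>
    let ?E = "\<lambda>v. {\<omega> \<in> space M. {x \<in> {e, {i, v}}. T x \<omega> \<le> ereal c} = {e, {i, v}} \<and> ?c v \<omega>}"
    have sub: "all_edges_on (V - {i}) \<subseteq> edges" by (intro all_edges_on_mono) auto
    have edge: "{i, v} \<in> edges" if "v \<in> V - {i}" for v
      using that e by (auto simp: all_edges_on_def)
    have mE: "?E v \<in> sets M" if "v \<in> V - {i}" for v
      using sets_graph[of "{e, {i, v}}" "\<lambda>A. A = {e, {i, v}}"] sets_graph[OF sub, of "\<lambda>A. (v, j) \<in> (adj A)\<^sup>*"]
        edge[OF that] \<open>e \<in> edges\<close> by (intro sets.sets_Collect_conj) auto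
    have "{\<omega> \<in> space M. e \<in> cycle_edges (graph c \<omega>)} \<subseteq> (\<Union>v\<in>V - {i, j}. ?E v)"
    proof
      fix \<omega> assume \<omega>: "\<omega> \<in> {\<omega> \<in> space M. e \<in> cycle_edges (graph c \<omega>)}"
      then obtain i' j' where ij': "e = {i', j'}" "(i', j') \<in> (adj (graph c \<omega> - {e}))\<^sup>*"
        by (auto simp: cycle_edges_def)
      then have "(i, j) \<in> (adj (graph c \<omega> - {e}))\<^sup>*"
        using e(1) sym_rtrancl[OF sym_adj] by (auto simp: doubleton_eq_iff dest: symD)
      then obtain v where v: "v \<noteq> i" "{i, v} \<in> graph c \<omega> - {e}"
        "(v, j) \<in> (adj {e' \<in> graph c \<omega> - {e}. i \<notin> e'})\<^sup>*"
        using e(4) by (rule adj_rtrancl_first_step)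
      have "{e' \<in> graph c \<omega> - {e}. i \<notin> e'} = {e \<in> all_edges_on (V - {i}). T e \<omega> \<le> ereal c}"
        using e(1) by (auto simp: all_edges_on_def)
      moreover have "v \<in> V" "v \<noteq> j" using v(2) e(1) by (auto simp: all_edges_on_def doubleton_eq_iff)
      moreover have "e \<in> graph c \<omega>" using \<omega> by (simp add: cycle_edges_def)
      ultimately have "v \<in> V - {i, j}" "?c v \<omega>" "{x \<in> {e, {i, v}}. T x \<omega> \<le> ereal c} = {e, {i, v}}"
        using v by (simp_all only: Diff_iff insert_iff empty_iff) auto
      then have "v \<in> V - {i, j}" "\<omega> \<in> ?E v" using \<omega> by blast+
      then show "\<omega> \<in> (\<Union>v\<in>V - {i, j}. ?E v)" by blast
    qed
    then have "prob {\<omega> \<in> space M. e \<in> cycle_edges (graph c \<omega>)} \<le> prob (\<Union>v\<in>V - {i, j}. ?E v)"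
      using mE V by (intro finite_measure_mono sets.finite_UN) auto
    also have "\<dots> \<le> (\<Sum>v\<in>V - {i, j}. prob (?E v))"
      using mE V by (intro finite_measure_subadditive_finite) auto
    also have "\<dots> \<le> (\<Sum>v\<in>V - {i, j}. C * ((z i)\<^sup>2 * (z j)\<^sup>2) * (z v)\<^sup>2)"
    proof (rule sum_mono)
      fix v assume v: "v \<in> V - {i, j}"
      have zs: "0 \<le> z i" "0 \<le> z j" "0 \<le> z v" using v e by (auto intro: z0)
      have ne: "e \<noteq> {i, v}" using v e by (auto simp: doubleton_eq_iff)
      have iv: "{i, v} \<in> edges" using edge v by auto
      have "prob (?E v) = prob {\<omega> \<in> space M. {x \<in> {e, {i, v}}. T x \<omega> \<le> ereal c} = {e, {i, v}}} * prob {\<omega> \<in> space M. ?c v \<omega>}"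
      proof (rule prob_graph_conj[of "{e, {i, v}}" "all_edges_on (V - {i})" "\<lambda>A. A = {e, {i, v}}"
            c "\<lambda>A. (v, j) \<in> (adj A)\<^sup>*"])
        have "i \<notin> x" if "x \<in> all_edges_on (V - {i})" for x using that by (auto simp: all_edges_on_def)
        then show "{e, {i, v}} \<inter> all_edges_on (V - {i}) = {}" using e(1) by blast
      qed (use iv sub \<open>e \<in> edges\<close> in auto)
      also have "\<dots> \<le> ((c * (z i * z j)) * (c * (z i * z v))) * (c * z v * z j / (1 - c * \<sigma>))"
      proof (rule mult_mono)
        have both: "{\<omega> \<in> space M. {x \<in> {e, {i, v}}. T x \<omega> \<le> ereal c} = {e, {i, v}}} =
          {\<omega> \<in> space M. e \<in> {x \<in> {e}. T x \<omega> \<le> ereal c} \<and> {i, v} \<in> {x \<in> {{i, v}}. T x \<omega> \<le> ereal c}}"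
          by auto
        have "prob {\<omega> \<in> space M. {x \<in> {e, {i, v}}. T x \<omega> \<le> ereal c} = {e, {i, v}}} = prob {\<omega> \<in> space M. e \<in> {x \<in> {e}. T x \<omega> \<le> ereal c}} *
            prob {\<omega> \<in> space M. {i, v} \<in> {x \<in> {{i, v}}. T x \<omega> \<le> ereal c}}"
          unfolding both using ne iv \<open>e \<in> edges\<close> by (intro prob_graph_conj) auto
        also have "\<dots> \<le> (c * (z i * z j)) * (c * (z i * z v))"
          using prob_T_le_bound[OF \<open>e \<in> edges\<close> c] prob_T_le_bound[OF iv c] e v c zs
          by (intro mult_mono) auto
        finally show "prob {\<omega> \<in> space M. {x \<in> {e, {i, v}}. T x \<omega> \<le> ereal c} = {e, {i, v}}}
            \<le> (c * (z i * z j)) * (c * (z i * z v))" .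
        show "prob {\<omega> \<in> space M. ?c v \<omega>} \<le> c * z v * z j / (1 - c * \<sigma>)"
          using prob_connected_le[OF assms, of "V - {i}" v j] v e by (auto simp: \<sigma>_def)
      qed (use c zs in auto)
      also have "\<dots> = C * ((z i)\<^sup>2 * (z j)\<^sup>2) * (z v)\<^sup>2"
        by (simp add: C_def power2_eq_square power3_eq_cube)
      finally show "prob (?E v) \<le> C * ((z i)\<^sup>2 * (z j)\<^sup>2) * (z v)\<^sup>2" .
    qed
    also have "\<dots> \<le> (\<Sum>v\<in>V. C * ((z i)\<^sup>2 * (z j)\<^sup>2) * (z v)\<^sup>2)"
      using V C by (intro sum_mono2) auto
    also have "\<dots> = C * \<sigma> * prod (\<lambda>i. (z i)\<^sup>2) e"
      using e by (simp add: \<sigma>_def sum_distrib_left sum_distrib_right mult_ac)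
    finally show ?thesis .
  qed
  have "expectation (\<lambda>\<omega>. real (card (cycle_edges (graph c \<omega>)))) =
      expectation (\<lambda>\<omega>. \<Sum>e\<in>edges. indicator {\<omega> \<in> space M. e \<in> cycle_edges (graph c \<omega>)} \<omega>)"
  proof (rule Bochner_Integration.integral_cong[OF refl])
    fix \<omega> assume \<omega>: "\<omega> \<in> space M"
    have "cycle_edges (graph c \<omega>) = {e \<in> edges. e \<in> cycle_edges (graph c \<omega>)}"
      by (auto simp: cycle_edges_def)
    then have "card (cycle_edges (graph c \<omega>)) = card {e \<in> edges. e \<in> cycle_edges (graph c \<omega>)}" by simp
    also have "real \<dots> = (\<Sum>e\<in>edges. of_bool (e \<in> cycle_edges (graph c \<omega>)))"
      using finite_edges by (simp add: Int_def)
    finally show "real (card (cycle_edges (graph c \<omega>))) =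
        (\<Sum>e\<in>edges. indicator {\<omega> \<in> space M. e \<in> cycle_edges (graph c \<omega>)} \<omega>)"
      using \<omega> by (simp add: indicator_def)
  qed
  also have "\<dots> = (\<Sum>e\<in>edges. prob {\<omega> \<in> space M. e \<in> cycle_edges (graph c \<omega>)})"
    using event by (subst Bochner_Integration.integral_sum) (auto simp: less_top[symmetric])
  also have "\<dots> \<le> (\<Sum>e\<in>edges. C * \<sigma> * prod (\<lambda>i. (z i)\<^sup>2) e)"
    by (intro sum_mono prob_cycle)
  also have "\<dots> = C * \<sigma> * (\<Sum>e\<in>edges. prod (\<lambda>i. (z i)\<^sup>2) e)" by (simp add: sum_distrib_left)
  also have "\<dots> \<le> C * \<sigma> * \<sigma>\<^sup>2"
  proof (rule mult_left_mono)
    have "0 \<le> (\<Sum>i\<in>V. ((z i)\<^sup>2)\<^sup>2)" by (intro sum_nonneg) simp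
    moreover have "0 \<le> \<sigma>\<^sup>2" by simp
    ultimately show "(\<Sum>e\<in>edges. prod (\<lambda>i. (z i)\<^sup>2) e) \<le> \<sigma>\<^sup>2"
      using sum_all_edges_on_prod[OF V, of "\<lambda>i. (z i)\<^sup>2"] unfolding \<sigma>_def by linarith
  qed (use C \<sigma>0 in simp)
  finally show ?thesis by (simp add: C_def \<sigma>_def power2_eq_square power3_eq_cube)
qed

section \<open>Number of edges that appear in a time interval\<close>

definition count :: "real \<Rightarrow> real \<Rightarrow> 'a \<Rightarrow> real" where
  "count s t \<omega> = (\<Sum>e\<in>edges. of_bool (ereal s < T e \<omega> \<and> T e \<omega> \<le> ereal t))"

text \<open>The expectation of \<open>count s t\<close> when 0 \<le> s \<le> t. The closed form is
  additive whatever the order of the times.\<close>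

definition mean :: "real \<Rightarrow> real \<Rightarrow> real" where
  "mean s t = (\<Sum>e\<in>edges. exp (- s * rate e) - exp (- t * rate e))"

lemma count_measurable[measurable]: "count s t \<in> borel_measurable M"
  unfolding count_def by (intro borel_measurable_sum) measurable

lemma count_add:
  assumes "r \<le> s" "s \<le> t"
  shows "count r t \<omega> = count r s \<omega> + count s t \<omega>"
proof -
  have "of_bool (ereal r < T e \<omega> \<and> T e \<omega> \<le> ereal t) =
      of_bool (ereal r < T e \<omega> \<and> T e \<omega> \<le> ereal s) + (of_bool (ereal s < T e \<omega> \<and> T e \<omega> \<le> ereal t) :: real)" for e
    using assms order_trans[of "T e \<omega>" "ereal s" "ereal t"] le_less_trans[of "ereal r" "ereal s" "T e \<omega>"]
    by (auto simp: not_le of_bool_def)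
  then show ?thesis unfolding count_def by (simp add: sum.distrib)
qed

lemma count_nonneg: "0 \<le> count s t \<omega>"
  by (simp add: count_def sum_nonneg)

lemma mean_add: "mean r t = mean r s + mean s t"
  unfolding mean_def by (simp add: sum.distrib[symmetric])

lemma mean_le:
  assumes "0 \<le> s" "s \<le> t"
  shows "mean s t \<le> (t - s) * (\<Sum>e\<in>edges. rate e)"
  unfolding mean_def sum_distrib_left using assms exp_diff_le[OF rate_nonneg] by (intro sum_mono) auto

lemma expectation_indicator_between:
  assumes "e \<in> edges" "0 \<le> s" "s \<le> t"
  shows "expectation (\<lambda>\<omega>. of_bool (ereal s < T e \<omega> \<and> T e \<omega> \<le> ereal t)) = exp (- s * rate e) - exp (- t * rate e)"
proof -
  have "expectation (\<lambda>\<omega>. of_bool (ereal s < T e \<omega> \<and> T e \<omega> \<le> ereal t)) =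
      expectation (indicator {\<omega> \<in> space M. ereal s < T e \<omega> \<and> T e \<omega> \<le> ereal t})"
    by (rule Bochner_Integration.integral_cong) (auto simp: indicator_def)
  also have "\<dots> = prob {\<omega> \<in> space M. ereal s < T e \<omega> \<and> T e \<omega> \<le> ereal t}"
    by (simp add: Int_def conj_ac)
  finally show ?thesis using prob_T_between[OF assms] by simp
qed

text \<open>The centred indicators are independent and bounded by 1, with variance p - p^2 \<le> p,
  and p is at most (t - s) times the rate. On short intervals the linear term of the fourth moment
  dominates, which limits how far the chaining can be refined.\<close>

lemma count_moments:
  assumes st: "0 \<le> s" "s \<le> t"
  defines "A \<equiv> (t - s) * (\<Sum>e\<in>edges. rate e)"
  shows "expectation (\<lambda>\<omega>. (count s t \<omega> - mean s t)\<^sup>2) \<le> A"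
    and "expectation (\<lambda>\<omega>. (count s t \<omega> - mean s t) ^ 4) \<le> A + 3 * A\<^sup>2"
proof -
  define p where "p e = exp (- s * rate e) - exp (- t * rate e)" for e
  define b where "b x = (of_bool (ereal s < x \<and> x \<le> ereal t) :: real)" for x
  have [measurable]: "b \<in> borel_measurable borel" unfolding b_def by measurable
  define \<xi> where "\<xi> e \<omega> = b (T e \<omega>) - p e" for e \<omega>
  have p: "0 \<le> p e" "p e \<le> 1" "p e \<le> (t - s) * rate e" if "e \<in> edges" for e
  proof -
    have "exp (- s * rate e) \<le> 1" "0 \<le> exp (- t * rate e)" using st rate_nonneg[OF that] by auto
    then show "p e \<le> 1" unfolding p_def by linarith
  qed (use exp_diff_le[OF rate_nonneg[OF that] st] st rate_nonneg[OF that] in \<open>auto simp: p_def mult_right_mono\<close>)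
  have Eb: "expectation (\<lambda>\<omega>. b (T e \<omega>)) = p e" if "e \<in> edges" for e
    using expectation_indicator_between[OF that st] by (simp add: b_def p_def)
  have int: "integrable M (\<lambda>\<omega>. b (T e \<omega>))" if "e \<in> edges" for e
    using that by (intro integrable_const_bound[where B = 1]) (auto simp: b_def)
  have ind: "indep_vars (\<lambda>_. borel) \<xi> edges"
    unfolding \<xi>_def by (rule indep_vars_compose2[OF indep]) measurable
  have bound: "\<bar>\<xi> e \<omega>\<bar> \<le> 1" if "e \<in> edges" for e \<omega>
    using p[OF that] by (auto simp: \<xi>_def b_def)
  have mean0: "expectation (\<xi> e) = 0" if "e \<in> edges" for e
    using Eb[OF that] int[OF that] by (simp add: \<xi>_def[abs_def] prob_space)
  have var: "expectation (\<lambda>\<omega>. (\<xi> e \<omega>)\<^sup>2) \<le> (t - s) * rate e" if "e \<in> edges" for e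
  proof -
    have "(\<xi> e \<omega>)\<^sup>2 = b (T e \<omega>) - 2 * p e * b (T e \<omega>) + (p e)\<^sup>2" for \<omega>
      by (auto simp: \<xi>_def b_def power2_eq_square algebra_simps)
    then have "expectation (\<lambda>\<omega>. (\<xi> e \<omega>)\<^sup>2) = p e - (p e)\<^sup>2"
      using Eb[OF that] int[OF that] by (simp add: prob_space power2_eq_square)
    also have "\<dots> \<le> p e" by simp
    finally show ?thesis using p(3)[OF that] by simp
  qed
  have sum: "(\<Sum>e\<in>edges. \<xi> e \<omega>) = count s t \<omega> - mean s t" for \<omega>
    by (simp add: \<xi>_def count_def mean_def b_def p_def sum_subtractf)
  show "expectation (\<lambda>\<omega>. (count s t \<omega> - mean s t)\<^sup>2) \<le> A"
    "expectation (\<lambda>\<omega>. (count s t \<omega> - mean s t) ^ 4) \<le> A + 3 * A\<^sup>2"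
    using fourth_moment_sum[OF finite_edges ind bound mean0 var] unfolding sum A_def
    by (simp_all add: sum_distrib_left)
qed

lemma integrable_count_power: "integrable M (\<lambda>\<omega>. (count s t \<omega> - mean s t) ^ k)"
proof (rule integrable_const_bound)
  have "\<bar>count s t \<omega> - mean s t\<bar> \<le> real (card edges) + \<bar>mean s t\<bar>" for \<omega>
  proof -
    have "count s t \<omega> \<le> (\<Sum>e\<in>edges. 1)" unfolding count_def by (intro sum_mono) auto
    then show ?thesis using count_nonneg[of s t \<omega>] by simp
  qed
  then show "AE \<omega> in M. norm ((count s t \<omega> - mean s t) ^ k) \<le> (real (card edges) + \<bar>mean s t\<bar>) ^ k"
    by (intro AE_I2) (auto simp: power_abs intro: power_mono)
qed measurable


end

section \<open>Chaining\<close>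

lemma grid_floor_unique:
  assumes c: "c > 0" and m: "m > 0" and t: "t \<in> {0..c}"
    and k: "real k * c / real m \<le> t" "t < real (Suc k) * c / real m"
  shows "grid_floor c m t = k"
proof -
  have "real k \<le> t / (c / real m)" "t / (c / real m) < real k + 1"
    using c m k by (simp_all add: field_simps)
  then have "\<lfloor>t / (c / real m)\<rfloor> = int k" by (simp add: floor_eq_iff)
  then show ?thesis using grid_floor_eq[OF c m t] by simp
qed

text \<open>Every point of a coarse dyadic grid is also a point of the finer one, so integer
  division of the fine index gives the coarse one.\<close>

lemma grid_floor_div:
  assumes c: "c > 0" and t: "t \<in> {0..c}" and mJ: "m \<le> J"
  shows "grid_floor c (2 ^ m) t = grid_floor c (2 ^ J) t div 2 ^ (J - m)"
proof (rule grid_floor_unique[OF c _ t])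
  define i where "i = grid_floor c (2 ^ J) t"
  define q where "q = i div 2 ^ (J - m)"
  have J: "(2 :: real) ^ J = 2 ^ m * 2 ^ (J - m)" using mJ by (simp add: power_add[symmetric])
  have b: "real i * c / 2 ^ J \<le> t" "t < real (Suc i) * c / 2 ^ J"
    using grid_floor_bounds[OF c _ t, of "2 ^ J"] by (simp_all add: i_def)
  have "q * 2 ^ (J - m) \<le> i" "i < Suc q * 2 ^ (J - m)"
    unfolding q_def by (auto simp: div_times_less_eq_dividend) (metis dividend_less_div_times pos2 zero_less_power mult_Suc add.commute)
  then have "real (q * 2 ^ (J - m)) \<le> real i" "real (Suc i) \<le> real (Suc q * 2 ^ (J - m))"
    by (simp_all only: of_nat_le_iff Suc_le_eq)
  then have "real q * 2 ^ (J - m) \<le> real i" "real (Suc i) \<le> real (Suc q) * 2 ^ (J - m)"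
    by (simp_all only: of_nat_mult of_nat_power of_nat_numeral)
  then have "real q * 2 ^ (J - m) * c / 2 ^ J \<le> real i * c / 2 ^ J"
    "real (Suc i) * c / 2 ^ J \<le> real (Suc q) * 2 ^ (J - m) * c / 2 ^ J"
    using c by (intro divide_right_mono mult_right_mono; simp del: of_nat_Suc)+
  then show "real (i div 2 ^ (J - m)) * c / real (2 ^ m) \<le> t" "t < real (Suc (i div 2 ^ (J - m))) * c / real (2 ^ m)"
    using b unfolding J q_def[symmetric] by (simp_all del: of_nat_Suc)
qed simp

text \<open>Pass from the index \<open>i\<close> at level \<open>j\<close> to its parent
  \<open>i div 2\<close>. An even index is the same point as its parent, an odd one differs from it
  by a single increment of level \<open>j\<close>, so each level costs its bound \<open>d\<close> at
  most once.\<close>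

lemma dyadic_chaining:
  fixes f :: "real \<Rightarrow> real"
  assumes d: "\<And>j k. m < j \<Longrightarrow> j \<le> J \<Longrightarrow> k < 2 ^ j \<Longrightarrow> \<bar>f (real (Suc k) * c / 2 ^ j) - f (real k * c / 2 ^ j)\<bar> \<le> d j"
    and d0: "\<And>j. 0 \<le> d j" and "m \<le> j" "j \<le> J" "i \<le> 2 ^ j"
  shows "\<bar>f (real i * c / 2 ^ j) - f (real (i div 2 ^ (j - m)) * c / 2 ^ m)\<bar> \<le> sum d {m<..j}"
  using \<open>m \<le> j\<close> \<open>j \<le> J\<close> \<open>i \<le> 2 ^ j\<close>
proof (induction j arbitrary: i rule: dec_induct)
  case base
  then show ?case by simp
next
  case (step j)
  define h where "h = i div 2"
  have h: "h \<le> 2 ^ j" using step.prems by (simp add: h_def)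
  have half: "f (real (2 * h) * c / 2 ^ Suc j) = f (real h * c / 2 ^ j)" by simp
  have "\<bar>f (real i * c / 2 ^ Suc j) - f (real h * c / 2 ^ j)\<bar> \<le> d (Suc j)"
  proof (cases "even i")
    case True
    then have "i = 2 * h" by (simp add: h_def)
    then show ?thesis using half d0 by simp
  next
    case False
    then have i: "i = Suc (2 * h)" by (simp add: h_def)
    then have "2 * h < 2 ^ Suc j" using step.prems by simp
    then show ?thesis
      using d[of "Suc j" "2 * h"] step unfolding half i[symmetric] by simp
  qed
  moreover have "\<bar>f (real h * c / 2 ^ j) - f (real (h div 2 ^ (j - m)) * c / 2 ^ m)\<bar> \<le> sum d {m<..j}"
    using step h by simp
  moreover have "h div 2 ^ (j - m) = i div 2 ^ (Suc j - m)"
    using step.hyps by (simp add: h_def Suc_diff_le div_mult2_eq[symmetric])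
  moreover have "{m<..Suc j} = insert (Suc j) {m<..j}" using step.hyps by auto
  ultimately show ?case by simp
qed

text \<open>Between the points of the finest level, \<open>f\<close> is controlled through the bound \<open>H\<close> on its rate of decrease.\<close>

lemma dyadic_modulus:
  fixes f :: "real \<Rightarrow> real"
  assumes c: "c > 0" and mJ: "m \<le> J"
    and d: "\<And>j k. m \<le> j \<Longrightarrow> j \<le> J \<Longrightarrow> k < 2 ^ j \<Longrightarrow> \<bar>f (real (Suc k) * c / 2 ^ j) - f (real k * c / 2 ^ j)\<bar> \<le> d j"
    and d0: "\<And>j. 0 \<le> d j" and H: "0 \<le> H"
    and mono: "\<And>s t. 0 \<le> s \<Longrightarrow> s \<le> t \<Longrightarrow> t \<le> c \<Longrightarrow> f s - f t \<le> H * (t - s)"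
    and t: "t \<in> {0..c}"
  shows "\<bar>f t - grid_path c (2 ^ m) (\<lambda>k. f (real k * c / 2 ^ m)) t\<bar> \<le> sum d {m<..J} + d J + H * c / 2 ^ J"
proof -
  define i where "i = grid_floor c (2 ^ J) t"
  have iJ: "i \<le> 2 ^ J" unfolding i_def by (rule grid_floor_le)
  have b: "real i * c / 2 ^ J \<le> t" "t < real (Suc i) * c / 2 ^ J"
    using grid_floor_bounds[OF c _ t, of "2 ^ J"] by (simp_all add: i_def)
  have gap: "real (Suc i) * c / 2 ^ J - real i * c / 2 ^ J = c / 2 ^ J"
    by (simp add: diff_divide_distrib[symmetric] algebra_simps)
  have fine: "\<bar>f t - f (real i * c / 2 ^ J)\<bar> \<le> d J + H * c / 2 ^ J"
  \<comment> \<open>The top index is reached only at \<open>t = c\<close>, which has no right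
    neighbour in the grid.\<close>
  proof (cases "i = 2 ^ J")
    case True
    then have "t = real i * c / 2 ^ J" using b(1) t by simp
    then have "f t = f (real i * c / 2 ^ J)" by simp
    then show ?thesis using d0[of J] H c by simp
  next
    case False
    then have i: "i < 2 ^ J" using iJ by simp
    then have "real (Suc i) \<le> 2 ^ J" by (metis Suc_leI of_nat_le_iff of_nat_numeral of_nat_power)
    then have top: "real (Suc i) * c / 2 ^ J \<le> c" using c by (simp add: field_simps del: of_nat_Suc)
    have 0: "0 \<le> real i * c / 2 ^ J" using c by simp
    \<comment> \<open>Control of decreases suffices on both sides: from below, \<open>f t\<close> is
      compared with the left grid point, from above with the right one, which is one increment of
      level \<open>J\<close> away.\<close>
    have "f (real i * c / 2 ^ J) - f t \<le> H * (t - real i * c / 2 ^ J)"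
      using mono[OF 0 b(1)] t by simp
    also have "\<dots> \<le> H * (c / 2 ^ J)" using H b gap by (intro mult_left_mono) auto
    finally have 1: "f (real i * c / 2 ^ J) - f t \<le> H * c / 2 ^ J" by simp
    have "f t - f (real (Suc i) * c / 2 ^ J) \<le> H * (real (Suc i) * c / 2 ^ J - t)"
      using mono[of t "real (Suc i) * c / 2 ^ J"] b t top by simp
    also have "\<dots> \<le> H * (c / 2 ^ J)" using H b gap by (intro mult_left_mono) auto
    finally have "f t - f (real (Suc i) * c / 2 ^ J) \<le> H * c / 2 ^ J" by simp
    then show ?thesis using 1 d[OF mJ order_refl i] d0[of J] by linarith
  qed
  have coarse: "\<bar>f (real i * c / 2 ^ J) - f (real (i div 2 ^ (J - m)) * c / 2 ^ m)\<bar> \<le> sum d {m<..J}"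
    by (rule dyadic_chaining[OF _ d0 mJ order_refl iJ]) (use d in auto)
  have "grid_path c (2 ^ m) (\<lambda>k. f (real k * c / 2 ^ m)) t = f (real (i div 2 ^ (J - m)) * c / 2 ^ m)"
    using t grid_floor_div[OF c t mJ] by (simp add: grid_path_def i_def)
  then show ?thesis using fine coarse by linarith
qed

section \<open>Fluctuations of the number of edges\<close>

text \<open>Bounds the largest of many increments by one sum of fourth powers, without roots, so
  that expectations can be taken term by term; \<open>a\<close> is the size that is conceded to
  every increment.\<close>

lemma abs_le_add_power4:
  fixes x a :: real
  assumes "a > 0"
  shows "\<bar>x\<bar> \<le> a + x ^ 4 / a ^ 3"
proof (cases "\<bar>x\<bar> \<le> a")
  case True
  then show ?thesis using assms by (simp add: add_increasing2)
next
  case False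
  then have "a ^ 3 * \<bar>x\<bar> \<le> \<bar>x\<bar> ^ 3 * \<bar>x\<bar>"
    using assms by (intro mult_right_mono power_mono) auto
  also have "\<dots> = x ^ 4" by (simp add: power_numeral_reduce power_abs[symmetric] abs_mult[symmetric])
  finally have "\<bar>x\<bar> \<le> x ^ 4 / a ^ 3" using assms by (simp add: field_simps)
  then show ?thesis using assms by linarith
qed

lemma sum_geometric_tail:
  assumes "m \<le> J"
  shows "(\<Sum>j\<in>{m<..J}. (9 / 10 :: real) ^ j) = 9 * ((9 / 10) ^ m - (9 / 10) ^ J)"
  using assms
proof (induction J rule: dec_induct)
  case (step J)
  then have "{m<..Suc J} = insert (Suc J) {m<..J}" by auto
  then show ?case using step by simp
qed simp

context edge_clocks
begin

definition fluct :: "nat \<Rightarrow> real \<Rightarrow> 'a \<Rightarrow> real" where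
  "fluct n t \<omega> = (count 0 t \<omega> - mean 0 t) / sqrt (real n)"

lemma fluct_diff:
  assumes "0 \<le> s" "s \<le> t"
  shows "fluct n t \<omega> - fluct n s \<omega> = (count s t \<omega> - mean s t) / sqrt (real n)"
  using count_add[OF assms, of \<omega>] mean_add[of 0 t s] by (simp add: fluct_def diff_divide_distrib[symmetric])

text \<open>Level j concedes increments of size (9/10)^j. It has 2^j increments with fourth moments
  of order 4^-j, so their sum is of order 2^-j; divided by the cube of the concession this is at
  most a multiple of the concession itself, because 2 (9/10)^4 \<ge> 1. Any ratio below 1 with this
  property would do, with another constant in front.\<close>

lemma fluct_modulus:
  assumes n: "0 < n" and c: "0 < c" and A: "0 \<le> A" and rates: "(\<Sum>e\<in>edges. rate e) \<le> real n * A"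
    and m: "2 ^ m \<le> n"
  obtains U where "integrable M U"
    "\<And>\<omega> t. t \<in> {0..c} \<Longrightarrow> \<bar>fluct n t \<omega> - grid_path c (2 ^ m) (\<lambda>k. fluct n (real k * c / 2 ^ m) \<omega>) t\<bar> \<le> U \<omega>"
    "expectation U \<le> 11 * (1 + (A * c + 3 * (A * c)\<^sup>2)) * (9 / 10) ^ m + 2 * A * c / sqrt (real n)"
proof -
  \<comment> \<open>The finest level has a mesh of order 1/n. Beyond it the linear part of the
    fourth moment, of order 2^-j / n after normalisation, would exceed the order 4^-j.\<close>
  obtain J where J: "2 ^ J \<le> n" "n < 2 ^ (J + 1)"
    using ex_power_ivl1[of 2 n] n by auto
  have mJ: "m \<le> J"
  proof -
    have "(2 :: nat) ^ m < 2 ^ (J + 1)" using m J by linarith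
    then have "m < J + 1" by (rule power_less_imp_less_exp[rotated]) simp
    then show ?thesis by simp
  qed
  have nJ: "2 ^ J \<le> real n" "real n \<le> 2 * 2 ^ J"
    using J by (metis of_nat_le_iff of_nat_numeral of_nat_power, 
      metis less_imp_le of_nat_le_iff of_nat_mult of_nat_numeral of_nat_power power_Suc Suc_eq_plus1)
  define C where "C = A * c + 3 * (A * c)\<^sup>2"
  have C: "0 \<le> C" using A c by (simp add: C_def)
  define a where "a j = (9 / 10 :: real) ^ j" for j :: nat
  have a: "0 < a j" for j by (simp add: a_def)
  define X where "X j k \<omega> = fluct n (real (Suc k) * c / 2 ^ j) \<omega> - fluct n (real k * c / 2 ^ j) \<omega>" for j k \<omega>
  \<comment> \<open>One random bound for all increments of level \<open>j\<close>
    simultaneously.\<close>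
  define d where "d \<omega> j = a j + (\<Sum>k<(2::nat) ^ j. X j k \<omega> ^ 4) / a j ^ 3" for \<omega> j
  have d0: "0 \<le> d \<omega> j" for \<omega> j
    unfolding d_def using a[of j] by (intro add_nonneg_nonneg divide_nonneg_nonneg sum_nonneg) auto
  have dX: "\<bar>X j k \<omega>\<bar> \<le> d \<omega> j" if "k < 2 ^ j" for j k \<omega>
  proof -
    have "X j k \<omega> ^ 4 \<le> (\<Sum>k<(2::nat) ^ j. X j k \<omega> ^ 4)"
      using that by (intro member_le_sum) auto
    then have "X j k \<omega> ^ 4 / a j ^ 3 \<le> (\<Sum>k<(2::nat) ^ j. X j k \<omega> ^ 4) / a j ^ 3"
      using a[of j] by (intro divide_right_mono) auto
    then show ?thesis using abs_le_add_power4[OF a[of j], of "X j k \<omega>"] by (simp add: d_def)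
  qed
  have pts: "0 \<le> real k * c / 2 ^ j" "real k * c / 2 ^ j \<le> real (Suc k) * c / 2 ^ j" for k j
    using c by (auto intro!: divide_right_mono mult_right_mono)
  have X_eq: "X j k \<omega> = (count (real k * c / 2 ^ j) (real (Suc k) * c / 2 ^ j) \<omega>
      - mean (real k * c / 2 ^ j) (real (Suc k) * c / 2 ^ j)) / sqrt (real n)" for j k \<omega>
    unfolding X_def by (rule fluct_diff[OF pts])
  have X4: "X j k \<omega> ^ 4 = (count (real k * c / 2 ^ j) (real (Suc k) * c / 2 ^ j) \<omega>
      - mean (real k * c / 2 ^ j) (real (Suc k) * c / 2 ^ j)) ^ 4 / (real n)\<^sup>2" for j k \<omega>
  proof -
    have "sqrt (real n) ^ 4 = (real n)\<^sup>2" using power_mult[of "sqrt (real n)" 2 2] by simp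
    then show ?thesis unfolding X_eq power_divide by simp
  qed
  have intX: "integrable M (\<lambda>\<omega>. X j k \<omega> ^ 4)" for j k
    unfolding X4 using integrable_count_power by simp
  have EX: "expectation (\<lambda>\<omega>. X j k \<omega> ^ 4) \<le> C / 4 ^ j" if "j \<le> J" for j k
  proof -
    let ?s = "real k * c / 2 ^ j" and ?t = "real (Suc k) * c / 2 ^ j"
    define B where "B = (?t - ?s) * (\<Sum>e\<in>edges. rate e)"
    have "?t - ?s = c / 2 ^ j" by (simp add: diff_divide_distrib[symmetric] algebra_simps)
    then have B: "B = c / 2 ^ j * (\<Sum>e\<in>edges. rate e)" by (simp add: B_def)
    have B0: "0 \<le> B" unfolding B using c by (intro mult_nonneg_nonneg sum_nonneg rate_nonneg) auto
    have "B \<le> c / 2 ^ j * (real n * A)" unfolding B using c rates by (intro mult_left_mono) auto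
    then have Bn: "B / real n \<le> A * c / 2 ^ j" using n by (simp add: field_simps)
    have Bn0: "0 \<le> B / real n" using B0 by simp
    have "2 ^ j \<le> real n"
      using that nJ(1) by (meson one_le_numeral order_trans power_increasing)
    then have jn: "1 / real n \<le> 1 / 2 ^ j" using n by (intro divide_left_mono) auto
    have "expectation (\<lambda>\<omega>. X j k \<omega> ^ 4) = expectation (\<lambda>\<omega>. (count ?s ?t \<omega> - mean ?s ?t) ^ 4) / (real n)\<^sup>2"
      unfolding X4 by simp
    also have "\<dots> \<le> (B + 3 * B\<^sup>2) / (real n)\<^sup>2"
      using count_moments(2)[OF pts(1,2)[of k j]] unfolding B_def by (intro divide_right_mono) auto
    also have "\<dots> = (B / real n) * (1 / real n) + 3 * (B / real n)\<^sup>2"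
      by (simp add: power2_eq_square add_divide_distrib)
    also have "\<dots> \<le> (A * c / 2 ^ j) * (1 / 2 ^ j) + 3 * (A * c / 2 ^ j)\<^sup>2"
      using Bn Bn0 jn A c by (intro add_mono mult_mono mult_left_mono power_mono) auto
    also have "\<dots> = C / 4 ^ j"
    proof -
      have "(4 :: real) ^ j = 2 ^ j * 2 ^ j" by (simp flip: power_mult_distrib)
      then show ?thesis by (simp add: C_def power2_eq_square add_divide_distrib)
    qed
    finally show ?thesis .
  qed
  have intd: "integrable M (\<lambda>\<omega>. d \<omega> j)" for j
    unfolding d_def using intX by (intro Bochner_Integration.integrable_add integrable_divide Bochner_Integration.integrable_sum) auto
  have Ed: "expectation (\<lambda>\<omega>. d \<omega> j) \<le> (1 + C) * a j" if "j \<le> J" for j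
  proof -
    have "expectation (\<lambda>\<omega>. d \<omega> j) = a j + (\<Sum>k<(2::nat) ^ j. expectation (\<lambda>\<omega>. X j k \<omega> ^ 4)) / a j ^ 3"
      unfolding d_def using intX by (subst Bochner_Integration.integral_add) (auto simp: prob_space)
    also have "\<dots> \<le> a j + (\<Sum>k<(2::nat) ^ j. C / 4 ^ j) / a j ^ 3"
      using EX[OF that] a[of j] by (intro add_left_mono divide_right_mono sum_mono) auto
    also have "(\<Sum>k<(2::nat) ^ j. C / 4 ^ j) = C / 2 ^ j"
    proof -
      have "(4 :: real) ^ j = 2 ^ j * 2 ^ j" by (simp flip: power_mult_distrib)
      then show ?thesis by simp
    qed
    also have "C / 2 ^ j / a j ^ 3 \<le> C * a j"
    proof -
      have "2 ^ j * a j ^ 4 = (2 * (9 / 10) ^ 4) ^ j"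
        by (simp add: a_def power_mult_distrib power_mult[symmetric] mult.commute)
      moreover have "(1 :: real) \<le> (2 * (9 / 10) ^ 4) ^ j"
        by (intro one_le_power) (simp add: power_numeral_reduce)
      ultimately have "1 \<le> 2 ^ j * a j ^ 3 * a j" by (simp add: power_numeral_reduce mult_ac)
      then have "1 / (2 ^ j * a j ^ 3) \<le> a j" using a[of j] by (simp add: field_simps)
      then have "C * (1 / (2 ^ j * a j ^ 3)) \<le> C * a j" using C by (rule mult_left_mono)
      then show ?thesis by simp
    qed
    finally show ?thesis by (simp add: algebra_simps)
  qed
  \<comment> \<open>\<open>count\<close> never decreases in its right end, so the fluctuation falls
    only through the mean, at a rate of at most n A / sqrt n. Over the finest mesh, which is at most
    2 c / n, this amounts to 2 A c / sqrt n.\<close>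
  define H where "H = A * sqrt (real n)"
  have H: "0 \<le> H" using A by (simp add: H_def)
  define U where "U \<omega> = sum (d \<omega>) {m<..J} + d \<omega> J + H * c / 2 ^ J" for \<omega>
  show ?thesis
  proof (rule that)
    show "integrable M U"
      unfolding U_def using intd by (intro Bochner_Integration.integrable_add Bochner_Integration.integrable_sum) auto
    fix \<omega> t assume t: "t \<in> {0..c}"
    have mono: "fluct n s \<omega> - fluct n t \<omega> \<le> H * (t - s)" if st: "0 \<le> s" "s \<le> t" for s t
    proof -
      have "fluct n s \<omega> - fluct n t \<omega> = (mean s t - count s t \<omega>) / sqrt (real n)"
        using fluct_diff[OF st, of n \<omega>] by (simp add: diff_divide_distrib)
      also have "\<dots> \<le> (t - s) * (real n * A) / sqrt (real n)"
      proof (rule divide_right_mono)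
        have "(t - s) * (\<Sum>e\<in>edges. rate e) \<le> (t - s) * (real n * A)"
          using st rates by (intro mult_left_mono) auto
        then show "mean s t - count s t \<omega> \<le> (t - s) * (real n * A)"
          using mean_le[OF st] count_nonneg[of s t \<omega>] by linarith
      qed simp
      also have "\<dots> = (t - s) * A * (real n / sqrt (real n))" by simp
      also have "\<dots> = H * (t - s)" by (simp only: real_div_sqrt of_nat_0_le_iff H_def mult_ac)
      finally show ?thesis .
    qed
    show "\<bar>fluct n t \<omega> - grid_path c (2 ^ m) (\<lambda>k. fluct n (real k * c / 2 ^ m) \<omega>) t\<bar> \<le> U \<omega>"
      unfolding U_def
    proof (rule dyadic_modulus[OF c mJ _ d0 H _ t, where f = "\<lambda>t. fluct n t \<omega>"])
      show "\<bar>fluct n (real (Suc k) * c / 2 ^ j) \<omega> - fluct n (real k * c / 2 ^ j) \<omega>\<bar> \<le> d \<omega> j"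
        if "k < 2 ^ j" for j k
        using dX[OF that, of \<omega>] unfolding X_def .
    qed (rule mono)
  next
    have "expectation U = (\<Sum>j\<in>{m<..J}. expectation (\<lambda>\<omega>. d \<omega> j)) + expectation (\<lambda>\<omega>. d \<omega> J) + H * c / 2 ^ J"
      unfolding U_def using intd by (simp add: prob_space)
    also have "\<dots> \<le> (\<Sum>j\<in>{m<..J}. (1 + C) * a j) + (1 + C) * a J + 2 * A * c / sqrt (real n)"
    proof (intro add_mono sum_mono Ed)
      have "H * c / 2 ^ J = 2 * A * c * sqrt (real n) / (2 * 2 ^ J)" by (simp add: H_def)
      also have "\<dots> \<le> 2 * A * c * sqrt (real n) / real n"
      proof (rule divide_left_mono[OF nJ(2)])
        show "0 \<le> 2 * A * c * sqrt (real n)" using A c by simp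
      qed (use n in simp)
      also have "\<dots> = 2 * A * c / sqrt (real n)" using sqrt_divide_self_eq[of "real n"] by (simp add: divide_inverse mult.assoc)
      finally show "H * c / 2 ^ J \<le> 2 * A * c / sqrt (real n)" .
    qed auto
    also have "(\<Sum>j\<in>{m<..J}. (1 + C) * a j) = (1 + C) * (9 * (a m - a J))"
      using sum_geometric_tail[OF mJ] by (simp add: sum_distrib_left[symmetric] a_def)
    also have "(1 + C) * (9 * (a m - a J)) + (1 + C) * a J \<le> 11 * (1 + C) * a m"
    proof -
      have "9 * (a m - a J) + a J \<le> 11 * a m" using a[of m] a[of J] unfolding right_diff_distrib by linarith
      then have "(1 + C) * (9 * (a m - a J) + a J) \<le> (1 + C) * (11 * a m)"
        using C by (intro mult_left_mono) auto
      then show ?thesis by (simp add: algebra_simps)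
    qed
    finally show "expectation U \<le> 11 * (1 + (A * c + 3 * (A * c)\<^sup>2)) * (9 / 10) ^ m + 2 * A * c / sqrt (real n)"
      by (simp add: C_def a_def)
  qed
qed


section \<open>Characteristic functions of the increments over a grid\<close>

text \<open>The linear combination of increments is a sum over edges of independent centred
  variables \<open>\<zeta> e\<close>. Each factor is compared with the Gaussian factor of the same
  variance by a third-order Taylor bound, and products of numbers of modulus at most 1 differ by at
  most the sum of the differences. With a total rate of order n and a bounded sum of squared rates,
  the errors are of order n^(-1/2) and 1/n.\<close>

lemma char_cells:
  fixes \<tau> u :: "nat \<Rightarrow> real" and k :: nat
  assumes n: "0 < n" and \<tau>0: "0 \<le> \<tau> 0" and \<tau>: "mono \<tau>"
  defines "D \<equiv> \<tau> k" and "B \<equiv> \<Sum>i<k. \<bar>u i\<bar>"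
  shows "cmod (expectation (\<lambda>\<omega>. iexp (\<Sum>i<k. u i * ((count (\<tau> i) (\<tau> (Suc i)) \<omega> - mean (\<tau> i) (\<tau> (Suc i))) / sqrt (real n))))
      - complex_of_real (exp (- ((\<Sum>i<k. (u i)\<^sup>2 * (mean (\<tau> i) (\<tau> (Suc i)) / real n)) / 2))))
    \<le> B ^ 3 * D * (\<Sum>e\<in>edges. rate e) / (real n * sqrt (real n)) + (B ^ 4 * D\<^sup>2 / (real n)\<^sup>2 + B\<^sup>2 * D\<^sup>2 / real n) * (\<Sum>e\<in>edges. (rate e)\<^sup>2)"
    (is "cmod (?E - complex_of_real ?X) \<le> _")
proof -
  define b where "b i x = (of_bool (ereal (\<tau> i) < x \<and> x \<le> ereal (\<tau> (Suc i))) :: real)" for i x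
  have [measurable]: "b i \<in> borel_measurable borel" for i unfolding b_def by measurable
  \<comment> \<open>The contribution of one clock before centring: \<open>u i\<close> if it rings in
    cell \<open>i\<close>. The cells are disjoint, hence the square of \<open>h\<close> has no mixed
    terms.\<close>
  define h where "h x = (\<Sum>i<k. u i * b i x)" for x
  have [measurable]: "h \<in> borel_measurable borel" unfolding h_def by measurable
  have B0: "0 \<le> B" by (simp add: B_def sum_nonneg)
  have \<tau>_nonneg: "0 \<le> \<tau> i" for i using \<tau>0 monoD[OF \<tau>, of 0 i] by simp
  have D0: "0 \<le> D" using \<tau>_nonneg by (simp add: D_def)
  have bb: "b i x * b j x = (if i = j then b i x else 0)" for i j x
  proof (cases i j rule: linorder_cases)
    case less
    then have "\<tau> (Suc i) \<le> \<tau> j" using monoD[OF \<tau>, of "Suc i" j] by simp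
    then show ?thesis using less order_trans[of x "ereal (\<tau> (Suc i))" "ereal (\<tau> j)"] by (auto simp: b_def)
  next
    case greater
    then have "\<tau> (Suc j) \<le> \<tau> i" using monoD[OF \<tau>, of "Suc j" i] by simp
    then show ?thesis using greater order_trans[of x "ereal (\<tau> (Suc j))" "ereal (\<tau> i)"] by (auto simp: b_def)
  qed (simp add: b_def)
  have h2: "(h x)\<^sup>2 = (\<Sum>i<k. (u i)\<^sup>2 * b i x)" for x
  proof -
    have "(h x)\<^sup>2 = (\<Sum>i<k. \<Sum>j<k. u i * u j * (b i x * b j x))"
      unfolding h_def power2_eq_square sum_product by (intro sum.cong refl) (simp add: mult_ac)
    also have "\<dots> = (\<Sum>i<k. \<Sum>j<k. if j = i then u i * u i * b i x else 0)"
      unfolding bb by (intro sum.cong refl) auto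
    also have "\<dots> = (\<Sum>i<k. (u i)\<^sup>2 * b i x)"
      by (intro sum.cong refl) (simp add: power2_eq_square)
    finally show ?thesis .
  qed
  have b_le: "b i x \<le> of_bool (x \<le> ereal D)" "0 \<le> b i x" if "i < k" for i x
    using monoD[OF \<tau>, of "Suc i" k] that order_trans[of x "ereal (\<tau> (Suc i))" "ereal (\<tau> k)"]
    by (auto simp: b_def D_def)
  have h_le: "\<bar>h x\<bar> \<le> B * of_bool (x \<le> ereal D)" for x
  proof -
    have "\<bar>h x\<bar> \<le> (\<Sum>i<k. \<bar>u i\<bar> * of_bool (x \<le> ereal D))"
      unfolding h_def
    proof (intro order_trans[OF sum_abs] sum_mono)
      fix i assume "i \<in> {..<k}"
      then have "\<bar>b i x\<bar> \<le> of_bool (x \<le> ereal D)" using b_le[of i x] by simp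
      then show "\<bar>u i * b i x\<bar> \<le> \<bar>u i\<bar> * of_bool (x \<le> ereal D)"
        unfolding abs_mult by (intro mult_left_mono) auto
    qed
    then show ?thesis by (simp add: B_def sum_distrib_right)
  qed
  have hB: "\<bar>h x\<bar> \<le> B" for x using h_le[of x] B0 by (auto split: if_splits simp: of_bool_def)
  define \<mu> where "\<mu> e = expectation (\<lambda>\<omega>. h (T e \<omega>))" for e
  define P where "P e = expectation (\<lambda>\<omega>. (h (T e \<omega>))\<^sup>2)" for e
  define v where "v e = (P e - (\<mu> e)\<^sup>2) / real n" for e
  define \<zeta> where "\<zeta> e \<omega> = (h (T e \<omega>) - \<mu> e) / sqrt (real n)" for e \<omega>
  note T_measurable[measurable]
  have int_h: "integrable M (\<lambda>\<omega>. h (T e \<omega>))" if [measurable]: "e \<in> edges" for e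
    by (rule integrable_const_bound[where B = B]) (auto intro: hB)
  have int_h2: "integrable M (\<lambda>\<omega>. (h (T e \<omega>))\<^sup>2)" if [measurable]: "e \<in> edges" for e
    by (rule integrable_const_bound[where B = "B\<^sup>2"]) (auto simp: abs_le_square_iff[symmetric] B0 hB)
  have int_b: "integrable M (\<lambda>\<omega>. b i (T e \<omega>))" if "e \<in> edges" for i e
    using that by (intro integrable_const_bound[where B = 1]) (auto simp: b_def)
  have Eb: "expectation (\<lambda>\<omega>. b i (T e \<omega>)) = exp (- \<tau> i * rate e) - exp (- \<tau> (Suc i) * rate e)" if "e \<in> edges" for i e
    unfolding b_def using monoD[OF \<tau>, of i "Suc i"] by (intro expectation_indicator_between that \<tau>_nonneg) simp
  have PD: "expectation (\<lambda>\<omega>. of_bool (T e \<omega> \<le> ereal D)) \<le> D * rate e"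
    and int_D: "integrable M (\<lambda>\<omega>. of_bool (T e \<omega> \<le> ereal D) :: real)" if [measurable]: "e \<in> edges" for e
  proof -
    have "expectation (\<lambda>\<omega>. of_bool (T e \<omega> \<le> ereal D)) = expectation (indicator {\<omega> \<in> space M. T e \<omega> \<le> ereal D})"
      by (rule Bochner_Integration.integral_cong) (auto simp: indicator_def)
    also have "\<dots> = prob {\<omega> \<in> space M. T e \<omega> \<le> ereal D}" by (simp add: Int_def conj_ac)
    finally show "expectation (\<lambda>\<omega>. of_bool (T e \<omega> \<le> ereal D)) \<le> D * rate e"
      using prob_T_le_bound[OF that D0] by simp
    show "integrable M (\<lambda>\<omega>. of_bool (T e \<omega> \<le> ereal D) :: real)"
      by (rule integrable_const_bound[where B = 1]) auto
  qed
  have \<mu>_le: "\<bar>\<mu> e\<bar> \<le> B * (D * rate e)" if "e \<in> edges" for e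
  proof -
    have "\<bar>\<mu> e\<bar> \<le> expectation (\<lambda>\<omega>. \<bar>h (T e \<omega>)\<bar>)" unfolding \<mu>_def by (rule integral_abs_bound)
    also have "\<dots> \<le> expectation (\<lambda>\<omega>. B * of_bool (T e \<omega> \<le> ereal D))"
      using int_h[OF that] int_D[OF that] h_le by (intro integral_mono) auto
    also have "\<dots> \<le> B * (D * rate e)" using PD[OF that] B0 by (simp add: mult_left_mono)
    finally show ?thesis .
  qed
  have P_le: "P e \<le> B\<^sup>2 * (D * rate e)" if "e \<in> edges" for e
  proof -
    have "P e \<le> expectation (\<lambda>\<omega>. B\<^sup>2 * of_bool (T e \<omega> \<le> ereal D))"
      unfolding P_def
    proof (rule integral_mono[OF int_h2[OF that]])
      fix \<omega>
      have "\<bar>h (T e \<omega>)\<bar>\<^sup>2 \<le> (B * of_bool (T e \<omega> \<le> ereal D))\<^sup>2" by (intro power_mono h_le) simp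
      then show "(h (T e \<omega>))\<^sup>2 \<le> B\<^sup>2 * of_bool (T e \<omega> \<le> ereal D)" by (simp add: power_mult_distrib of_bool_def split: if_splits)
    qed (use int_D[OF that] in simp)
    also have "\<dots> \<le> B\<^sup>2 * (D * rate e)" using PD[OF that] by (simp add: mult_left_mono)
    finally show ?thesis .
  qed
  have int_\<zeta>: "integrable M (\<zeta> e)" and mean_\<zeta>: "expectation (\<zeta> e) = 0" if "e \<in> edges" for e
    using int_h[OF that] by (simp_all add: \<zeta>_def[abs_def] \<mu>_def prob_space)
  have sq: "(\<zeta> e \<omega>)\<^sup>2 = ((h (T e \<omega>))\<^sup>2 - 2 * \<mu> e * h (T e \<omega>) + (\<mu> e)\<^sup>2) / real n" for e \<omega>
    by (simp add: \<zeta>_def power_divide power2_diff algebra_simps)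
  have int_\<zeta>2: "integrable M (\<lambda>\<omega>. (\<zeta> e \<omega>)\<^sup>2)" and var_\<zeta>: "expectation (\<lambda>\<omega>. (\<zeta> e \<omega>)\<^sup>2) = v e" if "e \<in> edges" for e
    using int_h[OF that] int_h2[OF that] unfolding sq
    by (simp_all add: v_def P_def \<mu>_def[symmetric] prob_space power2_eq_square)
  have v0: "0 \<le> v e" if "e \<in> edges" for e using var_\<zeta>[OF that, symmetric] by simp
  have v_le: "v e \<le> B\<^sup>2 * (D * rate e) / real n" if "e \<in> edges" for e
    unfolding v_def using P_le[OF that] by (intro divide_right_mono) (auto intro: order_trans[rotated])
  have \<zeta>_le: "\<bar>\<zeta> e \<omega>\<bar> \<le> 2 * B / sqrt (real n)" if "e \<in> edges" for e \<omega>
  proof -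
    have "\<bar>\<mu> e\<bar> \<le> expectation (\<lambda>\<omega>. \<bar>h (T e \<omega>)\<bar>)" unfolding \<mu>_def by (rule integral_abs_bound)
    also have "\<dots> \<le> expectation (\<lambda>\<omega>. B)" using int_h[OF that] hB by (intro integral_mono) auto
    finally have "\<bar>h (T e \<omega>) - \<mu> e\<bar> \<le> 2 * B" using hB[of "T e \<omega>"] by (simp add: prob_space)
    then show ?thesis by (simp add: \<zeta>_def abs_divide divide_right_mono)
  qed
  have \<zeta>_meas[measurable]: "\<zeta> e \<in> borel_measurable M" if "e \<in> edges" for e using int_\<zeta>[OF that] by simp
  have ind: "indep_vars (\<lambda>_. borel) \<zeta> edges"
    unfolding \<zeta>_def by (rule indep_vars_compose2[OF indep]) measurable
  have sum_\<zeta>: "(\<Sum>e\<in>edges. \<zeta> e \<omega>) =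
      (\<Sum>i<k. u i * ((count (\<tau> i) (\<tau> (Suc i)) \<omega> - mean (\<tau> i) (\<tau> (Suc i))) / sqrt (real n)))" for \<omega>
  proof -
    have \<mu>: "\<mu> e = (\<Sum>i<k. u i * (exp (- \<tau> i * rate e) - exp (- \<tau> (Suc i) * rate e)))" if "e \<in> edges" for e
      unfolding \<mu>_def h_def using int_b[OF that] Eb[OF that] by simp
    have "(\<Sum>e\<in>edges. \<zeta> e \<omega>) = (\<Sum>e\<in>edges. \<Sum>i<k. u i * (b i (T e \<omega>)
        - (exp (- \<tau> i * rate e) - exp (- \<tau> (Suc i) * rate e))) / sqrt (real n))"
      unfolding \<zeta>_def h_def using \<mu>
      by (intro sum.cong refl) (simp add: sum_subtractf[symmetric] sum_divide_distrib right_diff_distrib del: mult_minus_left)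
    also have "\<dots> = (\<Sum>i<k. \<Sum>e\<in>edges. u i * (b i (T e \<omega>)
        - (exp (- \<tau> i * rate e) - exp (- \<tau> (Suc i) * rate e))) / sqrt (real n))"
      by (rule sum.swap)
    also have "\<dots> = (\<Sum>i<k. u i * ((count (\<tau> i) (\<tau> (Suc i)) \<omega> - mean (\<tau> i) (\<tau> (Suc i))) / sqrt (real n)))"
      unfolding count_def mean_def b_def
      by (intro sum.cong refl)
        (simp only: sum_subtractf[symmetric] sum_divide_distrib[symmetric] sum_distrib_left[symmetric] times_divide_eq_right)
    finally show ?thesis .
  qed
  have sum_P: "(\<Sum>e\<in>edges. P e) = (\<Sum>i<k. (u i)\<^sup>2 * mean (\<tau> i) (\<tau> (Suc i)))"
  proof -
    have "P e = (\<Sum>i<k. (u i)\<^sup>2 * (exp (- \<tau> i * rate e) - exp (- \<tau> (Suc i) * rate e)))" if "e \<in> edges" for e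
      unfolding P_def h2 using int_b[OF that] Eb[OF that] by simp
    then have "(\<Sum>e\<in>edges. P e) = (\<Sum>e\<in>edges. \<Sum>i<k. (u i)\<^sup>2 * (exp (- \<tau> i * rate e) - exp (- \<tau> (Suc i) * rate e)))"
      by (intro sum.cong refl)
    also have "\<dots> = (\<Sum>i<k. \<Sum>e\<in>edges. (u i)\<^sup>2 * (exp (- \<tau> i * rate e) - exp (- \<tau> (Suc i) * rate e)))"
      by (rule sum.swap)
    finally show ?thesis by (simp only: mean_def sum_distrib_left)
  qed
  have ?thesis if "?E = (\<Prod>e\<in>edges. char (distr M borel (\<zeta> e)) 1)"
  proof -
    have each: "cmod (char (distr M borel (\<zeta> e)) 1 - complex_of_real (exp (- (v e / 2))))
        \<le> B ^ 3 * D * rate e / (real n * sqrt (real n)) + B ^ 4 * D\<^sup>2 / (real n)\<^sup>2 * (rate e)\<^sup>2" if e: "e \<in> edges" for e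
    proof -
      have "cmod (char (distr M borel (\<zeta> e)) 1 - complex_of_real (1 - 1\<^sup>2 * v e / 2))
          \<le> 1\<^sup>2 / 6 * expectation (\<lambda>\<omega>. min (6 * (\<zeta> e \<omega>)\<^sup>2) (\<bar>1\<bar> * \<bar>\<zeta> e \<omega>\<bar> ^ 3))"
        using int_\<zeta>[OF e] int_\<zeta>2[OF e] mean_\<zeta>[OF e] var_\<zeta>[OF e] by (intro char_approx3') auto
      \<comment> \<open>Since \<zeta> is at most 2 B / sqrt n, the third absolute moment is traded
        for the variance.\<close>
      also have "\<dots> \<le> 1\<^sup>2 / 6 * expectation (\<lambda>\<omega>. 2 * B / sqrt (real n) * (\<zeta> e \<omega>)\<^sup>2)"
      proof (intro mult_left_mono integral_mono)
        show "integrable M (\<lambda>\<omega>. min (6 * (\<zeta> e \<omega>)\<^sup>2) (\<bar>1\<bar> * \<bar>\<zeta> e \<omega>\<bar> ^ 3))"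
          by (rule Bochner_Integration.integrable_bound[of M "\<lambda>\<omega>. 6 * (\<zeta> e \<omega>)\<^sup>2"])
            (use int_\<zeta>2[OF e] e in auto)
        fix \<omega>
        have "\<bar>\<zeta> e \<omega>\<bar> * \<bar>\<zeta> e \<omega>\<bar>\<^sup>2 \<le> 2 * B / sqrt (real n) * \<bar>\<zeta> e \<omega>\<bar>\<^sup>2"
          by (intro mult_right_mono \<zeta>_le e) simp
        then have "\<bar>\<zeta> e \<omega>\<bar> ^ 3 \<le> 2 * B / sqrt (real n) * (\<zeta> e \<omega>)\<^sup>2"
          by (simp add: power3_eq_cube power2_eq_square)
        then show "min (6 * (\<zeta> e \<omega>)\<^sup>2) (\<bar>1\<bar> * \<bar>\<zeta> e \<omega>\<bar> ^ 3) \<le> 2 * B / sqrt (real n) * (\<zeta> e \<omega>)\<^sup>2"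
          by simp
      qed (use int_\<zeta>2[OF e] in auto)
      also have "\<dots> = (1 / 3) * (B / sqrt (real n) * v e)" using int_\<zeta>2[OF e] var_\<zeta>[OF e] by simp
      also have "\<dots> \<le> 1 * (B / sqrt (real n) * (B\<^sup>2 * (D * rate e) / real n))"
        using B0 v0[OF e] v_le[OF e] by (intro mult_mono mult_left_mono) auto
      also have "\<dots> = B ^ 3 * D * rate e / (real n * sqrt (real n))"
        by (simp add: power3_eq_cube power2_eq_square mult_ac)
      finally have 1: "cmod (char (distr M borel (\<zeta> e)) 1 - complex_of_real (1 - v e / 2))
          \<le> B ^ 3 * D * rate e / (real n * sqrt (real n))" by simp
      have "\<bar>(1 - v e / 2) - exp (- (v e / 2))\<bar> \<le> (v e)\<^sup>2"
      proof -
        have "1 - v e / 2 \<le> exp (- (v e / 2))" using exp_ge_add_one_self[of "- (v e / 2)"] by simp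
        moreover have "exp (- (v e / 2)) \<le> 1 - v e / 2 + (v e / 2)\<^sup>2"
          using v0[OF e] by (intro exp_minus_le) simp
        moreover have "(v e / 2)\<^sup>2 \<le> (v e)\<^sup>2" by (simp add: power_divide)
        ultimately show ?thesis by (simp add: abs_le_iff)
      qed
      also have "\<dots> \<le> (B\<^sup>2 * (D * rate e) / real n)\<^sup>2" using v0[OF e] v_le[OF e] by (intro power_mono)
      also have "\<dots> = B ^ 4 * D\<^sup>2 / (real n)\<^sup>2 * (rate e)\<^sup>2"
        by (simp add: power_mult_distrib power_divide power_mult[symmetric])
      finally have "cmod (complex_of_real (1 - v e / 2) - complex_of_real (exp (- (v e / 2)))) \<le> B ^ 4 * D\<^sup>2 / (real n)\<^sup>2 * (rate e)\<^sup>2"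
        unfolding of_real_diff[symmetric] norm_of_real .
      with 1 show ?thesis
        using norm_triangle_ineq[of "char (distr M borel (\<zeta> e)) 1 - complex_of_real (1 - v e / 2)"
            "complex_of_real (1 - v e / 2) - complex_of_real (exp (- (v e / 2)))"] by simp
    qed
    have "cmod (?E - (\<Prod>e\<in>edges. complex_of_real (exp (- (v e / 2)))))
        \<le> (\<Sum>e\<in>edges. cmod (char (distr M borel (\<zeta> e)) 1 - complex_of_real (exp (- (v e / 2)))))"
      unfolding that
    proof (rule norm_prod_diff)
      fix e assume e: "e \<in> edges"
      interpret d: real_distribution "distr M borel (\<zeta> e)" using e by (intro real_distribution_distr) measurable
      show "cmod (char (distr M borel (\<zeta> e)) 1) \<le> 1" by (rule d.cmod_char_le_1)
      show "cmod (complex_of_real (exp (- (v e / 2)))) \<le> 1" using v0[OF e] by simp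
    qed
    also have "\<dots> \<le> (\<Sum>e\<in>edges. B ^ 3 * D * rate e / (real n * sqrt (real n)) + B ^ 4 * D\<^sup>2 / (real n)\<^sup>2 * (rate e)\<^sup>2)"
      by (intro sum_mono each)
    also have "\<dots> = B ^ 3 * D * (\<Sum>e\<in>edges. rate e) / (real n * sqrt (real n)) + B ^ 4 * D\<^sup>2 / (real n)\<^sup>2 * (\<Sum>e\<in>edges. (rate e)\<^sup>2)"
      by (simp only: sum.distrib sum_distrib_left sum_divide_distrib)
    finally have 1: "cmod (?E - (\<Prod>e\<in>edges. complex_of_real (exp (- (v e / 2))))) \<le> \<dots>" .
    have prod: "(\<Prod>e\<in>edges. complex_of_real (exp (- (v e / 2)))) = complex_of_real (exp (- (sum v edges / 2)))"
      by (simp add: exp_sum[OF finite_edges, symmetric] sum_negf sum_divide_distrib of_real_prod[symmetric] del: of_real_exp)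
    have "\<bar>exp (- (sum v edges / 2)) - ?X\<bar> \<le> B\<^sup>2 * D\<^sup>2 / real n * (\<Sum>e\<in>edges. (rate e)\<^sup>2)"
    proof -
      have lip: "\<bar>exp (- x) - exp (- y)\<bar> \<le> y - x" if "0 \<le> x" "x \<le> y" for x y :: real
      proof -
        have "exp (- y) \<le> exp (- x)" using that by simp
        moreover have "exp (- x) - exp (- y) \<le> y - x" using exp_diff_le[of 1 x y] that by simp
        ultimately show ?thesis by simp
      qed
      \<comment> \<open>Dropping the squared means turns the total variance into the combination of
        \<open>mean\<close> values in the statement. As \<open>\<mu> e\<close> is at most a multiple
        of the rate of \<open>e\<close>, this costs a multiple of the sum of the squared
        rates.\<close>
      have sv: "sum v edges = (\<Sum>i<k. (u i)\<^sup>2 * (mean (\<tau> i) (\<tau> (Suc i)) / real n)) - (\<Sum>e\<in>edges. (\<mu> e)\<^sup>2) / real n"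
        unfolding v_def using sum_P by (simp add: diff_divide_distrib sum_subtractf sum_divide_distrib[symmetric])
      have m0: "0 \<le> (\<Sum>e\<in>edges. (\<mu> e)\<^sup>2) / real n" by (simp add: sum_nonneg)
      have "\<bar>exp (- (sum v edges / 2)) - ?X\<bar> \<le> (\<Sum>i<k. (u i)\<^sup>2 * (mean (\<tau> i) (\<tau> (Suc i)) / real n)) / 2 - sum v edges / 2"
      proof (rule lip)
        show "0 \<le> sum v edges / 2" using v0 by (simp add: sum_nonneg)
      qed (use sv m0 in linarith)
      also have "\<dots> = (\<Sum>e\<in>edges. (\<mu> e)\<^sup>2) / real n / 2"
        unfolding diff_divide_distrib[symmetric] using sv by simp
      also have "\<dots> \<le> (\<Sum>e\<in>edges. (\<mu> e)\<^sup>2) / real n" using m0 by simp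
      also have "\<dots> \<le> (\<Sum>e\<in>edges. B\<^sup>2 * D\<^sup>2 * (rate e)\<^sup>2) / real n"
      proof (intro divide_right_mono sum_mono)
        fix e assume "e \<in> edges"
        then have "\<bar>\<mu> e\<bar>\<^sup>2 \<le> (B * (D * rate e))\<^sup>2" by (intro power_mono \<mu>_le) auto
        then show "(\<mu> e)\<^sup>2 \<le> B\<^sup>2 * D\<^sup>2 * (rate e)\<^sup>2" by (simp add: power_mult_distrib)
      qed simp
      also have "\<dots> = B\<^sup>2 * D\<^sup>2 / real n * (\<Sum>e\<in>edges. (rate e)\<^sup>2)" unfolding sum_distrib_left[symmetric] by simp
      finally show ?thesis .
    qed
    then have 2: "cmod (complex_of_real (exp (- (sum v edges / 2))) - complex_of_real ?X) \<le> B\<^sup>2 * D\<^sup>2 / real n * (\<Sum>e\<in>edges. (rate e)\<^sup>2)"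
      unfolding of_real_diff[symmetric] norm_of_real .
    show ?thesis
      using norm_triangle_ineq[of "?E - complex_of_real (exp (- (sum v edges / 2)))"
          "complex_of_real (exp (- (sum v edges / 2))) - complex_of_real ?X"] 1 2 unfolding prod
      by (simp add: distrib_right)
  qed
  moreover have "?E = (\<Prod>e\<in>edges. char (distr M borel (\<zeta> e)) 1)"
  proof -
    have "(\<lambda>\<omega>. \<Sum>e\<in>edges. \<zeta> e \<omega>) \<in> borel_measurable M" by measurable
    then have "char (distr M borel (\<lambda>\<omega>. \<Sum>e\<in>edges. \<zeta> e \<omega>)) 1 = expectation (\<lambda>\<omega>. iexp (\<Sum>e\<in>edges. \<zeta> e \<omega>))"
      unfolding char_def by (subst integral_distr) auto
    then show ?thesis using char_distr_sum[OF ind, of 1] unfolding sum_\<zeta> by simp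
  qed
  ultimately show ?thesis by blast
qed

end

section \<open>Finite-dimensional convergence\<close>

text \<open>Real trigonometric polynomials in the first \<open>k\<close> coordinates. The phase
  covers the sines, and the expectation of such a function is determined by finitely many values of
  the characteristic function.\<close>

inductive trig_poly :: "nat \<Rightarrow> ((nat \<Rightarrow> real) \<Rightarrow> real) \<Rightarrow> bool" for k where
  cos: "trig_poly k (\<lambda>x. a * cos ((\<Sum>i<k. u i * x i) + \<theta>))"
| add: "trig_poly k f \<Longrightarrow> trig_poly k g \<Longrightarrow> trig_poly k (\<lambda>x. f x + g x)"

lemma trig_poly_const: "trig_poly k (\<lambda>x. a)"
  using trig_poly.cos[of k a "\<lambda>_. 0" 0] by simp

lemma trig_poly_sin:
  assumes "j < k"
  shows "trig_poly k (\<lambda>x. sin (r * x j))"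
proof -
  have "(\<Sum>i<k. (if i = j then r else 0) * x i) = r * x j" for x :: "nat \<Rightarrow> real"
  proof -
    have "(\<Sum>i<k. (if i = j then r else 0) * x i) = (\<Sum>i<k. if i = j then r * x j else 0)"
      by (rule sum.cong) auto
    then show ?thesis using assms by simp
  qed
  moreover have "cos (y + - (pi / 2)) = sin y" for y :: real by (simp add: cos_diff)
  ultimately show ?thesis
    using trig_poly.cos[of k 1 "\<lambda>i. if i = j then r else 0" "- (pi / 2)"] by simp
qed

text \<open>By the product-to-sum formula the class is an algebra, as the Stone-Weierstrass theorem
  requires.\<close>

lemma trig_poly_mult:
  assumes "trig_poly k f" "trig_poly k g"
  shows "trig_poly k (\<lambda>x. f x * g x)"
  using assms
proof (induction f rule: trig_poly.induct)
  case (cos a u \<theta>)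
  show ?case
    using cos.prems
  proof (induction g rule: trig_poly.induct)
    case (cos b v \<eta>)
    have eq: "a * cos ((\<Sum>i<k. u i * x i) + \<theta>) * (b * cos ((\<Sum>i<k. v i * x i) + \<eta>)) =
       a * b / 2 * cos ((\<Sum>i<k. (u i - v i) * x i) + (\<theta> - \<eta>)) + a * b / 2 * cos ((\<Sum>i<k. (u i + v i) * x i) + (\<theta> + \<eta>))"
      for x :: "nat \<Rightarrow> real"
    proof -
      have 1: "(\<Sum>i<k. (u i - v i) * x i) + (\<theta> - \<eta>) = ((\<Sum>i<k. u i * x i) + \<theta>) - ((\<Sum>i<k. v i * x i) + \<eta>)"
        by (simp add: left_diff_distrib sum_subtractf)
      have 2: "(\<Sum>i<k. (u i + v i) * x i) + (\<theta> + \<eta>) = ((\<Sum>i<k. u i * x i) + \<theta>) + ((\<Sum>i<k. v i * x i) + \<eta>)"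
        by (simp add: distrib_right sum.distrib)
      show ?thesis unfolding 1 2 cos_add cos_diff by (simp add: algebra_simps)
    qed
    show ?case unfolding eq by (intro trig_poly.intros)
  next
    case (add f g)
    then show ?case by (simp add: distrib_left trig_poly.add)
  qed
next
  case (add f g)
  then show ?case by (simp add: distrib_right trig_poly.add)
qed

lemma trig_poly_bounded:
  assumes "trig_poly k f"
  obtains B where "\<And>x. \<bar>f x\<bar> \<le> B"
proof -
  from assms have "\<exists>B. \<forall>x. \<bar>f x\<bar> \<le> B"
  proof induction
    case (cos a u \<theta>)
    show ?case by (intro exI[of _ "\<bar>a\<bar>"]) (simp add: abs_mult mult_left_le)
  next
    case (add f g)
    then obtain A B where "\<forall>x. \<bar>f x\<bar> \<le> A" "\<forall>x. \<bar>g x\<bar> \<le> B" by blast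
    then have "\<bar>f x + g x\<bar> \<le> A + B" for x
      using abs_triangle_ineq[of "f x" "g x"] by (meson add_mono order_trans)
    then show ?case by blast
  qed
  then show ?thesis using that by blast
qed

lemma trig_poly_measurable:
  assumes "trig_poly k f" "\<And>i. X i \<in> borel_measurable M"
  shows "(\<lambda>\<omega>. f (\<lambda>i. X i \<omega>)) \<in> borel_measurable M"
  using assms(1)
proof induction
  case (cos a u \<theta>)
  note assms(2)[measurable]
  show ?case by measurable
qed measurable

lemma integrable_trig_poly:
  assumes "prob_space M" "trig_poly k f" "\<And>i. X i \<in> borel_measurable M"
  shows "integrable M (\<lambda>\<omega>. f (\<lambda>i. X i \<omega>))"
proof -
  interpret prob_space M by fact
  obtain B where "\<And>x. \<bar>f x\<bar> \<le> B" using trig_poly_bounded[OF assms(2)] by blast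
  then show ?thesis
    using trig_poly_measurable[OF assms(2,3)] by (intro integrable_const_bound[of _ B]) auto
qed

lemma integral_cos_eq:
  assumes "prob_space M" "Y \<in> borel_measurable M"
  shows "(\<integral>\<omega>. a * cos (Y \<omega> + \<theta>) \<partial>M) = a * Re (iexp \<theta> * (\<integral>\<omega>. iexp (Y \<omega>) \<partial>M))"
proof -
  interpret prob_space M by fact
  note assms(2)[measurable]
  have int: "integrable M (\<lambda>\<omega>. iexp (Y \<omega>))"
    by (rule integrable_const_bound[of _ 1]) auto
  have "cos (Y \<omega> + \<theta>) = Re (iexp \<theta> * iexp (Y \<omega>))" for \<omega>
    by (simp add: cis_conv_exp[symmetric] cos_add mult.commute)
  then have "(\<integral>\<omega>. cos (Y \<omega> + \<theta>) \<partial>M) = (\<integral>\<omega>. Re (iexp \<theta> * iexp (Y \<omega>)) \<partial>M)" by simp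
  also have "\<dots> = Re (\<integral>\<omega>. iexp \<theta> * iexp (Y \<omega>) \<partial>M)"
    using int by (intro integral_Re) simp
  finally show ?thesis by simp
qed

text \<open>On the cube where \<open>\<bar>r * x i\<bar> \<le> pi / 2\<close> the waves return the
  coordinates and the difference is 0. Outside it some (r x_i)^2 is at least 1, so the right-hand
  side exceeds the trivial bound 2 B: Chebyshev's inequality in pointwise form.\<close>

lemma triangle_wave_close:
  fixes x :: "nat \<Rightarrow> real" and g :: "(nat \<Rightarrow> real) \<Rightarrow> real"
  assumes g: "\<And>x. g x = g (\<lambda>i. if i < k then x i else 0)" and B: "\<And>x. \<bar>g x\<bar> \<le> B" and r: "r > 0"
  shows "\<bar>g x - g (\<lambda>i. if i < k then arcsin (sin (r * x i)) / r else 0)\<bar> \<le> 2 * B * r\<^sup>2 * (\<Sum>i<k. (x i)\<^sup>2)"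
proof (cases "\<forall>i<k. \<bar>r * x i\<bar> \<le> pi / 2")
  case True
  have "arcsin (sin (r * x i)) / r = x i" if "i < k" for i
  proof -
    have "\<bar>r * x i\<bar> \<le> pi / 2" using True that by blast
    then have "arcsin (sin (r * x i)) = r * x i" by (intro arcsin_sin) (auto simp: abs_le_iff)
    then show ?thesis using r by simp
  qed
  then have "(\<lambda>i. if i < k then arcsin (sin (r * x i)) / r else 0) = (\<lambda>i. if i < k then x i else 0)" by auto
  then have "g (\<lambda>i. if i < k then arcsin (sin (r * x i)) / r else 0) = g x" using g[of x] by simp
  moreover have "0 \<le> 2 * B * r\<^sup>2 * (\<Sum>i<k. (x i)\<^sup>2)"
    using B[of x] by (intro mult_nonneg_nonneg sum_nonneg) auto
  ultimately show ?thesis by simp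
next
  case False
  then obtain i where i: "i < k" "pi / 2 < \<bar>r * x i\<bar>" by force
  then have "1 \<le> \<bar>r * x i\<bar>" using pi_half_gt_zero pi_ge_two by linarith
  then have "1 \<le> (r * x i)\<^sup>2" by (metis abs_1 abs_le_square_iff one_power2 abs_abs)
  also have "\<dots> \<le> r\<^sup>2 * (\<Sum>i<k. (x i)\<^sup>2)"
    unfolding power_mult_distrib using i(1) by (intro mult_left_mono member_le_sum) auto
  finally have "2 * B * 1 \<le> 2 * B * (r\<^sup>2 * (\<Sum>i<k. (x i)\<^sup>2))"
    using B[of x] by (intro mult_left_mono) auto
  then show ?thesis
    using B[of x] B[of "\<lambda>i. if i < k then arcsin (sin (r * x i)) / r else 0"] by (simp add: abs_le_iff mult.assoc)
qed

text \<open>Vectors of length \<open>k\<close> are represented by functions on the naturals; pinning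
  the remaining coordinates to 0 makes the set a product of compact sets.\<close>

lemma compact_cube: "compact {s :: nat \<Rightarrow> real. \<forall>i. s i \<in> (if i < k then {-1..1} else {0})}"
proof -
  let ?S = "\<lambda>i. if i < k then {-1..1} else {0 :: real}"
  have "compactin (product_topology (\<lambda>_. euclidean) UNIV) (PiE UNIV ?S)"
    unfolding compactin_PiE by auto
  then have "compact (PiE UNIV ?S)" by (simp add: euclidean_product_topology)
  then show ?thesis by (simp add: PiE_def Pi_def)
qed

text \<open>The polynomials in \<open>sin (r x\<^sub>i)\<close> approximate uniformly every continuous function of the triangle
  waves \<open>arcsin (sin (r x\<^sub>i)) / r\<close>, which are bounded and agree with the coordinates on a cube
  that is large for small \<open>r\<close>; so no truncation is needed.\<close>

lemma trig_poly_approx: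
  fixes g :: "(nat \<Rightarrow> real) \<Rightarrow> real"
  assumes g: "continuous_on UNIV g" and r: "r > 0" and e: "e > 0"
  obtains f where "trig_poly k f" "\<And>x. \<bar>g (\<lambda>i. if i < k then arcsin (sin (r * x i)) / r else 0) - f x\<bar> \<le> e"
proof -
  define S where "S = {s :: nat \<Rightarrow> real. \<forall>i. s i \<in> (if i < k then {-1..1} else {0})}"
  define \<sigma> where "\<sigma> x = (\<lambda>i. if i < k then sin (r * x i) else 0)" for x :: "nat \<Rightarrow> real"
  have \<sigma>S: "\<sigma> x \<in> S" for x by (auto simp: \<sigma>_def S_def)
  define G where "G s = g (\<lambda>i. if i < k then arcsin (s i) / r else 0)" for s :: "nat \<Rightarrow> real"
  have "continuous_on S (\<lambda>s i. if i < k then arcsin (s i) / r else 0)"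
  proof (rule continuous_on_coordinatewise_then_product)
    fix i
    show "continuous_on S (\<lambda>s. if i < k then arcsin (s i) / r else 0)"
    proof (cases "i < k")
      case True
      have "continuous_on S (\<lambda>s. s i)"
        by (rule continuous_on_subset[OF continuous_on_product_coordinates]) simp
      then have "continuous_on S (\<lambda>s. arcsin (s i))"
        using True by (intro continuous_on_arcsin) (auto simp: S_def)
      then show ?thesis using True r by (auto intro!: continuous_on_divide continuous_on_const)
    qed simp
  qed
  then have contG: "continuous_on S G"
    unfolding G_def by (intro continuous_on_compose2[OF g]) auto
  \<comment> \<open>The algebra for Stone-Weierstrass: continuous functions of the sines that become
    trigonometric polynomials after composition with \<sigma>. The coordinates below
    \<open>k\<close> belong to it and separate the points of \<open>S\<close>.\<close>
  define R where "R h \<longleftrightarrow> continuous_on S h \<and> trig_poly k (\<lambda>x. h (\<sigma> x))" for h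
  have "\<exists>h. R h \<and> (\<forall>s\<in>S. \<bar>G s - h s\<bar> < e)"
  proof (rule Stone_Weierstrass_HOL)
    show "compact S" unfolding S_def by (rule compact_cube)
    show "R (\<lambda>x. c)" for c by (simp add: R_def trig_poly_const)
    show "R (\<lambda>x. f x + h x)" if "R f \<and> R h" for f h
      using that by (auto simp: R_def intro: continuous_on_add trig_poly.add)
    show "R (\<lambda>x. f x * h x)" if "R f \<and> R h" for f h
      using that by (auto simp: R_def intro: continuous_on_mult trig_poly_mult)
    show "\<exists>f. R f \<and> f s \<noteq> f t" if st: "s \<in> S \<and> t \<in> S \<and> s \<noteq> t" for s t
    proof -
      obtain i where i: "s i \<noteq> t i" using st by auto
      then have "i < k" using st by (auto simp: S_def split: if_splits) (metis)
      then have "R (\<lambda>s. s i)"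
        unfolding R_def using trig_poly_sin[of i k r]
        by (auto simp: \<sigma>_def intro: continuous_on_product_then_coordinatewise continuous_on_id)
      then show ?thesis using i by blast
    qed
  qed (use contG e in \<open>auto simp: R_def\<close>)
  then obtain h where h: "R h" "\<And>s. s \<in> S \<Longrightarrow> \<bar>G s - h s\<bar> < e" by blast
  show ?thesis
  proof (rule that)
    show "trig_poly k (\<lambda>x. h (\<sigma> x))" using h(1) by (simp add: R_def)
    fix x
    have "G (\<sigma> x) = g (\<lambda>i. if i < k then arcsin (sin (r * x i)) / r else 0)"
      unfolding G_def \<sigma>_def by (rule arg_cong[where f = g]) auto
    then show "\<bar>g (\<lambda>i. if i < k then arcsin (sin (r * x i)) / r else 0) - h (\<sigma> x)\<bar> \<le> e"
      using h(2)[OF \<sigma>S[of x]] by simp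
  qed
qed

text \<open>Integrates the pointwise bound of \<open>triangle_wave_close\<close>, so the second
  moments control what happens outside the cube.\<close>

lemma expectation_trig_approx:
  fixes X :: "nat \<Rightarrow> 'a \<Rightarrow> real" and g :: "(nat \<Rightarrow> real) \<Rightarrow> real"
  assumes "prob_space M" and X[measurable]: "\<And>i. X i \<in> borel_measurable M"
    and mom: "\<And>i. i < k \<Longrightarrow> integrable M (\<lambda>\<omega>. (X i \<omega>)\<^sup>2) \<and> (\<integral>\<omega>. (X i \<omega>)\<^sup>2 \<partial>M) \<le> C"
    and g: "continuous_on UNIV g" "\<And>x. g x = g (\<lambda>i. if i < k then x i else 0)" "\<And>x. \<bar>g x\<bar> \<le> B"
    and r: "r > 0" and f: "trig_poly k f" "\<And>x. \<bar>g (\<lambda>i. if i < k then arcsin (sin (r * x i)) / r else 0) - f x\<bar> \<le> e"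
  shows "\<bar>(\<integral>\<omega>. g (\<lambda>i. X i \<omega>) \<partial>M) - (\<integral>\<omega>. f (\<lambda>i. X i \<omega>) \<partial>M)\<bar> \<le> 2 * B * r\<^sup>2 * (real k * C) + e"
proof -
  interpret prob_space M by fact
  have gm: "g \<in> borel_measurable borel" using g(1) by (rule borel_measurable_continuous_onI)
  have "(\<lambda>\<omega> i. X i \<omega>) \<in> borel_measurable M"
    by (rule measurable_coordinatewise_then_product) measurable
  from measurable_compose[OF this gm] have gX: "integrable M (\<lambda>\<omega>. g (\<lambda>i. X i \<omega>))"
    by (intro integrable_const_bound[of _ B]) (auto simp: g(3))
  have fX: "integrable M (\<lambda>\<omega>. f (\<lambda>i. X i \<omega>))" by (rule integrable_trig_poly[OF assms(1) f(1) X])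
  have int: "integrable M (\<lambda>\<omega>. 2 * B * r\<^sup>2 * (\<Sum>i<k. (X i \<omega>)\<^sup>2) + e)"
    using mom by (intro Bochner_Integration.integrable_add integrable_mult_right Bochner_Integration.integrable_sum) auto
  have "\<bar>(\<integral>\<omega>. g (\<lambda>i. X i \<omega>) \<partial>M) - (\<integral>\<omega>. f (\<lambda>i. X i \<omega>) \<partial>M)\<bar> = \<bar>\<integral>\<omega>. g (\<lambda>i. X i \<omega>) - f (\<lambda>i. X i \<omega>) \<partial>M\<bar>"
    using gX fX by simp
  also have "\<dots> \<le> (\<integral>\<omega>. \<bar>g (\<lambda>i. X i \<omega>) - f (\<lambda>i. X i \<omega>)\<bar> \<partial>M)" by (rule integral_abs_bound)
  also have "\<dots> \<le> (\<integral>\<omega>. 2 * B * r\<^sup>2 * (\<Sum>i<k. (X i \<omega>)\<^sup>2) + e \<partial>M)"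
  proof (rule integral_mono)
    fix \<omega>
    show "\<bar>g (\<lambda>i. X i \<omega>) - f (\<lambda>i. X i \<omega>)\<bar> \<le> 2 * B * r\<^sup>2 * (\<Sum>i<k. (X i \<omega>)\<^sup>2) + e"
      using triangle_wave_close[where g = g and k = k, OF g(2,3) r, of "\<lambda>i. X i \<omega>"] f(2)[of "\<lambda>i. X i \<omega>"] by linarith
  qed (use gX fX int in auto)
  also have "\<dots> = 2 * B * r\<^sup>2 * (\<Sum>i<k. \<integral>\<omega>. (X i \<omega>)\<^sup>2 \<partial>M) + e"
    using mom by (subst Bochner_Integration.integral_add) (auto simp: prob_space)
  also have "(\<Sum>i<k. \<integral>\<omega>. (X i \<omega>)\<^sup>2 \<partial>M) \<le> real k * C"
    using sum_bounded_above[of "{..<k}" "\<lambda>i. \<integral>\<omega>. (X i \<omega>)\<^sup>2 \<partial>M" C] mom by simp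
  finally show ?thesis using g(3)[of undefined] by (simp add: mult_left_mono)
qed

text \<open>Levy's continuity theorem in \<open>k\<close> dimensions. The uniform bound on second
  moments plays the role of tightness: it makes the error of replacing coordinates by triangle waves
  uniform in n, after which only trigonometric polynomials remain.\<close>

lemma continuity_theorem_finite_dim:
  fixes X :: "nat \<Rightarrow> nat \<Rightarrow> 'a \<Rightarrow> real" and Z :: "nat \<Rightarrow> 'b \<Rightarrow> real" and g :: "(nat \<Rightarrow> real) \<Rightarrow> real"
  assumes X: "\<forall>\<^sub>F n in sequentially. prob_space (P n) \<and> (\<forall>i. X n i \<in> borel_measurable (P n)) \<and>
      (\<forall>i<k. integrable (P n) (\<lambda>\<omega>. (X n i \<omega>)\<^sup>2) \<and> (\<integral>\<omega>. (X n i \<omega>)\<^sup>2 \<partial>P n) \<le> C)"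
    and Q: "prob_space Q" and Z: "\<And>i. Z i \<in> borel_measurable Q"
    and Z2: "\<And>i. i < k \<Longrightarrow> integrable Q (\<lambda>\<omega>. (Z i \<omega>)\<^sup>2) \<and> (\<integral>\<omega>. (Z i \<omega>)\<^sup>2 \<partial>Q) \<le> C"
    and char: "\<And>u. (\<lambda>n. \<integral>\<omega>. iexp (\<Sum>i<k. u i * X n i \<omega>) \<partial>P n) \<longlonglongrightarrow> (\<integral>\<omega>. iexp (\<Sum>i<k. u i * Z i \<omega>) \<partial>Q)"
    and g: "continuous_on UNIV g" "\<And>x. g x = g (\<lambda>i. if i < k then x i else 0)" "\<And>x. \<bar>g x\<bar> \<le> B"
  shows "(\<lambda>n. \<integral>\<omega>. g (\<lambda>i. X n i \<omega>) \<partial>P n) \<longlonglongrightarrow> (\<integral>\<omega>. g (\<lambda>i. Z i \<omega>) \<partial>Q)"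
proof (rule tendstoI)
  fix e :: real assume e: "e > 0"
  have trig: "(\<lambda>n. \<integral>\<omega>. f (\<lambda>i. X n i \<omega>) \<partial>P n) \<longlonglongrightarrow> (\<integral>\<omega>. f (\<lambda>i. Z i \<omega>) \<partial>Q)" if "trig_poly k f" for f
    using that
  proof induction
    case (cos a u \<theta>)
    have "(\<lambda>n. a * Re (iexp \<theta> * (\<integral>\<omega>. iexp (\<Sum>i<k. u i * X n i \<omega>) \<partial>P n)))
        \<longlonglongrightarrow> a * Re (iexp \<theta> * (\<integral>\<omega>. iexp (\<Sum>i<k. u i * Z i \<omega>) \<partial>Q))"
      by (intro tendsto_intros char)
    moreover have "\<forall>\<^sub>F n in sequentially. a * Re (iexp \<theta> * (\<integral>\<omega>. iexp (\<Sum>i<k. u i * X n i \<omega>) \<partial>P n))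
        = (\<integral>\<omega>. a * cos ((\<Sum>i<k. u i * X n i \<omega>) + \<theta>) \<partial>P n)"
      using X
    proof eventually_elim
      case (elim n)
      then show ?case
        by (intro integral_cos_eq[symmetric] borel_measurable_sum borel_measurable_times borel_measurable_const) auto
    qed
    moreover have "a * Re (iexp \<theta> * (\<integral>\<omega>. iexp (\<Sum>i<k. u i * Z i \<omega>) \<partial>Q))
        = (\<integral>\<omega>. a * cos ((\<Sum>i<k. u i * Z i \<omega>) + \<theta>) \<partial>Q)"
      by (intro integral_cos_eq[symmetric] borel_measurable_sum borel_measurable_times borel_measurable_const Q Z)
    ultimately show ?case using Lim_transform_eventually by force
  next
    case (add f h)
    have "(\<lambda>n. (\<integral>\<omega>. f (\<lambda>i. X n i \<omega>) \<partial>P n) + (\<integral>\<omega>. h (\<lambda>i. X n i \<omega>) \<partial>P n))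
        \<longlonglongrightarrow> (\<integral>\<omega>. f (\<lambda>i. Z i \<omega>) \<partial>Q) + (\<integral>\<omega>. h (\<lambda>i. Z i \<omega>) \<partial>Q)"
      by (intro tendsto_add add.IH)
    moreover have "\<forall>\<^sub>F n in sequentially. (\<integral>\<omega>. f (\<lambda>i. X n i \<omega>) \<partial>P n) + (\<integral>\<omega>. h (\<lambda>i. X n i \<omega>) \<partial>P n)
        = (\<integral>\<omega>. f (\<lambda>i. X n i \<omega>) + h (\<lambda>i. X n i \<omega>) \<partial>P n)"
      using X
    proof eventually_elim
      case (elim n)
      then have n: "prob_space (P n)" "\<And>i. X n i \<in> borel_measurable (P n)" by auto
      show ?case
        by (rule Bochner_Integration.integral_add[OF integrable_trig_poly[OF n(1) add.hyps(1) n(2)]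
            integrable_trig_poly[OF n(1) add.hyps(2) n(2)], symmetric])
    qed
    moreover have "(\<integral>\<omega>. f (\<lambda>i. Z i \<omega>) \<partial>Q) + (\<integral>\<omega>. h (\<lambda>i. Z i \<omega>) \<partial>Q) = (\<integral>\<omega>. f (\<lambda>i. Z i \<omega>) + h (\<lambda>i. Z i \<omega>) \<partial>Q)"
      by (rule Bochner_Integration.integral_add[OF integrable_trig_poly[OF Q add.hyps(1) Z]
          integrable_trig_poly[OF Q add.hyps(2) Z], symmetric])
    ultimately show ?case using Lim_transform_eventually by force
  qed
  \<comment> \<open>The scale \<open>r\<close> is fixed before the polynomial, which depends on it.
    The waves cost less than e / 4 and the polynomial e / 12, together less than e / 3.\<close>
  define D where "D = 2 * B * (real k * C)"
  obtain r where r: "r > 0" "D * r\<^sup>2 < e / 4"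
  proof -
    have "((\<lambda>r. D * r\<^sup>2) \<longlongrightarrow> D * 0\<^sup>2) (at_right 0)" by (intro tendsto_intros)
    then have "\<forall>\<^sub>F r in at_right 0. D * r\<^sup>2 < e / 4" using e by (intro order_tendstoD) auto
    then have "\<forall>\<^sub>F r in at_right 0. 0 < r \<and> D * r\<^sup>2 < e / 4"
      using eventually_at_right_less[of 0] by eventually_elim simp
    then show ?thesis using that eventually_happens'[OF trivial_limit_at_right_real] by blast
  qed
  obtain f where f: "trig_poly k f" "\<And>x. \<bar>g (\<lambda>i. if i < k then arcsin (sin (r * x i)) / r else 0) - f x\<bar> \<le> e / 12"
    using trig_poly_approx[OF g(1) r(1), of "e / 12" k] e by auto
  have bound: "2 * B * r\<^sup>2 * (real k * C) + e / 12 < e / 3"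
    using r(2) by (simp add: D_def mult_ac)
  have "\<forall>\<^sub>F n in sequentially. dist (\<integral>\<omega>. f (\<lambda>i. X n i \<omega>) \<partial>P n) (\<integral>\<omega>. f (\<lambda>i. Z i \<omega>) \<partial>Q) < e / 3"
    using e by (intro tendstoD[OF trig[OF f(1)]]) simp
  then show "\<forall>\<^sub>F n in sequentially. dist (\<integral>\<omega>. g (\<lambda>i. X n i \<omega>) \<partial>P n) (\<integral>\<omega>. g (\<lambda>i. Z i \<omega>) \<partial>Q) < e"
    using X
  proof eventually_elim
    case (elim n)
    have 1: "\<bar>(\<integral>\<omega>. g (\<lambda>i. X n i \<omega>) \<partial>P n) - (\<integral>\<omega>. f (\<lambda>i. X n i \<omega>) \<partial>P n)\<bar> \<le> 2 * B * r\<^sup>2 * (real k * C) + e / 12"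
      using elim by (intro expectation_trig_approx[OF _ _ _ g r(1) f]) auto
    have 2: "\<bar>(\<integral>\<omega>. g (\<lambda>i. Z i \<omega>) \<partial>Q) - (\<integral>\<omega>. f (\<lambda>i. Z i \<omega>) \<partial>Q)\<bar> \<le> 2 * B * r\<^sup>2 * (real k * C) + e / 12"
      by (intro expectation_trig_approx[OF Q Z Z2 g r(1) f])
    show ?case using 1 2 bound elim(1) unfolding dist_real_def by linarith
  qed
qed

section \<open>From edges to components\<close>

lemma edge_clocks_of_process:
  assumes "multiplicative_graph_process P V z G" "finite V" "\<And>i. i \<in> V \<Longrightarrow> 0 \<le> z i"
  obtains T where "edge_clocks P V z T"
    "\<And>t \<omega>. 0 \<le> t \<Longrightarrow> \<omega> \<in> space P \<Longrightarrow> G t \<omega> = {e \<in> all_edges_on V. T e \<omega> \<le> ereal t}"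
proof -
  from assms(1) obtain T where T: "prob_space P" "prob_space.indep_vars P (\<lambda>_. borel) T (all_edges_on V)"
    "\<forall>i\<in>V. \<forall>j\<in>V. i \<noteq> j \<longrightarrow> distr P borel (T {i, j}) = exponential_time (z i * z j)"
    "\<forall>t\<ge>0. \<forall>\<omega>\<in>space P. G t \<omega> = {e \<in> all_edges_on V. T e \<omega> \<le> ereal t}"
    unfolding multiplicative_graph_process_def by blast
  have "edge_clocks P V z T"
    using T assms(2,3) by (simp add: edge_clocks_def edge_clocks_axioms_def)
  then show ?thesis using T(4) that by blast
qed

context edge_clocks
begin

text \<open>Edge by edge, 1 - exp(-x) lies between x - x^2 and x.\<close>

lemma mean_0_bounds:
  assumes t: "0 \<le> t"
  shows "mean 0 t \<le> t * (\<Sum>e\<in>edges. rate e)"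
    and "t * (\<Sum>e\<in>edges. rate e) - t\<^sup>2 * (\<Sum>e\<in>edges. (rate e)\<^sup>2) \<le> mean 0 t"
proof -
  show "mean 0 t \<le> t * (\<Sum>e\<in>edges. rate e)" using mean_le[of 0 t] t by simp
  have "t * rate e - t\<^sup>2 * (rate e)\<^sup>2 \<le> exp (- 0 * rate e) - exp (- t * rate e)" if "e \<in> edges" for e
    using exp_minus_le[of "t * rate e"] t rate_nonneg[OF that] by (simp add: power_mult_distrib)
  then show "t * (\<Sum>e\<in>edges. rate e) - t\<^sup>2 * (\<Sum>e\<in>edges. (rate e)\<^sup>2) \<le> mean 0 t"
    unfolding mean_def sum_distrib_left sum_subtractf[symmetric] by (intro sum_mono)
qed

lemma count_eq_card:
  assumes "\<forall>e\<in>edges. 0 < T e \<omega>"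
  shows "count 0 t \<omega> = real (card (graph t \<omega>))"
proof -
  have "count 0 t \<omega> = (\<Sum>e\<in>edges. of_bool (T e \<omega> \<le> ereal t))"
    unfolding count_def using assms by (intro sum.cong) (auto simp: zero_ereal_def)
  then show ?thesis using finite_edges by (simp add: Int_def)
qed

text \<open>Components plus edges minus vertices lies between 0 and the number of cycle edges, and
  the latter grows with time, so its value at \<open>c\<close> serves for every \<open>t\<close>.
  The sign in front of \<open>fluct\<close> is plus because components are lost where edges are
  gained.\<close>

lemma components_fluct:
  assumes n: "0 < card V" and \<delta>: "\<And>t. t \<in> {0..c} \<Longrightarrow> \<bar>t * real (card V) * a - mean 0 t\<bar> \<le> \<delta>"
  shows "AE \<omega> in M. \<forall>t\<in>{0..c}. \<bar>sqrt (real (card V)) * (real (num_components V (graph t \<omega>)) / real (card V) - (1 - t * a))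
      + fluct (card V) t \<omega>\<bar> \<le> (real (card (cycle_edges (graph c \<omega>))) + \<delta>) / sqrt (real (card V))"
  using AE_T_pos
proof eventually_elim
  case (elim \<omega>)
  show ?case
  proof
    fix t assume t: "t \<in> {0..c}"
    let ?n = "real (card V)"
    have "graph t \<omega> \<subseteq> graph c \<omega>" using t by (auto intro: order_trans)
    then have "card (cycle_edges (graph t \<omega>)) \<le> card (cycle_edges (graph c \<omega>))"
      using finite_edges by (intro card_mono cycle_edges_mono) (auto simp: cycle_edges_def)
    moreover have "card V \<le> num_components V (graph t \<omega>) + card (graph t \<omega>)"
      "num_components V (graph t \<omega>) + card (graph t \<omega>) \<le> card V + card (cycle_edges (graph t \<omega>))"
      by (intro num_components_bounds[OF V]; blast)+
    ultimately have b: "0 \<le> real (num_components V (graph t \<omega>)) + count 0 t \<omega> - ?n"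
      "real (num_components V (graph t \<omega>)) + count 0 t \<omega> - ?n \<le> real (card (cycle_edges (graph c \<omega>)))"
      unfolding count_eq_card[OF elim] by linarith+
    have "sqrt ?n * (real (num_components V (graph t \<omega>)) / ?n - (1 - t * a)) =
        ?n * (real (num_components V (graph t \<omega>)) / ?n - (1 - t * a)) / sqrt ?n"
      by (subst real_div_sqrt[of ?n, symmetric]) simp_all
    also have "\<dots> = (real (num_components V (graph t \<omega>)) - ?n + t * ?n * a) / sqrt ?n"
      using n by (simp add: right_diff_distrib algebra_simps)
    finally have "sqrt ?n * (real (num_components V (graph t \<omega>)) / ?n - (1 - t * a)) + fluct (card V) t \<omega> =
      ((real (num_components V (graph t \<omega>)) + count 0 t \<omega> - ?n) + (t * ?n * a - mean 0 t)) / sqrt ?n"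
      by (simp add: fluct_def add_divide_distrib[symmetric])
    also have "\<bar>\<dots>\<bar> \<le> (real (card (cycle_edges (graph c \<omega>))) + \<delta>) / sqrt ?n"
      unfolding abs_divide abs_of_nonneg[OF real_sqrt_ge_zero[OF of_nat_0_le_iff]]
      using b \<delta>[OF t] by (intro divide_right_mono) (linarith, simp)
    finally show "\<bar>sqrt ?n * (real (num_components V (graph t \<omega>)) / ?n - (1 - t * a)) + fluct (card V) t \<omega>\<bar>
        \<le> (real (card (cycle_edges (graph c \<omega>))) + \<delta>) / sqrt ?n" .
  qed
qed

lemma integrable_cycle_edges: "integrable M (\<lambda>\<omega>. real (card (cycle_edges (graph c \<omega>))))"
proof (rule integrable_const_bound[of _ "real (card edges)"])
  have "(\<lambda>\<omega>. real (card (cycle_edges (graph c \<omega>)))) \<in> borel_measurable M"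
    by (rule measurable_compose[OF measurable_graph[OF order_refl]]) simp
  then show "(\<lambda>\<omega>. real (card (cycle_edges (graph c \<omega>)))) \<in> borel_measurable M" .
  show "AE \<omega> in M. norm (real (card (cycle_edges (graph c \<omega>)))) \<le> real (card edges)"
    using finite_edges by (intro AE_I2) (auto simp: cycle_edges_def intro!: card_mono)
qed

text \<open>The scale \<open>b\<close> and the shift \<open>h\<close> cover both the proportion of
  components and its centred, rescaled version.\<close>

lemma component_path_measurable:
  assumes c: "0 \<le> c" and h: "continuous_on {0..c} h"
    and Y: "\<And>\<omega>. \<omega> \<in> space M \<Longrightarrow> Y \<omega> = (\<lambda>t\<in>{0..c}. b * real (num_components V (graph t \<omega>)) + h t)"
  shows "Y \<in> M \<rightarrow>\<^sub>M borel_of (skorokhod_topology c)"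
proof (rule skorokhod_measurableI[OF c])
  fix \<omega> assume \<omega>: "\<omega> \<in> space M"
  show "Y \<omega> \<in> skorokhod_space c"
    unfolding Y[OF \<omega>] by (rule skorokhod_space_step[OF finite_edges h, of "\<lambda>A. b * real (num_components V A)" "\<lambda>e. T e \<omega>"])
next
  fix t assume t: "t \<in> {0..c}"
  have "(\<lambda>\<omega>. b * real (num_components V (graph t \<omega>)) + h t) \<in> borel_measurable M"
    by (rule measurable_compose[OF measurable_graph[OF order_refl]]) simp
  moreover have "Y \<omega> t = b * real (num_components V (graph t \<omega>)) + h t" if "\<omega> \<in> space M" for \<omega>
    using Y[OF that] t by simp
  ultimately show "(\<lambda>\<omega>. Y \<omega> t) \<in> borel_measurable M"
    by (subst measurable_cong) auto
qed

end

section \<open>Expectations of Lipschitz functions of paths\<close>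

text \<open>Both paths live on the same space, so a Lipschitz function changes by at most
  \<open>L\<close> times their uniform distance. The integrable majorant \<open>U\<close> stands in
  for the supremum over uncountably many times.\<close>

lemma Lipschitz_expectation_diff:
  assumes "prob_space M" and Y: "Y \<in> M \<rightarrow>\<^sub>M borel_of (skorokhod_topology c)"
    and Y': "Y' \<in> M \<rightarrow>\<^sub>M borel_of (skorokhod_topology c)"
    and lip: "\<And>x y. x \<in> skorokhod_space c \<Longrightarrow> y \<in> skorokhod_space c \<Longrightarrow> \<bar>\<phi> x - \<phi> y\<bar> \<le> L * skorokhod_dist c x y"
    and L: "0 \<le> L" and B: "\<And>x. x \<in> skorokhod_space c \<Longrightarrow> \<bar>\<phi> x\<bar> \<le> B"
    and U: "integrable M U" "AE \<omega> in M. \<forall>t\<in>{0..c}. \<bar>Y \<omega> t - Y' \<omega> t\<bar> \<le> U \<omega>" and c: "0 \<le> c"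
  shows "\<bar>(\<integral>\<omega>. \<phi> (Y \<omega>) \<partial>M) - (\<integral>\<omega>. \<phi> (Y' \<omega>) \<partial>M)\<bar> \<le> L * (\<integral>\<omega>. U \<omega> \<partial>M)"
    and "integrable M (\<lambda>\<omega>. \<phi> (Y \<omega>))"
proof -
  interpret prob_space M by fact
  have top: "topspace (skorokhod_topology c) = skorokhod_space c"
    by (simp add: skorokhod_topology_def Metric_space.topspace_mtopology[OF Metric_space_skorokhod])
  have sp: "Y \<omega> \<in> skorokhod_space c" "Y' \<omega> \<in> skorokhod_space c" if "\<omega> \<in> space M" for \<omega>
    using measurable_space[OF Y that] measurable_space[OF Y' that] by (simp_all add: space_borel_of top)
  have "continuous_map (skorokhod_topology c) euclideanreal \<phi>"
    unfolding skorokhod_topology_def by (rule Lipschitz_continuous_map[OF Metric_space_skorokhod L lip])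
  then have m: "\<phi> \<in> borel_measurable (borel_of (skorokhod_topology c))"
    by (rule measurable_continuous_map_borel_of)
  have int: "integrable M (\<lambda>\<omega>. \<phi> (Y \<omega>))" "integrable M (\<lambda>\<omega>. \<phi> (Y' \<omega>))"
    using measurable_compose[OF Y m] measurable_compose[OF Y' m] B sp
    by (auto intro!: integrable_const_bound[of _ B] AE_I2)
  then show "integrable M (\<lambda>\<omega>. \<phi> (Y \<omega>))" by simp
  have "\<bar>(\<integral>\<omega>. \<phi> (Y \<omega>) \<partial>M) - (\<integral>\<omega>. \<phi> (Y' \<omega>) \<partial>M)\<bar> = \<bar>\<integral>\<omega>. \<phi> (Y \<omega>) - \<phi> (Y' \<omega>) \<partial>M\<bar>"
    using int by simp
  also have "\<dots> \<le> (\<integral>\<omega>. \<bar>\<phi> (Y \<omega>) - \<phi> (Y' \<omega>)\<bar> \<partial>M)" by (rule integral_abs_bound)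
  also have "\<dots> \<le> (\<integral>\<omega>. L * U \<omega> \<partial>M)"
  proof (rule integral_mono_AE)
    show "AE \<omega> in M. \<bar>\<phi> (Y \<omega>) - \<phi> (Y' \<omega>)\<bar> \<le> L * U \<omega>"
      using U(2) AE_space
    proof eventually_elim
      case (elim \<omega>)
      have "0 \<le> U \<omega>" using bspec[OF elim(1), of 0] c by simp
      then have "skorokhod_dist c (Y \<omega>) (Y' \<omega>) \<le> U \<omega>"
        using elim sp by (intro skorokhod_dist_le_sup) auto
      then have "L * skorokhod_dist c (Y \<omega>) (Y' \<omega>) \<le> L * U \<omega>" using L by (rule mult_left_mono)
      then show ?case using lip[of "Y \<omega>" "Y' \<omega>"] sp elim by fastforce
    qed
  qed (use int U in auto)
  also have "\<dots> = L * (\<integral>\<omega>. U \<omega> \<partial>M)" by simp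
  finally show "\<bar>(\<integral>\<omega>. \<phi> (Y \<omega>) \<partial>M) - (\<integral>\<omega>. \<phi> (Y' \<omega>) \<partial>M)\<bar> \<le> L * (\<integral>\<omega>. U \<omega> \<partial>M)" .
qed

lemma skorokhod_space_continuous:
  assumes "continuous_on {0..c} h"
  shows "(\<lambda>t\<in>{0..c}. h t) \<in> skorokhod_space c"
  using skorokhod_space_step[of "{} :: nat set" c h "\<lambda>_. 0" "\<lambda>_. 0"] assms by simp

text \<open>For a deterministic limit it is enough that the expected uniform distance vanishes. This
  serves the law of large numbers and also the fluctuation limit on the degenerate interval
  \<open>c = 0\<close>.\<close>

lemma converges_to_constant_path:
  assumes c: "0 \<le> c" and f: "f \<in> skorokhod_space c"
    and Y: "\<forall>\<^sub>F n in sequentially. prob_space (P n) \<and> Y n \<in> P n \<rightarrow>\<^sub>M borel_of (skorokhod_topology c)"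
    and U: "\<forall>\<^sub>F n in sequentially. \<exists>U. integrable (P n) U \<and>
      (AE \<omega> in P n. \<forall>t\<in>{0..c}. \<bar>Y n \<omega> t - f t\<bar> \<le> U \<omega>) \<and> (\<integral>\<omega>. U \<omega> \<partial>P n) \<le> b n" and b: "b \<longlonglongrightarrow> 0"
    and Q: "prob_space Q" and Z: "Z \<in> Q \<rightarrow>\<^sub>M borel_of (skorokhod_topology c)" "AE \<omega> in Q. Z \<omega> = f"
  shows "converges_in_distribution (skorokhod_topology c) P Y Q Z"
  unfolding skorokhod_topology_def
proof (rule converges_in_distribution_LipschitzI[OF Metric_space_skorokhod])
  fix \<phi> :: "(real \<Rightarrow> real) \<Rightarrow> real" and L B :: real
  assume lip: "\<And>x y. x \<in> skorokhod_space c \<Longrightarrow> y \<in> skorokhod_space c \<Longrightarrow> \<bar>\<phi> x - \<phi> y\<bar> \<le> L * skorokhod_dist c x y"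
    and L: "0 \<le> L" and B: "\<And>x. x \<in> skorokhod_space c \<Longrightarrow> \<bar>\<phi> x\<bar> \<le> B"
  interpret Q: prob_space Q by (rule Q)
  have const: "(\<lambda>_. f) \<in> R \<rightarrow>\<^sub>M borel_of (skorokhod_topology c)" for R :: "'z measure"
    using f by (intro skorokhod_measurableI[OF c]) auto
  have "(\<integral>\<omega>. \<phi> (Z \<omega>) \<partial>Q) = (\<integral>\<omega>. \<phi> f \<partial>Q)"
    using Z(2) Lipschitz_expectation_diff(2)[OF Q Z(1) Z(1) lip L B, of "\<lambda>_. 0"] c
    by (intro integral_cong_AE) (auto elim: eventually_mono)
  then have Zf: "(\<integral>\<omega>. \<phi> (Z \<omega>) \<partial>Q) = \<phi> f" by (simp add: Q.prob_space)
  have "\<forall>\<^sub>F n in sequentially. \<bar>(\<integral>\<omega>. \<phi> (Y n \<omega>) \<partial>P n) - \<phi> f\<bar> \<le> L * b n"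
    using Y U
  proof eventually_elim
    case (elim n)
    then interpret P: prob_space "P n" by simp
    from elim obtain U where U: "integrable (P n) U" "AE \<omega> in P n. \<forall>t\<in>{0..c}. \<bar>Y n \<omega> t - f t\<bar> \<le> U \<omega>"
      "(\<integral>\<omega>. U \<omega> \<partial>P n) \<le> b n" by blast
    have "\<bar>(\<integral>\<omega>. \<phi> (Y n \<omega>) \<partial>P n) - (\<integral>\<omega>. \<phi> f \<partial>P n)\<bar> \<le> L * (\<integral>\<omega>. U \<omega> \<partial>P n)"
      using elim by (intro Lipschitz_expectation_diff(1)[OF _ _ const lip L B U(1,2) c]) auto
    also have "\<dots> \<le> L * b n" using L U(3) by (rule mult_left_mono[rotated])
    finally show ?case by (simp add: P.prob_space)
  qed
  then have "(\<lambda>n. (\<integral>\<omega>. \<phi> (Y n \<omega>) \<partial>P n) - \<phi> f) \<longlonglongrightarrow> 0"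
    by (intro Lim_null_comparison[OF _ tendsto_mult_right_zero[OF b, of L]]) simp
  then show "(\<lambda>n. \<integral>\<omega>. \<phi> (Y n \<omega>) \<partial>P n) \<longlonglongrightarrow> (\<integral>\<omega>. \<phi> (Z \<omega>) \<partial>Q)"
    unfolding Zf by (simp add: LIM_zero_iff)
qed (use Y Q Z in \<open>simp_all add: skorokhod_topology_def\<close>)

text \<open>A step path given by its increments, so that a test function of the path becomes a
  function of a finite vector, whose law the characteristic functions control.\<close>

definition sum_path :: "real \<Rightarrow> nat \<Rightarrow> (nat \<Rightarrow> real) \<Rightarrow> real \<Rightarrow> real" where
  "sum_path c m x = grid_path c m (\<lambda>k. \<Sum>i<k. x i)"

lemma sum_path_in_space: "sum_path c m x \<in> skorokhod_space c"
  by (simp add: sum_path_def grid_path_in_space)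

lemma sum_path_dist:
  "skorokhod_dist c (sum_path c m x) (sum_path c m y) \<le> (\<Sum>i<m. \<bar>x i - y i\<bar>)"
proof (rule skorokhod_dist_le_sup[OF sum_path_in_space sum_path_in_space])
  fix t assume "t \<in> {0..c}"
  then have "\<bar>sum_path c m x t - sum_path c m y t\<bar> = \<bar>\<Sum>i<grid_floor c m t. x i - y i\<bar>"
    by (simp add: sum_path_def grid_path_def sum_subtractf)
  also have "\<dots> \<le> (\<Sum>i<grid_floor c m t. \<bar>x i - y i\<bar>)" by (rule sum_abs)
  also have "\<dots> \<le> (\<Sum>i<m. \<bar>x i - y i\<bar>)" using grid_floor_le[of c m t] by (intro sum_mono2) auto
  finally show "\<bar>sum_path c m x t - sum_path c m y t\<bar> \<le> (\<Sum>i<m. \<bar>x i - y i\<bar>)" .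
qed (simp add: sum_nonneg)

lemma sum_path_cong: "(\<And>i. i < m \<Longrightarrow> x i = y i) \<Longrightarrow> sum_path c m x = sum_path c m y"
  unfolding sum_path_def by (intro grid_path_cong sum.cong) auto

text \<open>Continuity in the product topology, the form in which
  \<open>continuity_theorem_finite_dim\<close> takes its test functions.\<close>

lemma continuous_on_Lipschitz_sum_path:
  assumes lip: "\<And>x y. x \<in> skorokhod_space c \<Longrightarrow> y \<in> skorokhod_space c \<Longrightarrow> \<bar>\<phi> x - \<phi> y\<bar> \<le> L * skorokhod_dist c x y"
    and L: "0 \<le> L"
  shows "continuous_on UNIV (\<lambda>x. \<phi> (sum_path c m x) :: real)"
  unfolding continuous_on_def
proof (intro ballI)
  fix x :: "nat \<Rightarrow> real"
  have "((\<lambda>y. L * (\<Sum>i<m. \<bar>y i - x i\<bar>)) \<longlongrightarrow> L * (\<Sum>i<m. \<bar>x i - x i\<bar>)) (at x)"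
    by (intro tendsto_intros) (metis continuous_on_product_coordinates continuous_on_def UNIV_I)
  then have lim: "((\<lambda>y. L * (\<Sum>i<m. \<bar>y i - x i\<bar>)) \<longlongrightarrow> 0) (at x)" by simp
  have "\<forall>\<^sub>F y in at x. \<bar>\<phi> (sum_path c m y) - \<phi> (sum_path c m x)\<bar> \<le> L * (\<Sum>i<m. \<bar>y i - x i\<bar>)"
  proof (rule always_eventually, rule allI)
    fix y
    show "\<bar>\<phi> (sum_path c m y) - \<phi> (sum_path c m x)\<bar> \<le> L * (\<Sum>i<m. \<bar>y i - x i\<bar>)"
      using lip[OF sum_path_in_space sum_path_in_space, of m y m x] mult_left_mono[OF sum_path_dist L, of c m y x] by linarith
  qed
  then have "((\<lambda>y. \<phi> (sum_path c m y) - \<phi> (sum_path c m x)) \<longlongrightarrow> 0) (at x)"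
    by (intro Lim_null_comparison[OF _ lim]) simp
  then show "((\<lambda>y. \<phi> (sum_path c m y)) \<longlongrightarrow> \<phi> (sum_path c m x)) (at x within UNIV)"
    by (simp add: LIM_zero_iff)
qed

lemma sum_path_measurable:
  assumes "0 \<le> c" "\<And>i. X i \<in> borel_measurable M"
  shows "(\<lambda>\<omega>. sum_path c m (\<lambda>i. X i \<omega>)) \<in> M \<rightarrow>\<^sub>M borel_of (skorokhod_topology c)"
proof (rule skorokhod_measurableI[OF assms(1) sum_path_in_space])
  fix t assume "t \<in> {0..c}"
  then show "(\<lambda>\<omega>. sum_path c m (\<lambda>i. X i \<omega>) t) \<in> borel_measurable M"
    unfolding sum_path_def grid_path_def using assms(2) by simp
qed

lemma sum_path_telescope:
  "sum_path c m (\<lambda>i. f (Suc i) - f i) = grid_path c m (\<lambda>k. f k - f 0)"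
  by (simp add: sum_path_def sum_lessThan_telescope)

section \<open>Brownian motion along a grid\<close>

lemma (in prob_space) normal_iexp:
  assumes \<sigma>: "0 < \<sigma>" and D: "distributed M lborel X (normal_density 0 \<sigma>)"
  shows "char (distr M borel X) u = complex_of_real (exp (- (u\<^sup>2 * \<sigma>\<^sup>2 / 2)))"
    and "integrable M (\<lambda>\<omega>. (X \<omega>)\<^sup>2)" and "expectation (\<lambda>\<omega>. (X \<omega>)\<^sup>2) = \<sigma>\<^sup>2"
proof -
  have X[measurable]: "X \<in> borel_measurable M" using distributed_measurable[OF D] by simp
  have "distributed M lborel (\<lambda>x. X x / \<sigma>) std_normal_density"
    using normal_standard_normal_convert[OF \<sigma>, of X 0] D by simp
  then have std: "distr M lborel (\<lambda>x. X x / \<sigma>) = std_normal_distribution"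
    by (simp add: distributed_def)
  have "char (distr M borel X) u = expectation (\<lambda>\<omega>. iexp (u * X \<omega>))"
    unfolding char_def by (subst integral_distr) auto
  also have "\<dots> = expectation (\<lambda>\<omega>. iexp ((u * \<sigma>) * (X \<omega> / \<sigma>)))" using \<sigma> by simp
  also have "\<dots> = char (distr M lborel (\<lambda>x. X x / \<sigma>)) (u * \<sigma>)"
    unfolding char_def by (subst integral_distr) auto
  also have "\<dots> = complex_of_real (exp (- (u\<^sup>2 * \<sigma>\<^sup>2 / 2)))"
    unfolding std char_std_normal_distribution by (simp add: power_mult_distrib)
  finally show "char (distr M borel X) u = complex_of_real (exp (- (u\<^sup>2 * \<sigma>\<^sup>2 / 2)))" .
  show "integrable M (\<lambda>\<omega>. (X \<omega>)\<^sup>2)"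
    using distributed_integrable[OF D, of "\<lambda>x. x\<^sup>2"] integrable_normal_moment[OF \<sigma>, of 0 2] by simp
  show "expectation (\<lambda>\<omega>. (X \<omega>)\<^sup>2) = \<sigma>\<^sup>2"
    using normal_distributed_variance[OF \<sigma> D] normal_distributed_expectation[OF \<sigma> D] by simp
qed

lemma brownian_increments:
  assumes B: "standard_brownian_motion Q B" and h: "0 < h"
  defines "Z \<equiv> \<lambda>i \<omega>. B (h * real (Suc i)) \<omega> - B (h * real i) \<omega>"
  shows "Z i \<in> borel_measurable Q" "integrable Q (\<lambda>\<omega>. (Z i \<omega>)\<^sup>2)" "(\<integral>\<omega>. (Z i \<omega>)\<^sup>2 \<partial>Q) = h"
    and "(\<integral>\<omega>. iexp (\<Sum>i<k. u i * Z i \<omega>) \<partial>Q) = complex_of_real (exp (- ((\<Sum>i<k. (u i)\<^sup>2 * h) / 2)))"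
proof -
  interpret prob_space Q using B by (simp add: standard_brownian_motion_def)
  have "B t \<in> borel_measurable Q" if "0 \<le> t" for t using B that by (simp add: standard_brownian_motion_def)
  then have Zm[measurable]: "Z i \<in> borel_measurable Q" for i using h by (simp add: Z_def)
  have D: "distributed Q lborel (Z i) (normal_density 0 (sqrt h))" for i
  proof -
    have "distributed Q lborel (\<lambda>\<omega>. B t \<omega> - B s \<omega>) (normal_density 0 (sqrt (t - s)))" if "0 \<le> s" "s < t" for s t
      using B that by (simp add: standard_brownian_motion_def)
    from this[of "h * real i" "h * real (Suc i)"] show ?thesis
      using h by (simp add: Z_def algebra_simps)
  qed
  have sh: "0 < sqrt h" using h by simp
  show "Z i \<in> borel_measurable Q" by (rule Zm)
  show "integrable Q (\<lambda>\<omega>. (Z i \<omega>)\<^sup>2)" by (rule normal_iexp(2)[OF sh D])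
  show "(\<integral>\<omega>. (Z i \<omega>)\<^sup>2 \<partial>Q) = h" using normal_iexp(3)[OF sh D] h by simp
  have "indep_vars (\<lambda>_. borel) (\<lambda>i \<omega>. B (h * real (Suc i)) \<omega> - B (h * real i) \<omega>) {..<k}"
  proof -
    have "\<forall>k (\<tau> :: nat \<Rightarrow> real). 0 \<le> \<tau> 0 \<and> (\<forall>i<k. \<tau> i < \<tau> (Suc i)) \<longrightarrow>
        indep_vars (\<lambda>_. borel) (\<lambda>i \<omega>. B (\<tau> (Suc i)) \<omega> - B (\<tau> i) \<omega>) {..<k}"
      using B[unfolded standard_brownian_motion_def] by (elim conjE)
    from this[rule_format, of "\<lambda>i. h * real i" k] show ?thesis using h by simp
  qed
  then have "indep_vars (\<lambda>_. borel) Z {..<k}" by (simp add: Z_def)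
  from indep_vars_compose2[OF this, of "\<lambda>i x. u i * x" "\<lambda>_. borel"]
  have ind: "indep_vars (\<lambda>_. borel) (\<lambda>i \<omega>. u i * Z i \<omega>) {..<k}" by simp
  have "(\<integral>\<omega>. iexp (\<Sum>i<k. u i * Z i \<omega>) \<partial>Q) = char (distr Q borel (\<lambda>\<omega>. \<Sum>i<k. u i * Z i \<omega>)) 1"
    unfolding char_def by (subst integral_distr) auto
  also have "\<dots> = (\<Prod>i<k. char (distr Q borel (\<lambda>\<omega>. u i * Z i \<omega>)) 1)" by (rule char_distr_sum[OF ind])
  also have "\<dots> = (\<Prod>i<k. char (distr Q borel (Z i)) (u i))"
  proof (rule prod.cong[OF refl])
    fix i
    have "char (distr Q borel (\<lambda>\<omega>. u i * Z i \<omega>)) 1 = (\<integral>\<omega>. iexp (u i * Z i \<omega>) \<partial>Q)"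
      unfolding char_def by (subst integral_distr) auto
    also have "\<dots> = char (distr Q borel (Z i)) (u i)"
      unfolding char_def by (subst integral_distr) auto
    finally show "char (distr Q borel (\<lambda>\<omega>. u i * Z i \<omega>)) 1 = char (distr Q borel (Z i)) (u i)" .
  qed
  also have "\<dots> = (\<Prod>i<k. complex_of_real (exp (- ((u i)\<^sup>2 * h / 2))))"
    using normal_iexp(1)[OF sh D] h by simp
  also have "\<dots> = complex_of_real (exp (- ((\<Sum>i<k. (u i)\<^sup>2 * h) / 2)))"
    by (simp add: exp_sum[symmetric] sum_negf sum_divide_distrib of_real_prod[symmetric] del: of_real_exp)
  finally show "(\<integral>\<omega>. iexp (\<Sum>i<k. u i * Z i \<omega>) \<partial>Q) = complex_of_real (exp (- ((\<Sum>i<k. (u i)\<^sup>2 * h) / 2)))" .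
qed

lemma brownian_path:
  assumes B: "standard_brownian_motion Q B" and a: "0 \<le> a" and c: "0 \<le> c"
  shows "\<omega> \<in> space Q \<Longrightarrow> (\<lambda>t\<in>{0..c}. B (t * a) \<omega>) \<in> skorokhod_space c"
    and "(\<lambda>\<omega>. \<lambda>t\<in>{0..c}. B (t * a) \<omega>) \<in> Q \<rightarrow>\<^sub>M borel_of (skorokhod_topology c)"
proof -
  show sp: "(\<lambda>t\<in>{0..c}. B (t * a) \<omega>) \<in> skorokhod_space c" if "\<omega> \<in> space Q" for \<omega>
  proof (rule skorokhod_space_continuous)
    have "continuous_on {0..} (\<lambda>t. B t \<omega>)" using B that by (simp add: standard_brownian_motion_def)
    then show "continuous_on {0..c} (\<lambda>t. B (t * a) \<omega>)"
      by (rule continuous_on_compose2) (use a in \<open>auto intro!: continuous_intros\<close>)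
  qed
  show "(\<lambda>\<omega>. \<lambda>t\<in>{0..c}. B (t * a) \<omega>) \<in> Q \<rightarrow>\<^sub>M borel_of (skorokhod_topology c)"
  proof (rule skorokhod_measurableI[OF c sp])
    fix t assume "t \<in> {0..c}"
    then show "(\<lambda>\<omega>. (\<lambda>t\<in>{0..c}. B (t * a) \<omega>) t) \<in> borel_measurable Q"
      using B a by (simp add: standard_brownian_motion_def)
  qed
qed

text \<open>Summing the increments restores the Brownian path at the grid points up to the value
  \<open>B 0\<close>, which vanishes almost surely. Pathwise convergence is then
  \<open>grid_path_tendsto\<close>, and dominated convergence passes to expectations.\<close>

lemma brownian_sum_path_tendsto:
  assumes B: "standard_brownian_motion Q B" and a: "0 < a" and c: "0 < c"
    and lip: "\<And>x y. x \<in> skorokhod_space c \<Longrightarrow> y \<in> skorokhod_space c \<Longrightarrow> \<bar>\<phi> x - \<phi> y\<bar> \<le> L * skorokhod_dist c x y"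
    and L: "0 \<le> L" and bd: "\<And>x. x \<in> skorokhod_space c \<Longrightarrow> \<bar>\<phi> x\<bar> \<le> D"
  defines "Z \<equiv> \<lambda>m i \<omega>. B (a * c / 2 ^ m * real (Suc i)) \<omega> - B (a * c / 2 ^ m * real i) \<omega>"
  shows "(\<lambda>m. \<integral>\<omega>. \<phi> (sum_path c (2 ^ m) (\<lambda>i. Z m i \<omega>)) \<partial>Q) \<longlonglongrightarrow> (\<integral>\<omega>. \<phi> (\<lambda>t\<in>{0..c}. B (t * a) \<omega>) \<partial>Q)"
proof -
  interpret prob_space Q using B by (simp add: standard_brownian_motion_def)
  have cont: "\<phi> \<in> borel_measurable (borel_of (skorokhod_topology c))"
    unfolding skorokhod_topology_def
    by (intro measurable_continuous_map_borel_of Lipschitz_continuous_map[OF Metric_space_skorokhod L lip])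
  have c0: "0 \<le> c" and a0: "0 \<le> a" using a c by auto
  note path = brownian_path[OF B a0 c0]
  have Zm: "Z m i \<in> borel_measurable Q" for m i
    unfolding Z_def using brownian_increments(1)[OF B, of "a * c / 2 ^ m" i] a c by simp
  have B0: "AE \<omega> in Q. B 0 \<omega> = 0" using B by (simp add: standard_brownian_motion_def)
  show ?thesis
  proof (rule integral_dominated_convergence[where w = "\<lambda>_. D"])
    show "(\<lambda>\<omega>. \<phi> (\<lambda>t\<in>{0..c}. B (t * a) \<omega>)) \<in> borel_measurable Q"
      by (rule measurable_compose[OF path(2) cont])
    show "(\<lambda>\<omega>. \<phi> (sum_path c (2 ^ m) (\<lambda>i. Z m i \<omega>))) \<in> borel_measurable Q" for m
      by (rule measurable_compose[OF sum_path_measurable[OF c0 Zm] cont])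
    show "AE \<omega> in Q. norm (\<phi> (sum_path c (2 ^ m) (\<lambda>i. Z m i \<omega>))) \<le> D" for m
      using bd[OF sum_path_in_space] by simp
    show "AE \<omega> in Q. (\<lambda>m. \<phi> (sum_path c (2 ^ m) (\<lambda>i. Z m i \<omega>))) \<longlonglongrightarrow> \<phi> (\<lambda>t\<in>{0..c}. B (t * a) \<omega>)"
      using B0 AE_space
    proof eventually_elim
      case (elim \<omega>)
      define f where "f = (\<lambda>t\<in>{0..c}. B (t * a) \<omega>)"
      have f: "f \<in> skorokhod_space c" unfolding f_def by (rule path(1)[OF elim(2)])
      have eq: "sum_path c (2 ^ m) (\<lambda>i. Z m i \<omega>) = grid_path c (2 ^ m) (\<lambda>k. f (real k * c / real (2 ^ m)))" for m
      proof -
        have "sum_path c (2 ^ m) (\<lambda>i. Z m i \<omega>) = grid_path c (2 ^ m) (\<lambda>k. B (a * c / 2 ^ m * real k) \<omega> - B (a * c / 2 ^ m * real 0) \<omega>)"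
          unfolding Z_def by (rule sum_path_telescope)
        also have "\<dots> = grid_path c (2 ^ m) (\<lambda>k. f (real k * c / real (2 ^ m)))"
        proof (rule grid_path_cong)
          fix k :: nat assume "k \<le> 2 ^ m"
          then have "real k \<le> 2 ^ m" by (metis of_nat_le_iff of_nat_numeral of_nat_power)
          then have "real k * c / 2 ^ m \<in> {0..c}" using c by (simp add: field_simps)
          then show "B (a * c / 2 ^ m * real k) \<omega> - B (a * c / 2 ^ m * real 0) \<omega> = f (real k * c / real (2 ^ m))"
            using elim(1) by (simp add: f_def mult_ac)
        qed
        finally show ?thesis .
      qed
      have sub: "filterlim (\<lambda>m. 2 ^ m :: nat) sequentially sequentially"
        by (rule filterlim_subseq) (simp add: strict_mono_def)
      have "(\<lambda>m. skorokhod_dist c (sum_path c (2 ^ m) (\<lambda>i. Z m i \<omega>)) f) \<longlonglongrightarrow> 0"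
        unfolding eq by (rule filterlim_compose[OF grid_path_tendsto[OF f c0] sub])
      from tendsto_mult_right_zero[OF this, of L]
      have "(\<lambda>m. \<phi> (sum_path c (2 ^ m) (\<lambda>i. Z m i \<omega>)) - \<phi> f) \<longlonglongrightarrow> 0"
        by (rule Lim_null_comparison[rotated]) (simp add: lip[OF sum_path_in_space f])
      then show ?case unfolding f_def[symmetric] by (simp add: LIM_zero_iff)
    qed
  qed simp
qed

section \<open>Error bounds for a single graph\<close>

context edge_clocks
begin

lemma fluct_0: "fluct n 0 \<omega> = 0"
proof -
  have "count 0 0 \<omega> = 0"
    unfolding count_def by (intro sum.neutral) (auto simp: zero_ereal_def[symmetric] not_le)
  then show ?thesis by (simp add: fluct_def mean_def)
qed

text \<open>\<open>a\<close> is the limiting number of edges per vertex and unit of time, E[W] / 2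
  in the application. \<open>S\<close> bounds the sum of the squared masses and keeps
  \<open>c\<close> below the critical time.\<close>

context
  fixes a c S :: real
  assumes a: "0 \<le> a" and c: "0 \<le> c" and n: "0 < card V"
    and rates: "(\<Sum>e\<in>edges. rate e) \<le> real (card V) * a"
    and squares: "(\<Sum>i\<in>V. (z i)\<^sup>2) \<le> S" and subcritical: "c * S < 1"
begin

text \<open>The error of replacing \<open>mean 0 t\<close> by its linear limit has two sources: the
  deficit of the total rate, and the second-order term of 1 - exp(-t rate) summed over the
  edges.\<close>

abbreviation mean_error :: real where
  "mean_error \<equiv> c * (real (card V) * a - (\<Sum>e\<in>edges. rate e)) + c\<^sup>2 * S\<^sup>2"

lemma squares_nonneg: "0 \<le> (\<Sum>i\<in>V. (z i)\<^sup>2)"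
  by (simp add: sum_nonneg)

text \<open>No single rate is bounded here; the product form alone turns the sum over edges into at
  most half the square of the sum of the squared masses.\<close>

lemma sum_rate_squares: "(\<Sum>e\<in>edges. (rate e)\<^sup>2) \<le> S\<^sup>2"
proof -
  have "(\<Sum>e\<in>edges. (rate e)\<^sup>2) = (\<Sum>e\<in>edges. prod (\<lambda>i. (z i)\<^sup>2) e)"
    by (simp add: prod_power_distrib)
  moreover have "0 \<le> (\<Sum>i\<in>V. ((z i)\<^sup>2)\<^sup>2)" by (simp add: sum_nonneg)
  moreover have "(\<Sum>i\<in>V. (z i)\<^sup>2)\<^sup>2 \<le> S\<^sup>2" using squares squares_nonneg by (intro power_mono)
  moreover have "0 \<le> S\<^sup>2" by simp
  ultimately show ?thesis using sum_all_edges_on_prod[OF V, of "\<lambda>i. (z i)\<^sup>2"] by linarith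
qed

lemma mean_close:
  assumes t: "t \<in> {0..c}"
  shows "\<bar>t * real (card V) * a - mean 0 t\<bar> \<le> mean_error"
proof -
  let ?\<Lambda> = "\<Sum>e\<in>edges. rate e"
  have t0: "0 \<le> t" "t \<le> c" using t by auto
  have "t * (real (card V) * a - ?\<Lambda>) \<le> c * (real (card V) * a - ?\<Lambda>)"
    "0 \<le> t * (real (card V) * a - ?\<Lambda>)"
    using t0 rates by (auto intro: mult_right_mono)
  moreover have "t\<^sup>2 * (\<Sum>e\<in>edges. (rate e)\<^sup>2) \<le> c\<^sup>2 * S\<^sup>2"
    using t0 sum_rate_squares by (intro mult_mono power_mono) (auto intro: sum_nonneg)
  ultimately show ?thesis
    using mean_0_bounds[OF t0(1)] unfolding right_diff_distrib abs_le_iff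
    by (simp add: mult.assoc)
qed

text \<open>The bound on cycle edges increases with the sum of the squared masses, which may
  therefore be replaced by \<open>S\<close>.\<close>

lemma components_fluct_bound:
  obtains U where "integrable M U"
    "AE \<omega> in M. \<forall>t\<in>{0..c}. \<bar>sqrt (real (card V)) * (real (num_components V (graph t \<omega>)) / real (card V) - (1 - t * a))
      + fluct (card V) t \<omega>\<bar> \<le> U \<omega>"
    "expectation U \<le> (c ^ 3 * S ^ 3 / (1 - c * S) + mean_error) / sqrt (real (card V))"
proof (rule that[OF _ components_fluct[OF n mean_close]])
  let ?\<sigma> = "\<Sum>i\<in>V. (z i)\<^sup>2"
  show "integrable M (\<lambda>\<omega>. (real (card (cycle_edges (graph c \<omega>))) + mean_error) / sqrt (real (card V)))"
    using integrable_cycle_edges by simp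
  have \<sigma>: "c * ?\<sigma> \<le> c * S" using c squares by (rule mult_left_mono[rotated])
  then have "expectation (\<lambda>\<omega>. real (card (cycle_edges (graph c \<omega>)))) \<le> c ^ 3 * ?\<sigma> ^ 3 / (1 - c * ?\<sigma>)"
    using subcritical by (intro expectation_cycle_edges c) simp
  also have "\<dots> \<le> c ^ 3 * S ^ 3 / (1 - c * S)"
  proof (rule frac_le)
    show "0 \<le> c ^ 3 * S ^ 3" using c squares squares_nonneg by simp
    show "c ^ 3 * ?\<sigma> ^ 3 \<le> c ^ 3 * S ^ 3"
      using c squares squares_nonneg by (intro mult_left_mono power_mono) auto
  qed (use \<sigma> subcritical in auto)
  finally have "expectation (\<lambda>\<omega>. real (card (cycle_edges (graph c \<omega>)))) + mean_error
      \<le> c ^ 3 * S ^ 3 / (1 - c * S) + mean_error" by simp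
  then show "expectation (\<lambda>\<omega>. (real (card (cycle_edges (graph c \<omega>))) + mean_error) / sqrt (real (card V)))
      \<le> (c ^ 3 * S ^ 3 / (1 - c * S) + mean_error) / sqrt (real (card V))"
    using integrable_cycle_edges by (simp add: prob_space divide_right_mono)
qed

text \<open>In the application this bounds the expected supremum by a constant, which after division
  by sqrt n gives the law of large numbers. The chaining starts at level 0, so only the value at
  \<open>c\<close> remains, and its second moment controls it.\<close>

lemma components_bound:
  obtains U where "integrable M U"
    "AE \<omega> in M. \<forall>t\<in>{0..c}. \<bar>sqrt (real (card V)) * (real (num_components V (graph t \<omega>)) / real (card V) - (1 - t * a))\<bar> \<le> U \<omega>"
    "expectation U \<le> (c ^ 3 * S ^ 3 / (1 - c * S) + mean_error) / sqrt (real (card V))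
      + (11 * (1 + (a * c + 3 * (a * c)\<^sup>2)) + 2 * a * c / sqrt (real (card V)) + (1 + a * c))"
proof -
  let ?n = "card V"
  let ?Y = "\<lambda>t \<omega>. sqrt (real ?n) * (real (num_components V (graph t \<omega>)) / real ?n - (1 - t * a))"
  obtain U1 where U1: "integrable M U1" "AE \<omega> in M. \<forall>t\<in>{0..c}. \<bar>?Y t \<omega> + fluct ?n t \<omega>\<bar> \<le> U1 \<omega>"
    "expectation U1 \<le> (c ^ 3 * S ^ 3 / (1 - c * S) + mean_error) / sqrt (real ?n)"
    using components_fluct_bound by blast
  obtain U2 where U2: "integrable M U2" "\<And>\<omega> t. t \<in> {0..c} \<Longrightarrow> \<bar>fluct ?n t \<omega>\<bar> \<le> U2 \<omega>"
    "expectation U2 \<le> 11 * (1 + (a * c + 3 * (a * c)\<^sup>2)) + 2 * a * c / sqrt (real ?n) + (1 + a * c)"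
  proof (cases "c = 0")
    case True
    then show ?thesis using fluct_0 by (intro that[of "\<lambda>_. 0"]) auto
  next
    case False
    then have c0: "0 < c" using c by simp
    obtain U where U: "integrable M U"
      "\<And>\<omega> t. t \<in> {0..c} \<Longrightarrow> \<bar>fluct ?n t \<omega> - grid_path c (2 ^ 0) (\<lambda>k. fluct ?n (real k * c / 2 ^ 0) \<omega>) t\<bar> \<le> U \<omega>"
      "expectation U \<le> 11 * (1 + (a * c + 3 * (a * c)\<^sup>2)) * (9 / 10) ^ 0 + 2 * a * c / sqrt (real ?n)"
      using fluct_modulus[OF n c0 a rates, of 0] n by auto
    have sq: "(fluct ?n c \<omega>)\<^sup>2 = (count 0 c \<omega> - mean 0 c) ^ 2 / real ?n" for \<omega>
      by (simp add: fluct_def power_divide)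
    have int: "integrable M (\<lambda>\<omega>. (fluct ?n c \<omega>)\<^sup>2)" unfolding sq using integrable_count_power by simp
    have Esq: "expectation (\<lambda>\<omega>. (fluct ?n c \<omega>)\<^sup>2) \<le> a * c"
    proof -
      have "expectation (\<lambda>\<omega>. (fluct ?n c \<omega>)\<^sup>2) \<le> (c - 0) * (\<Sum>e\<in>edges. rate e) / real ?n"
        unfolding sq using count_moments(1)[of 0 c] c by (simp add: divide_right_mono)
      also have "\<dots> \<le> c * (real ?n * a) / real ?n"
        using rates c by (intro divide_right_mono) (auto intro: mult_left_mono)
      finally show ?thesis using n by (simp add: mult.commute)
    qed
    show ?thesis
    proof (rule that[of "\<lambda>\<omega>. U \<omega> + (1 + (fluct ?n c \<omega>)\<^sup>2)"])
      show "integrable M (\<lambda>\<omega>. U \<omega> + (1 + (fluct ?n c \<omega>)\<^sup>2))" using U int by simp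
      show "expectation (\<lambda>\<omega>. U \<omega> + (1 + (fluct ?n c \<omega>)\<^sup>2))
          \<le> 11 * (1 + (a * c + 3 * (a * c)\<^sup>2)) + 2 * a * c / sqrt (real ?n) + (1 + a * c)"
        using U int Esq by (simp add: prob_space)
      fix \<omega> t assume t: "t \<in> {0..c}"
      \<comment> \<open>At level 0 the grid path takes just two values: the one at time 0, which
        vanishes, and the one at time \<open>c\<close>.\<close>
      have "grid_floor c 1 t \<le> 1" by (rule grid_floor_le)
      then have "grid_floor c 1 t = 0 \<or> grid_floor c 1 t = 1" by linarith
      then have "\<bar>grid_path c (2 ^ 0) (\<lambda>k. fluct ?n (real k * c / 2 ^ 0) \<omega>) t\<bar> \<le> \<bar>fluct ?n c \<omega>\<bar>"
        using t fluct_0 by (auto simp: grid_path_def)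
      also have "\<bar>fluct ?n c \<omega>\<bar> \<le> 1 + (fluct ?n c \<omega>)\<^sup>2"
      proof -
        have "0 \<le> (\<bar>fluct ?n c \<omega>\<bar> - 1)\<^sup>2" by simp
        then have "2 * \<bar>fluct ?n c \<omega>\<bar> \<le> 1 + (fluct ?n c \<omega>)\<^sup>2" by (simp add: power2_diff)
        then show ?thesis by simp
      qed
      finally show "\<bar>fluct ?n t \<omega>\<bar> \<le> U \<omega> + (1 + (fluct ?n c \<omega>)\<^sup>2)" using U(2)[OF t, of \<omega>] by linarith
    qed
  qed
  show ?thesis
  proof (rule that[of "\<lambda>\<omega>. U1 \<omega> + U2 \<omega>"])
    show "AE \<omega> in M. \<forall>t\<in>{0..c}. \<bar>?Y t \<omega>\<bar> \<le> U1 \<omega> + U2 \<omega>"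
      using U1(2)
    proof eventually_elim
      case (elim \<omega>)
      show ?case
      proof
        fix t assume "t \<in> {0..c}"
        then show "\<bar>?Y t \<omega>\<bar> \<le> U1 \<omega> + U2 \<omega>" using bspec[OF elim] U2(2)[of t \<omega>] by force
      qed
    qed
  qed (use U1 U2 in auto)
qed

text \<open>The increments \<open>X\<close> carry a minus sign because the component path follows
  minus the edge fluctuation. In the application all terms of the bound vanish for large n except
  the one with (9 / 10)^m.\<close>

lemma components_sum_path_bound:
  assumes c0: "0 < c" and m: "2 ^ m \<le> card V"
  defines "X \<equiv> \<lambda>i \<omega>. - ((count (real i * c / 2 ^ m) (real (Suc i) * c / 2 ^ m) \<omega>
      - mean (real i * c / 2 ^ m) (real (Suc i) * c / 2 ^ m)) / sqrt (real (card V)))"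
  obtains U where "integrable M U"
    "AE \<omega> in M. \<forall>t\<in>{0..c}. \<bar>sqrt (real (card V)) * (real (num_components V (graph t \<omega>)) / real (card V) - (1 - t * a))
      - sum_path c (2 ^ m) (\<lambda>i. X i \<omega>) t\<bar> \<le> U \<omega>"
    "expectation U \<le> (c ^ 3 * S ^ 3 / (1 - c * S) + mean_error) / sqrt (real (card V))
      + (11 * (1 + (a * c + 3 * (a * c)\<^sup>2)) * (9 / 10) ^ m + 2 * a * c / sqrt (real (card V)))"
proof -
  let ?n = "card V"
  let ?Y = "\<lambda>t \<omega>. sqrt (real ?n) * (real (num_components V (graph t \<omega>)) / real ?n - (1 - t * a))"
  obtain U1 where U1: "integrable M U1" "AE \<omega> in M. \<forall>t\<in>{0..c}. \<bar>?Y t \<omega> + fluct ?n t \<omega>\<bar> \<le> U1 \<omega>"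
    "expectation U1 \<le> (c ^ 3 * S ^ 3 / (1 - c * S) + mean_error) / sqrt (real ?n)"
    using components_fluct_bound by blast
  obtain U2 where U2: "integrable M U2"
    "\<And>\<omega> t. t \<in> {0..c} \<Longrightarrow> \<bar>fluct ?n t \<omega> - grid_path c (2 ^ m) (\<lambda>k. fluct ?n (real k * c / 2 ^ m) \<omega>) t\<bar> \<le> U2 \<omega>"
    "expectation U2 \<le> 11 * (1 + (a * c + 3 * (a * c)\<^sup>2)) * (9 / 10) ^ m + 2 * a * c / sqrt (real ?n)"
    using fluct_modulus[OF n c0 a rates m] by blast
  have X: "X i \<omega> = - fluct ?n (real (Suc i) * c / 2 ^ m) \<omega> - - fluct ?n (real i * c / 2 ^ m) \<omega>" for i \<omega>
  proof -
    have "0 \<le> real i * c / 2 ^ m" "real i * c / 2 ^ m \<le> real (Suc i) * c / 2 ^ m"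
      using c by (auto intro!: divide_right_mono mult_right_mono)
    from fluct_diff[OF this, of ?n \<omega>] show ?thesis by (simp add: X_def)
  qed
  have path: "sum_path c (2 ^ m) (\<lambda>i. X i \<omega>) t = - grid_path c (2 ^ m) (\<lambda>k. fluct ?n (real k * c / 2 ^ m) \<omega>) t"
    if "t \<in> {0..c}" for \<omega> t
  proof -
    have "sum_path c (2 ^ m) (\<lambda>i. X i \<omega>) = grid_path c (2 ^ m)
        (\<lambda>k. - fluct ?n (real k * c / 2 ^ m) \<omega> - - fluct ?n (real 0 * c / 2 ^ m) \<omega>)"
      unfolding X by (rule sum_path_telescope)
    then show ?thesis using that fluct_0 by (simp add: grid_path_def)
  qed
  show ?thesis
  proof (rule that[of "\<lambda>\<omega>. U1 \<omega> + U2 \<omega>"])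
    show "AE \<omega> in M. \<forall>t\<in>{0..c}. \<bar>?Y t \<omega> - sum_path c (2 ^ m) (\<lambda>i. X i \<omega>) t\<bar> \<le> U1 \<omega> + U2 \<omega>"
      using U1(2)
    proof eventually_elim
      case (elim \<omega>)
      show ?case
      proof
        fix t assume "t \<in> {0..c}"
        then show "\<bar>?Y t \<omega> - sum_path c (2 ^ m) (\<lambda>i. X i \<omega>) t\<bar> \<le> U1 \<omega> + U2 \<omega>"
          using bspec[OF elim, of t] U2(2)[of t \<omega>] path[of t \<omega>] by linarith
      qed
    qed
  qed (use U1 U2 in auto)
qed

end

end

section \<open>The limit theorems\<close>

text \<open>Stated for arbitrary masses: what matters is the total rate up to o(sqrt n), a bound on
  the squared masses, and subcriticality. For the fluctuations n tends to infinity while the number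
  2^m of increments is held fixed, and m tends to infinity only afterwards.\<close>

lemma component_limits:
  fixes P :: "nat \<Rightarrow> 'b measure" and T :: "nat \<Rightarrow> nat set \<Rightarrow> 'b \<Rightarrow> ereal" and z :: "nat \<Rightarrow> nat \<Rightarrow> real"
    and a c S :: real
  defines "\<Lambda> \<equiv> \<lambda>n. \<Sum>e\<in>all_edges_on {1..n}. prod (z n) e"
  assumes a: "0 < a" and c: "0 \<le> c" and sub: "c * S < 1"
    and good: "\<forall>\<^sub>F n in sequentially. edge_clocks (P n) {1..n} (z n) (T n) \<and>
      \<Lambda> n \<le> real n * a \<and> (\<Sum>i=1..n. (z n i)\<^sup>2) \<le> S"
    and \<Lambda>: "(\<lambda>n. sqrt (real n) * (a - \<Lambda> n / real n)) \<longlonglongrightarrow> 0"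
    and k: "\<forall>\<^sub>F n in sequentially. \<forall>\<omega>\<in>space (P n). \<forall>t\<in>{0..c}.
      K n t \<omega> = num_components {1..n} {e \<in> all_edges_on {1..n}. T n e \<omega> \<le> ereal t}"
  shows "prob_space R \<Longrightarrow> converges_in_distribution (skorokhod_topology c)
      P (\<lambda>n \<omega>. \<lambda>t\<in>{0..c}. real (K n t \<omega>) / real n) R (\<lambda>_. \<lambda>t\<in>{0..c}. 1 - t * a)" (is "_ \<Longrightarrow> ?lln")
    and "standard_brownian_motion Q B \<Longrightarrow> converges_in_distribution (skorokhod_topology c)
      P (\<lambda>n \<omega>. \<lambda>t\<in>{0..c}. sqrt (real n) * (real (K n t \<omega>) / real n - (1 - t * a)))
      Q (\<lambda>\<omega>. \<lambda>t\<in>{0..c}. B (t * a) \<omega>)" (is "_ \<Longrightarrow> ?clt")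
proof -
  let ?V = "\<lambda>n. {1..n :: nat}"
  define Y where "Y n \<omega> = (\<lambda>t\<in>{0..c}. sqrt (real n) * (real (K n t \<omega>) / real n - (1 - t * a)))" for n \<omega>
  define C where "C = c ^ 3 * S ^ 3 / (1 - c * S) + c\<^sup>2 * S\<^sup>2"
  \<comment> \<open>The expected error from cycles and from the centring, already divided by sqrt
    n.\<close>
  define \<kappa> where "\<kappa> n = (c ^ 3 * S ^ 3 / (1 - c * S) + (c * (real n * a - \<Lambda> n) + c\<^sup>2 * S\<^sup>2)) / sqrt (real n)" for n
  have inv_sqrt: "(\<lambda>n. x / sqrt (real n)) \<longlonglongrightarrow> 0" for x :: real by real_asymp
  have \<kappa>: "\<kappa> \<longlonglongrightarrow> 0"
  proof -
    have "(\<lambda>n. C / sqrt (real n) + c * (sqrt (real n) * (a - \<Lambda> n / real n))) \<longlonglongrightarrow> 0 + c * 0"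
      by (intro tendsto_add tendsto_mult inv_sqrt \<Lambda> tendsto_const)
    moreover have "\<forall>\<^sub>F n in sequentially. C / sqrt (real n) + c * (sqrt (real n) * (a - \<Lambda> n / real n)) = \<kappa> n"
      using eventually_gt_at_top[of 0]
    proof eventually_elim
      case (elim n)
      have "sqrt (real n) * (a - \<Lambda> n / real n) = (real n / sqrt (real n)) * (a - \<Lambda> n / real n)"
        by (simp add: real_div_sqrt)
      also have "\<dots> = (real n * a - \<Lambda> n) / sqrt (real n)" using elim by (simp add: right_diff_distrib diff_divide_distrib)
      finally show ?case unfolding \<kappa>_def C_def by (simp add: add_divide_distrib)
    qed
    ultimately show ?thesis using Lim_transform_eventually by force
  qed
  have \<Lambda>': "(\<lambda>n. \<Lambda> n / real n) \<longlonglongrightarrow> a"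
  proof -
    have "(\<lambda>n. 1 / sqrt (real n) * (sqrt (real n) * (a - \<Lambda> n / real n))) \<longlonglongrightarrow> 0 * 0"
      by (intro tendsto_mult inv_sqrt \<Lambda>)
    moreover have "\<forall>\<^sub>F n in sequentially. 1 / sqrt (real n) * (sqrt (real n) * (a - \<Lambda> n / real n)) = a - \<Lambda> n / real n"
      using eventually_gt_at_top[of 0] by eventually_elim simp
    ultimately have "(\<lambda>n. a - \<Lambda> n / real n) \<longlonglongrightarrow> 0" using Lim_transform_eventually by force
    from tendsto_diff[OF tendsto_const[of a] this] show ?thesis by simp
  qed
  have ev: "\<forall>\<^sub>F n in sequentially. 0 < n \<and> edge_clocks (P n) (?V n) (z n) (T n) \<and>
      \<Lambda> n \<le> real n * a \<and> (\<Sum>i=1..n. (z n i)\<^sup>2) \<le> S \<and> (\<forall>\<omega>\<in>space (P n). \<forall>t\<in>{0..c}.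
      K n t \<omega> = num_components (?V n) {e \<in> all_edges_on (?V n). T n e \<omega> \<le> ereal t})"
    using good k eventually_gt_at_top[of 0] by eventually_elim blast
  have Ymeas: "\<forall>\<^sub>F n in sequentially. prob_space (P n) \<and> Y n \<in> P n \<rightarrow>\<^sub>M borel_of (skorokhod_topology c)"
    using ev
  proof eventually_elim
    case (elim n)
    then interpret edge_clocks "P n" "?V n" "z n" "T n" by blast
    have "Y n \<in> P n \<rightarrow>\<^sub>M borel_of (skorokhod_topology c)"
    proof (rule component_path_measurable[OF c, where h = "\<lambda>t. - (sqrt (real n) * (1 - t * a))" and b = "sqrt (real n) / real n"])
      fix \<omega> assume "\<omega> \<in> space (P n)"
      then show "Y n \<omega> = (\<lambda>t\<in>{0..c}. sqrt (real n) / real n * real (num_components (?V n) (graph t \<omega>)) + - (sqrt (real n) * (1 - t * a)))"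
        unfolding Y_def using elim by (intro restrict_ext) (simp add: right_diff_distrib)
    qed (intro continuous_intros)
    then show ?case using prob_space_axioms by blast
  qed
  have Ybound: "\<forall>\<^sub>F n in sequentially. \<exists>U. integrable (P n) U \<and> (AE \<omega> in P n. \<forall>t\<in>{0..c}. \<bar>Y n \<omega> t\<bar> \<le> U \<omega>) \<and>
      (\<integral>\<omega>. U \<omega> \<partial>P n) \<le> \<kappa> n + (11 * (1 + (a * c + 3 * (a * c)\<^sup>2)) + 2 * a * c / sqrt (real n) + (1 + a * c))"
    using ev
  proof eventually_elim
    case (elim n)
    then interpret edge_clocks "P n" "?V n" "z n" "T n" by blast
    have cv: "card (?V n) = n" by simp
    obtain U where U: "integrable (P n) U"
      "AE \<omega> in P n. \<forall>t\<in>{0..c}. \<bar>sqrt (real n) * (real (num_components (?V n) (graph t \<omega>)) / real n - (1 - t * a))\<bar> \<le> U \<omega>"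
      "expectation U \<le> \<kappa> n + (11 * (1 + (a * c + 3 * (a * c)\<^sup>2)) + 2 * a * c / sqrt (real n) + (1 + a * c))"
      using components_bound[of a c S, unfolded cv] a c sub elim unfolding \<kappa>_def \<Lambda>_def by auto
    have "AE \<omega> in P n. \<forall>t\<in>{0..c}. \<bar>Y n \<omega> t\<bar> \<le> U \<omega>"
      using U(2) AE_space by eventually_elim (use elim in \<open>simp add: Y_def\<close>)
    then show ?case using U by blast
  qed
  show ?lln if R: "prob_space R"
  proof (rule converges_to_constant_path[OF c _ _ _ _ R])
    define M0 where "M0 = 11 * (1 + (a * c + 3 * (a * c)\<^sup>2)) + (1 + a * c)"
    show f: "(\<lambda>t\<in>{0..c}. 1 - t * a) \<in> skorokhod_space c"
      by (intro skorokhod_space_continuous continuous_intros)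
    show "(\<lambda>_. \<lambda>t\<in>{0..c}. 1 - t * a) \<in> R \<rightarrow>\<^sub>M borel_of (skorokhod_topology c)"
      using f by (intro skorokhod_measurableI[OF c]) auto
    show "\<forall>\<^sub>F n in sequentially. prob_space (P n) \<and>
        (\<lambda>\<omega>. \<lambda>t\<in>{0..c}. real (K n t \<omega>) / real n) \<in> P n \<rightarrow>\<^sub>M borel_of (skorokhod_topology c)"
      using ev
    proof eventually_elim
      case (elim n)
      then interpret edge_clocks "P n" "?V n" "z n" "T n" by blast
      have "(\<lambda>\<omega>. \<lambda>t\<in>{0..c}. real (K n t \<omega>) / real n) \<in> P n \<rightarrow>\<^sub>M borel_of (skorokhod_topology c)"
      proof (rule component_path_measurable[OF c, where h = "\<lambda>t. 0" and b = "1 / real n"])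
        fix \<omega> assume "\<omega> \<in> space (P n)"
        then show "(\<lambda>t\<in>{0..c}. real (K n t \<omega>) / real n) = (\<lambda>t\<in>{0..c}. 1 / real n * real (num_components (?V n) (graph t \<omega>)) + 0)"
          using elim by (intro restrict_ext) simp
      qed simp
      then show ?case using prob_space_axioms by blast
    qed
    have "(\<lambda>n. (\<kappa> n + (M0 + 2 * a * c / sqrt (real n))) * (1 / sqrt (real n))) \<longlonglongrightarrow> (0 + (M0 + 0)) * 0"
      by (intro tendsto_intros \<kappa> inv_sqrt)
    then show "(\<lambda>n. (\<kappa> n + (M0 + 2 * a * c / sqrt (real n))) / sqrt (real n)) \<longlonglongrightarrow> 0" by simp
    show "\<forall>\<^sub>F n in sequentially. \<exists>U. integrable (P n) U \<and>
        (AE \<omega> in P n. \<forall>t\<in>{0..c}. \<bar>(\<lambda>t\<in>{0..c}. real (K n t \<omega>) / real n) t - (\<lambda>t\<in>{0..c}. 1 - t * a) t\<bar> \<le> U \<omega>) \<and>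
        (\<integral>\<omega>. U \<omega> \<partial>P n) \<le> (\<kappa> n + (M0 + 2 * a * c / sqrt (real n))) / sqrt (real n)"
      using Ybound eventually_gt_at_top[of 0]
    proof eventually_elim
      case (elim n)
      then obtain U where U: "integrable (P n) U" "AE \<omega> in P n. \<forall>t\<in>{0..c}. \<bar>Y n \<omega> t\<bar> \<le> U \<omega>"
        "(\<integral>\<omega>. U \<omega> \<partial>P n) \<le> \<kappa> n + (M0 + 2 * a * c / sqrt (real n))"
        unfolding M0_def by (auto simp: algebra_simps)
      have "AE \<omega> in P n. \<forall>t\<in>{0..c}. \<bar>(\<lambda>t\<in>{0..c}. real (K n t \<omega>) / real n) t - (\<lambda>t\<in>{0..c}. 1 - t * a) t\<bar> \<le> U \<omega> / sqrt (real n)"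
        using U(2)
      proof eventually_elim
        case (elim \<omega>)
        show ?case
        proof
          fix t assume t: "t \<in> {0..c}"
          have "\<bar>real (K n t \<omega>) / real n - (1 - t * a)\<bar> = \<bar>Y n \<omega> t\<bar> / sqrt (real n)"
            using \<open>0 < n\<close> t by (simp add: Y_def abs_mult)
          also have "\<dots> \<le> U \<omega> / sqrt (real n)" using bspec[OF elim t] by (intro divide_right_mono) auto
          finally show "\<bar>(\<lambda>t\<in>{0..c}. real (K n t \<omega>) / real n) t - (\<lambda>t\<in>{0..c}. 1 - t * a) t\<bar> \<le> U \<omega> / sqrt (real n)"
            using t by simp
        qed
      qed
      then show ?case using U(1,3)
        by (intro exI[of _ "\<lambda>\<omega>. U \<omega> / sqrt (real n)"]) (simp add: divide_right_mono)
    qed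
  qed simp
  show ?clt if B: "standard_brownian_motion Q B"
    unfolding Y_def[symmetric]
  \<comment> \<open>A one-point interval is treated apart, since a grid of mesh c / 2^m requires
    \<open>c\<close> to be positive.\<close>
  proof (cases "c = 0")
    have Q: "prob_space Q" and B0: "AE \<omega> in Q. B 0 \<omega> = 0" using B by (auto simp: standard_brownian_motion_def)
    have a0: "0 \<le> a" using a by simp
    {
      case True
      have cv: "card (?V n) = n" for n by simp
      show "converges_in_distribution (skorokhod_topology c) P Y Q (\<lambda>\<omega>. \<lambda>t\<in>{0..c}. B (t * a) \<omega>)"
      proof (rule converges_to_constant_path[OF c _ Ymeas _ \<kappa> Q brownian_path(2)[OF B a0 c]])
        show "(\<lambda>t\<in>{0..c}. 0) \<in> skorokhod_space c" by (intro skorokhod_space_continuous continuous_intros)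
        show "AE \<omega> in Q. (\<lambda>t\<in>{0..c}. B (t * a) \<omega>) = (\<lambda>t\<in>{0..c}. 0)"
          using B0 by eventually_elim (intro restrict_ext, use True in simp)
        show "\<forall>\<^sub>F n in sequentially. \<exists>U. integrable (P n) U \<and>
            (AE \<omega> in P n. \<forall>t\<in>{0..c}. \<bar>Y n \<omega> t - (\<lambda>t\<in>{0..c}. 0) t\<bar> \<le> U \<omega>) \<and> (\<integral>\<omega>. U \<omega> \<partial>P n) \<le> \<kappa> n"
          using ev
        proof eventually_elim
          case (elim n)
          then interpret edge_clocks "P n" "?V n" "z n" "T n" by blast
          obtain U where U: "integrable (P n) U"
            "AE \<omega> in P n. \<forall>t\<in>{0..c}. \<bar>sqrt (real n) * (real (num_components (?V n) (graph t \<omega>)) / real n - (1 - t * a)) + fluct n t \<omega>\<bar> \<le> U \<omega>"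
            "expectation U \<le> \<kappa> n"
            using components_fluct_bound[of a c S, unfolded cv] a c sub elim unfolding \<kappa>_def \<Lambda>_def by auto
          note f0 = fluct_0[of n]
          have "AE \<omega> in P n. \<forall>t\<in>{0..c}. \<bar>Y n \<omega> t - (\<lambda>t\<in>{0..c}. 0) t\<bar> \<le> U \<omega>"
            using U(2) AE_space by eventually_elim (use elim True f0 in \<open>simp add: Y_def\<close>)
          then show ?case using U by blast
        qed
      qed
    next
      case False
      then have c0: "0 < c" using c by simp
      show "converges_in_distribution (skorokhod_topology c) P Y Q (\<lambda>\<omega>. \<lambda>t\<in>{0..c}. B (t * a) \<omega>)"
        unfolding skorokhod_topology_def
      proof (rule converges_in_distribution_LipschitzI[OF Metric_space_skorokhod])
        fix \<phi> :: "(real \<Rightarrow> real) \<Rightarrow> real" and L D :: real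
        assume lip: "\<And>x y. x \<in> skorokhod_space c \<Longrightarrow> y \<in> skorokhod_space c \<Longrightarrow> \<bar>\<phi> x - \<phi> y\<bar> \<le> L * skorokhod_dist c x y"
          and L: "0 \<le> L" and D: "\<And>x. x \<in> skorokhod_space c \<Longrightarrow> \<bar>\<phi> x\<bar> \<le> D"
        define X where "X m n i \<omega> = - ((edge_clocks.count (?V n) (T n) (real i * c / 2 ^ m) (real (Suc i) * c / 2 ^ m) \<omega>
          - edge_clocks.mean (?V n) (z n) (real i * c / 2 ^ m) (real (Suc i) * c / 2 ^ m)) / sqrt (real n))" for m n i \<omega>
        define Z where "Z m i \<omega> = B (a * c / 2 ^ m * real (Suc i)) \<omega> - B (a * c / 2 ^ m * real i) \<omega>" for m i \<omega>
        have fd: "(\<lambda>n. \<integral>\<omega>. \<phi> (sum_path c (2 ^ m) (\<lambda>i. X m n i \<omega>)) \<partial>P n)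
            \<longlonglongrightarrow> (\<integral>\<omega>. \<phi> (sum_path c (2 ^ m) (\<lambda>i. Z m i \<omega>)) \<partial>Q)" for m
        proof (rule continuity_theorem_finite_dim[where k = "2 ^ m" and C = "a * c" and X = "X m" and Z = "Z m"
              and g = "\<lambda>x. \<phi> (sum_path c (2 ^ m) x)" and B = D])
          have h: "0 < a * c / 2 ^ m" "a * c / 2 ^ m \<le> a * c / 1"
            using a c0 by (simp, intro divide_left_mono) auto
          note incr = brownian_increments[OF B h(1)]
          let ?\<tau> = "\<lambda>i. real i * c / 2 ^ m"
          have \<tau>: "0 \<le> ?\<tau> i" "?\<tau> i \<le> ?\<tau> (Suc i)" "?\<tau> (Suc i) - ?\<tau> i = c / 2 ^ m" for i
            using c0 by (auto intro!: divide_right_mono mult_right_mono simp: diff_divide_distrib[symmetric] algebra_simps)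
          show "Z m i \<in> borel_measurable Q" for i unfolding Z_def by (rule incr(1))
          show "integrable Q (\<lambda>\<omega>. (Z m i \<omega>)\<^sup>2) \<and> (\<integral>\<omega>. (Z m i \<omega>)\<^sup>2 \<partial>Q) \<le> a * c" for i
            unfolding Z_def using incr(2,3) h(2) by simp
          show "continuous_on UNIV (\<lambda>x. \<phi> (sum_path c (2 ^ m) x))"
            by (rule continuous_on_Lipschitz_sum_path[OF lip L])
          show "\<phi> (sum_path c (2 ^ m) x) = \<phi> (sum_path c (2 ^ m) (\<lambda>i. if i < 2 ^ m then x i else 0))" for x
            by (rule arg_cong[where f = \<phi>], rule sum_path_cong) simp
          show "\<bar>\<phi> (sum_path c (2 ^ m) x)\<bar> \<le> D" for x by (rule D[OF sum_path_in_space])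
          show "\<forall>\<^sub>F n in sequentially. prob_space (P n) \<and> (\<forall>i. X m n i \<in> borel_measurable (P n)) \<and>
              (\<forall>i<2 ^ m. integrable (P n) (\<lambda>\<omega>. (X m n i \<omega>)\<^sup>2) \<and> (\<integral>\<omega>. (X m n i \<omega>)\<^sup>2 \<partial>P n) \<le> a * c)"
            using ev
          proof eventually_elim
            case (elim n)
            then interpret edge_clocks "P n" "?V n" "z n" "T n" by blast
            have sq: "(X m n i \<omega>)\<^sup>2 = (count (?\<tau> i) (?\<tau> (Suc i)) \<omega> - mean (?\<tau> i) (?\<tau> (Suc i))) ^ 2 / real n" for i \<omega>
              unfolding X_def by (simp add: power_divide del: of_nat_Suc)
            have "X m n i \<in> borel_measurable (P n)" for i
              unfolding X_def by (intro borel_measurable_uminus borel_measurable_divide borel_measurable_diff count_measurable borel_measurable_const)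
            moreover have "integrable (P n) (\<lambda>\<omega>. (X m n i \<omega>)\<^sup>2)" for i
              unfolding sq by (intro integrable_divide_zero integrable_count_power)
            moreover have "(\<integral>\<omega>. (X m n i \<omega>)\<^sup>2 \<partial>P n) \<le> a * c" for i
            proof -
              have "(\<integral>\<omega>. (X m n i \<omega>)\<^sup>2 \<partial>P n) \<le> c / 2 ^ m * \<Lambda> n / real n"
                unfolding sq integral_divide_zero using count_moments(1)[OF \<tau>(1,2)[of i]]
                unfolding \<tau>(3) \<Lambda>_def by (intro divide_right_mono) auto
              also have "\<dots> \<le> c / 2 ^ m * (real n * a) / real n"
                using elim c0 by (intro divide_right_mono mult_left_mono) auto
              also have "\<dots> = a * c / 2 ^ m" using elim by simp
              finally show ?thesis using h(2) by linarith
            qed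
            ultimately show ?case using prob_space_axioms by blast
          qed
          fix u :: "nat \<Rightarrow> real"
          have mean_lim: "(\<lambda>n. edge_clocks.mean (?V n) (z n) 0 t / real n) \<longlonglongrightarrow> t * a" if t: "t \<in> {0..c}" for t
          proof -
            have "(\<lambda>n. c * (a - \<Lambda> n / real n) + c\<^sup>2 * S\<^sup>2 * (1 / real n)) \<longlonglongrightarrow> c * (a - a) + c\<^sup>2 * S\<^sup>2 * 0"
              by (intro tendsto_intros \<Lambda>' lim_1_over_n)
            then have b0: "(\<lambda>n. c * (a - \<Lambda> n / real n) + c\<^sup>2 * S\<^sup>2 * (1 / real n)) \<longlonglongrightarrow> 0" by simp
            have "\<forall>\<^sub>F n in sequentially. norm (edge_clocks.mean (?V n) (z n) 0 t / real n - t * a)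
                \<le> c * (a - \<Lambda> n / real n) + c\<^sup>2 * S\<^sup>2 * (1 / real n)"
              using ev
            proof eventually_elim
              case (elim n)
              then interpret edge_clocks "P n" "?V n" "z n" "T n" by blast
              have cv: "card (?V n) = n" by simp
              have "\<bar>t * real n * a - mean 0 t\<bar> \<le> c * (real n * a - \<Lambda> n) + c\<^sup>2 * S\<^sup>2"
                using mean_close[of a c S t, unfolded cv] a c sub elim t unfolding \<Lambda>_def by auto
              then have "\<bar>t * real n * a - mean 0 t\<bar> / real n \<le> (c * (real n * a - \<Lambda> n) + c\<^sup>2 * S\<^sup>2) / real n"
                by (intro divide_right_mono) auto
              moreover have "\<bar>t * real n * a - mean 0 t\<bar> / real n = norm (mean 0 t / real n - t * a)"
              proof -
                have "mean 0 t / real n - t * a = - ((t * real n * a - mean 0 t) / real n)"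
                  using elim by (simp add: diff_divide_distrib)
                then show ?thesis by (simp add: abs_divide)
              qed
              moreover have "(c * (real n * a - \<Lambda> n) + c\<^sup>2 * S\<^sup>2) / real n = c * (a - \<Lambda> n / real n) + c\<^sup>2 * S\<^sup>2 * (1 / real n)"
                using elim by (simp add: add_divide_distrib diff_divide_distrib right_diff_distrib)
              ultimately show ?case by simp
            qed
            from Lim_null_comparison[OF this b0] show ?thesis by (rule LIM_zero_cancel)
          qed
          have cell_lim: "(\<lambda>n. edge_clocks.mean (?V n) (z n) (?\<tau> i) (?\<tau> (Suc i)) / real n) \<longlonglongrightarrow> a * c / 2 ^ m" if i: "i < 2 ^ m" for i
          proof -
            have "real (Suc i) \<le> 2 ^ m" using i by (metis Suc_leI of_nat_le_iff of_nat_numeral of_nat_power)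
            then have "?\<tau> (Suc i) \<le> c" using c0 by (simp add: field_simps del: of_nat_Suc)
            then have "?\<tau> i \<in> {0..c}" "?\<tau> (Suc i) \<in> {0..c}"
              using \<tau>(1)[of i] \<tau>(1)[of "Suc i"] \<tau>(2)[of i] by (auto simp del: of_nat_Suc)
            then have "(\<lambda>n. edge_clocks.mean (?V n) (z n) 0 (?\<tau> (Suc i)) / real n - edge_clocks.mean (?V n) (z n) 0 (?\<tau> i) / real n)
                \<longlonglongrightarrow> ?\<tau> (Suc i) * a - ?\<tau> i * a"
              by (intro tendsto_diff mean_lim)
            moreover have "?\<tau> (Suc i) * a - ?\<tau> i * a = a * c / 2 ^ m"
              unfolding left_diff_distrib[symmetric] \<tau>(3) by simp
            moreover have "\<forall>\<^sub>F n in sequentially. edge_clocks.mean (?V n) (z n) 0 (?\<tau> (Suc i)) / real n - edge_clocks.mean (?V n) (z n) 0 (?\<tau> i) / real n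
                = edge_clocks.mean (?V n) (z n) (?\<tau> i) (?\<tau> (Suc i)) / real n"
              using ev
            proof eventually_elim
              case (elim n)
              then interpret edge_clocks "P n" "?V n" "z n" "T n" by blast
              show ?case using mean_add[of 0 "?\<tau> (Suc i)" "?\<tau> i"] by (simp only: diff_divide_distrib[symmetric] add_diff_cancel_left')
            qed
            ultimately show ?thesis using Lim_transform_eventually by force
          qed
          \<comment> \<open>The Gaussian factor before the limit. The sign of \<open>u\<close> is
            flipped because \<open>X\<close> is minus the normalised increment, in agreement with
            \<open>char_cells\<close>; the squares do not notice it.\<close>
          define W where "W n = exp (- ((\<Sum>i<2 ^ m. (- u i)\<^sup>2 * (edge_clocks.mean (?V n) (z n) (?\<tau> i) (?\<tau> (Suc i)) / real n)) / 2))" for n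
          have "W \<longlonglongrightarrow> exp (- ((\<Sum>i<2 ^ m. (- u i)\<^sup>2 * (a * c / 2 ^ m)) / 2))"
            unfolding W_def by (intro tendsto_intros cell_lim) auto
          then have W: "(\<lambda>n. complex_of_real (W n)) \<longlonglongrightarrow> (\<integral>\<omega>. iexp (\<Sum>i<2 ^ m. u i * Z m i \<omega>) \<partial>Q)"
            unfolding Z_def incr(4) by (intro tendsto_of_real) simp
          define b where "b = (\<Sum>i<(2::nat) ^ m. \<bar>- u i\<bar>)"
          define E where "E n = (b ^ 3 * ?\<tau> (2 ^ m)) * (\<Lambda> n / real n) / sqrt (real n)
              + (b ^ 4 * (?\<tau> (2 ^ m))\<^sup>2 * (1 / real n) * (1 / real n) + b\<^sup>2 * (?\<tau> (2 ^ m))\<^sup>2 * (1 / real n)) * S\<^sup>2" for n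
          have "(\<lambda>n. (b ^ 3 * ?\<tau> (2 ^ m)) * (\<Lambda> n / real n) * (1 / sqrt (real n))
              + (b ^ 4 * (?\<tau> (2 ^ m))\<^sup>2 * (1 / real n) * (1 / real n) + b\<^sup>2 * (?\<tau> (2 ^ m))\<^sup>2 * (1 / real n)) * S\<^sup>2)
            \<longlonglongrightarrow> (b ^ 3 * ?\<tau> (2 ^ m)) * a * 0
              + (b ^ 4 * (?\<tau> (2 ^ m))\<^sup>2 * 0 * 0 + b\<^sup>2 * (?\<tau> (2 ^ m))\<^sup>2 * 0) * S\<^sup>2"
            by (intro tendsto_intros \<Lambda>' lim_1_over_n inv_sqrt)
          then have E: "E \<longlonglongrightarrow> 0" unfolding E_def by simp
          have "\<forall>\<^sub>F n in sequentially. norm ((\<integral>\<omega>. iexp (\<Sum>i<2 ^ m. u i * X m n i \<omega>) \<partial>P n) - complex_of_real (W n)) \<le> E n"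
            using ev
          proof eventually_elim
            case (elim n)
            then interpret edge_clocks "P n" "?V n" "z n" "T n" by blast
            have cv: "card (?V n) = n" by simp
            have sq: "(\<Sum>e\<in>edges. (rate e)\<^sup>2) \<le> S\<^sup>2"
              using sum_rate_squares[of a c S, unfolded cv] a c sub elim unfolding \<Lambda>_def by auto
            have mono: "mono ?\<tau>"
              using c0 by (intro monoI divide_right_mono mult_right_mono) auto
            have eq: "(\<Sum>i<2 ^ m. u i * X m n i \<omega>) =
                (\<Sum>i<2 ^ m. - u i * ((count (?\<tau> i) (?\<tau> (Suc i)) \<omega> - mean (?\<tau> i) (?\<tau> (Suc i))) / sqrt (real n)))" for \<omega>
              unfolding X_def by (intro sum.cong refl) (simp del: of_nat_Suc)
            have "norm ((\<integral>\<omega>. iexp (\<Sum>i<2 ^ m. u i * X m n i \<omega>) \<partial>P n) - complex_of_real (W n)) \<le>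
                b ^ 3 * ?\<tau> (2 ^ m) * (\<Sum>e\<in>edges. rate e) / (real n * sqrt (real n))
                + (b ^ 4 * (?\<tau> (2 ^ m))\<^sup>2 / (real n)\<^sup>2 + b\<^sup>2 * (?\<tau> (2 ^ m))\<^sup>2 / real n) * (\<Sum>e\<in>edges. (rate e)\<^sup>2)"
              unfolding eq W_def b_def using elim by (intro char_cells[OF _ _ mono]) auto
            also have "\<dots> \<le> E n"
              unfolding E_def \<Lambda>_def
            proof (rule add_mono)
              show "(b ^ 4 * (?\<tau> (2 ^ m))\<^sup>2 / (real n)\<^sup>2 + b\<^sup>2 * (?\<tau> (2 ^ m))\<^sup>2 / real n) * (\<Sum>e\<in>edges. (rate e)\<^sup>2)
                  \<le> (b ^ 4 * (?\<tau> (2 ^ m))\<^sup>2 * (1 / real n) * (1 / real n) + b\<^sup>2 * (?\<tau> (2 ^ m))\<^sup>2 * (1 / real n)) * S\<^sup>2"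
                using sq by (intro mult_mono) (auto simp: power2_eq_square[of "real n"] intro!: sum_nonneg add_nonneg_nonneg)
            qed simp
            finally show ?case .
          qed
          from Lim_null_comparison[OF this E]
          have "(\<lambda>n. (\<integral>\<omega>. iexp (\<Sum>i<2 ^ m. u i * X m n i \<omega>) \<partial>P n) - complex_of_real (W n)) \<longlonglongrightarrow> 0" .
          from tendsto_add[OF this W]
          show "(\<lambda>n. \<integral>\<omega>. iexp (\<Sum>i<2 ^ m. u i * X m n i \<omega>) \<partial>P n) \<longlonglongrightarrow> (\<integral>\<omega>. iexp (\<Sum>i<2 ^ m. u i * Z m i \<omega>) \<partial>Q)"
            by simp
        qed (rule Q)
        \<comment> \<open>The part of the approximation error that does not depend on n.\<close>
        define \<eta> where "\<eta> m = 11 * (1 + (a * c + 3 * (a * c)\<^sup>2)) * (9 / 10) ^ m" for m :: nat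
        have approx: "\<forall>\<^sub>F n in sequentially. \<bar>(\<integral>\<omega>. \<phi> (Y n \<omega>) \<partial>P n) - (\<integral>\<omega>. \<phi> (sum_path c (2 ^ m) (\<lambda>i. X m n i \<omega>)) \<partial>P n)\<bar>
            \<le> L * (\<kappa> n + (\<eta> m + 2 * a * c / sqrt (real n)))" for m
          using ev Ymeas eventually_ge_at_top[of "2 ^ m"]
        proof eventually_elim
          case (elim n)
          then interpret edge_clocks "P n" "?V n" "z n" "T n" by blast
          have cv: "card (?V n) = n" by simp
          obtain U where U: "integrable (P n) U"
            "AE \<omega> in P n. \<forall>t\<in>{0..c}. \<bar>sqrt (real n) * (real (num_components (?V n) (graph t \<omega>)) / real n - (1 - t * a))
              - sum_path c (2 ^ m) (\<lambda>i. X m n i \<omega>) t\<bar> \<le> U \<omega>"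
            "expectation U \<le> \<kappa> n + (\<eta> m + 2 * a * c / sqrt (real n))"
            using components_sum_path_bound[of a c S m, unfolded cv] a c sub c0 elim
            unfolding \<kappa>_def \<Lambda>_def \<eta>_def X_def by auto
          have "AE \<omega> in P n. \<forall>t\<in>{0..c}. \<bar>Y n \<omega> t - sum_path c (2 ^ m) (\<lambda>i. X m n i \<omega>) t\<bar> \<le> U \<omega>"
            using U(2) AE_space by eventually_elim (use elim in \<open>simp add: Y_def\<close>)
          moreover have "(\<lambda>\<omega>. sum_path c (2 ^ m) (\<lambda>i. X m n i \<omega>)) \<in> P n \<rightarrow>\<^sub>M borel_of (skorokhod_topology c)"
            unfolding X_def by (intro sum_path_measurable[OF c] borel_measurable_uminus borel_measurable_divide
                borel_measurable_diff count_measurable borel_measurable_const)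
          ultimately have "\<bar>(\<integral>\<omega>. \<phi> (Y n \<omega>) \<partial>P n) - (\<integral>\<omega>. \<phi> (sum_path c (2 ^ m) (\<lambda>i. X m n i \<omega>)) \<partial>P n)\<bar> \<le> L * expectation U"
            using elim by (intro Lipschitz_expectation_diff(1)[OF _ _ _ lip L D U(1) _ c]) auto
          also have "\<dots> \<le> L * (\<kappa> n + (\<eta> m + 2 * a * c / sqrt (real n)))" using L U(3) by (rule mult_left_mono[rotated])
          finally show ?case .
        qed
        have Zlim: "(\<lambda>m. \<integral>\<omega>. \<phi> (sum_path c (2 ^ m) (\<lambda>i. Z m i \<omega>)) \<partial>Q) \<longlonglongrightarrow> (\<integral>\<omega>. \<phi> (\<lambda>t\<in>{0..c}. B (t * a) \<omega>) \<partial>Q)"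
          unfolding Z_def by (rule brownian_sum_path_tendsto[OF B a c0 lip L D])
        show "(\<lambda>n. \<integral>\<omega>. \<phi> (Y n \<omega>) \<partial>P n) \<longlonglongrightarrow> (\<integral>\<omega>. \<phi> (\<lambda>t\<in>{0..c}. B (t * a) \<omega>) \<partial>Q)"
        proof (rule tendstoI)
          \<comment> \<open>Four errors of size e / 4: \<eta> and the discretisation of Brownian
            motion fix \<open>m\<close>; for this \<open>m\<close> the vanishing part of the
            approximation and the finite-dimensional limit require n to be large.\<close>
          fix e :: real assume e: "e > 0"
          have "(\<lambda>m. L * \<eta> m) \<longlonglongrightarrow> L * (11 * (1 + (a * c + 3 * (a * c)\<^sup>2)) * 0)"
            unfolding \<eta>_def by (intro tendsto_intros LIMSEQ_power_zero) simp
          then have "\<forall>\<^sub>F m in sequentially. L * \<eta> m < e / 4" using e by (intro order_tendstoD) auto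
          moreover have "\<forall>\<^sub>F m in sequentially. dist (\<integral>\<omega>. \<phi> (sum_path c (2 ^ m) (\<lambda>i. Z m i \<omega>)) \<partial>Q)
              (\<integral>\<omega>. \<phi> (\<lambda>t\<in>{0..c}. B (t * a) \<omega>) \<partial>Q) < e / 4"
            using e by (intro tendstoD[OF Zlim]) simp
          ultimately have "\<forall>\<^sub>F m in sequentially. L * \<eta> m < e / 4 \<and> dist (\<integral>\<omega>. \<phi> (sum_path c (2 ^ m) (\<lambda>i. Z m i \<omega>)) \<partial>Q)
              (\<integral>\<omega>. \<phi> (\<lambda>t\<in>{0..c}. B (t * a) \<omega>) \<partial>Q) < e / 4" by (rule eventually_conj)
          then obtain m where m: "L * \<eta> m < e / 4" "dist (\<integral>\<omega>. \<phi> (sum_path c (2 ^ m) (\<lambda>i. Z m i \<omega>)) \<partial>Q)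
              (\<integral>\<omega>. \<phi> (\<lambda>t\<in>{0..c}. B (t * a) \<omega>) \<partial>Q) < e / 4"
            using eventually_happens'[OF sequentially_bot] by blast
          have "(\<lambda>n. L * (\<kappa> n + 2 * a * c / sqrt (real n))) \<longlonglongrightarrow> L * (0 + 0)"
            by (intro tendsto_intros \<kappa> inv_sqrt)
          then have "\<forall>\<^sub>F n in sequentially. L * (\<kappa> n + 2 * a * c / sqrt (real n)) < e / 4" using e by (intro order_tendstoD) auto
          moreover have "\<forall>\<^sub>F n in sequentially. dist (\<integral>\<omega>. \<phi> (sum_path c (2 ^ m) (\<lambda>i. X m n i \<omega>)) \<partial>P n)
              (\<integral>\<omega>. \<phi> (sum_path c (2 ^ m) (\<lambda>i. Z m i \<omega>)) \<partial>Q) < e / 4"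
            using e by (intro tendstoD[OF fd]) simp
          ultimately show "\<forall>\<^sub>F n in sequentially. dist (\<integral>\<omega>. \<phi> (Y n \<omega>) \<partial>P n) (\<integral>\<omega>. \<phi> (\<lambda>t\<in>{0..c}. B (t * a) \<omega>) \<partial>Q) < e"
            using approx[of m]
          proof eventually_elim
            case (elim n)
            have "L * (\<kappa> n + (\<eta> m + 2 * a * c / sqrt (real n))) = L * (\<kappa> n + 2 * a * c / sqrt (real n)) + L * \<eta> m"
              by (simp add: distrib_left)
            then show ?case using elim m unfolding dist_real_def by linarith
          qed
        qed
      qed (use Ymeas Q brownian_path(2)[OF B a0 c] in \<open>simp_all add: skorokhod_topology_def\<close>)
    }
  qed
qed


section \<open>Application to the masses defined by the generalized inverse\<close>

theorem corollary3p3: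
  fixes M :: "'a measure" and W :: "'a \<Rightarrow> real" and F :: "real \<Rightarrow> real"
    and P :: "nat \<Rightarrow> 'b measure" and G :: "nat \<Rightarrow> real \<Rightarrow> 'b \<Rightarrow> nat set set"
    and K :: "nat \<Rightarrow> real \<Rightarrow> 'b \<Rightarrow> nat" and EW :: real and c :: real
    and Q :: "'c measure" and B :: "real \<Rightarrow> 'c \<Rightarrow> real"
  assumes "prob_space M"
    and "W \<in> borel_measurable M"
    and "AE x in M. 0 \<le> W x"
    and "\<not> (AE x in M. W x = 0)"
    and "integrable M W"
    and "integrable M (\<lambda>x. (W x)\<^sup>2)"
    and "F = cdf (distr M borel W)"
    and "EW = (\<integral>x. W x \<partial>M)"
    and "\<And>n. 0 < total_weight F n \<Longrightarrow> multiplicative_graph_process (P n) {1..n} (mass F n) (G n)"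
    and "\<And>n t \<omega>. K n t \<omega> = num_components {1..n} (G n t \<omega>)"
    and "0 \<le> c"
    and "c < EW / (\<integral>x. (W x)\<^sup>2 \<partial>M)"
  shows "converges_in_distribution (skorokhod_topology c)
           P (\<lambda>n \<omega>. \<lambda>t\<in>{0..c}. real (K n t \<omega>) / real n)
           M (\<lambda>_. \<lambda>t\<in>{0..c}. 1 - t / 2 * EW)
       \<and> (standard_brownian_motion Q B \<longrightarrow>
          converges_in_distribution (skorokhod_topology c)
           P (\<lambda>n \<omega>. \<lambda>t\<in>{0..c}. sqrt (real n) * (real (K n t \<omega>) / real n - (1 - t / 2 * EW)))
           Q (\<lambda>\<omega>. \<lambda>t\<in>{0..c}. B (t * EW / 2) \<omega>))"
proof -
  let ?l = "total_weight F" and ?E2 = "\<integral>x. (W x)\<^sup>2 \<partial>M"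
  note weights = assms(1-3,7)
  have "0 \<le> EW" unfolding assms(8) using assms(3) by (rule integral_nonneg_AE)
  moreover have "EW \<noteq> 0"
    using assms(3,4,5) integral_nonneg_eq_0_iff_AE[of M W] unfolding assms(8) by blast
  ultimately have EW: "0 < EW" by simp
  have "0 < EW / ?E2" using assms(11,12) by linarith
  then have E2: "0 < ?E2" using EW by (simp add: zero_less_divide_iff)
  \<comment> \<open>An asymptotic upper bound for the sum of the squared masses; its reciprocal is
    the critical time of the statement.\<close>
  define S0 where "S0 = ?E2 / EW"
  have S0: "0 < S0" "c * S0 < 1"
    using assms(12) EW E2 by (simp_all add: S0_def field_simps)
  \<comment> \<open>A strict margin: the sum of the squared masses is only known to be eventually
    below each number above \<open>S0\<close>.\<close>
  obtain S where S: "S0 < S" "c * S < 1"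
  proof (cases "c = 0")
    case True
    then show ?thesis by (intro that[of "S0 + 1"]) auto
  next
    case False
    then have "c > 0" "S0 < 1 / c" using assms(11) S0(2) by (simp_all add: field_simps)
    then obtain S where "S0 < S" "S < 1 / c" using dense by blast
    then show ?thesis using \<open>c > 0\<close> by (intro that[of S]) (auto simp: field_simps)
  qed
  have lim: "(\<lambda>n. sqrt (real n) * (EW - ?l n / real n)) \<longlonglongrightarrow> 0"
    using total_weight_asymp[OF weights assms(5,6)] unfolding assms(8) .
  have l_lim: "(\<lambda>n. ?l n / real n) \<longlonglongrightarrow> EW"
  proof -
    have "(\<lambda>n. 1 / sqrt (real n)) \<longlonglongrightarrow> 0" by real_asymp
    from tendsto_mult[OF this lim]
    have "(\<lambda>n. 1 / sqrt (real n) * (sqrt (real n) * (EW - ?l n / real n))) \<longlonglongrightarrow> 0" by simp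
    moreover have "\<forall>\<^sub>F n in sequentially. 1 / sqrt (real n) * (sqrt (real n) * (EW - ?l n / real n)) = EW - ?l n / real n"
      using eventually_gt_at_top[of 0] by eventually_elim simp
    ultimately have "(\<lambda>n. EW - ?l n / real n) \<longlonglongrightarrow> 0" using Lim_transform_eventually by force
    from tendsto_diff[OF tendsto_const[of EW] this] show ?thesis by simp
  qed
  have ev: "\<forall>\<^sub>F n in sequentially. 0 < n \<and> 0 < ?l n \<and> ?E2 / (?l n / real n) < S"
  proof -
    have "\<forall>\<^sub>F n in sequentially. 0 < ?l n / real n" using l_lim EW by (intro order_tendstoD)
    moreover have "(\<lambda>n. ?E2 / (?l n / real n)) \<longlonglongrightarrow> S0"
      unfolding S0_def using EW by (intro tendsto_divide tendsto_const l_lim) simp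
    then have "\<forall>\<^sub>F n in sequentially. ?E2 / (?l n / real n) < S" using S(1) by (rule order_tendstoD)
    ultimately show ?thesis
      using eventually_gt_at_top[of 0] by eventually_elim (simp add: zero_less_divide_iff)
  qed
  have mass0: "0 \<le> mass F n i" if "0 < ?l n" "i \<in> {1..n}" for n i
    unfolding mass_def using weight_nonneg[OF weights that(2)] that(1) by simp
  have "\<exists>T. edge_clocks (P n) {1..n} (mass F n) T \<and>
      (\<forall>t\<ge>0. \<forall>\<omega>\<in>space (P n). G n t \<omega> = {e \<in> all_edges_on {1..n}. T e \<omega> \<le> ereal t})" if "0 < ?l n" for n
    using edge_clocks_of_process[OF assms(9)[OF that] finite_atLeastAtMost mass0[OF that]] by metis
  then obtain T where T: "\<And>n. 0 < ?l n \<Longrightarrow> edge_clocks (P n) {1..n} (mass F n) (T n)"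
    "\<And>n t \<omega>. 0 < ?l n \<Longrightarrow> 0 \<le> t \<Longrightarrow> \<omega> \<in> space (P n) \<Longrightarrow> G n t \<omega> = {e \<in> all_edges_on {1..n}. T n e \<omega> \<le> ereal t}"
    by metis
  define \<Lambda> where "\<Lambda> n = (\<Sum>e\<in>all_edges_on {1..n}. prod (mass F n) e)" for n
  define \<sigma> where "\<sigma> n = (\<Sum>i=1..n. (mass F n i)\<^sup>2)" for n
  have \<sigma>0: "0 \<le> \<sigma> n" for n by (simp add: \<sigma>_def sum_nonneg)
  \<comment> \<open>The masses add up to the square root of the total weight, so the full double sum
    is the total weight itself, and the total rate is half of it up to the diagonal
    \<sigma>.\<close>
  have \<Lambda>_eq: "2 * \<Lambda> n = ?l n - \<sigma> n" if "0 < ?l n" for n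
  proof -
    have "(\<Sum>i=1..n. mass F n i) = ?l n / sqrt (?l n)"
      by (simp add: mass_def total_weight_def sum_divide_distrib)
    also have "\<dots> = sqrt (?l n)" using that by (simp add: real_div_sqrt)
    finally have "(\<Sum>i=1..n. mass F n i)\<^sup>2 = ?l n" using that by simp
    then show ?thesis
      unfolding \<Lambda>_def \<sigma>_def using sum_all_edges_on_prod[of "{1..n}" "mass F n"] by simp
  qed
  have \<sigma>_le: "\<sigma> n \<le> S" if "0 < n" "0 < ?l n" "?E2 / (?l n / real n) < S" for n
  proof -
    have "\<sigma> n = (\<Sum>i=1..n. weight F n i ^ 2) / ?l n"
      using that(2) by (simp add: \<sigma>_def mass_def power_divide sum_divide_distrib)
    also have "\<dots> \<le> real n * ?E2 / ?l n"
      using sum_weight_power_le[OF weights _ assms(6) that(1)] that(2) by (intro divide_right_mono) auto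
    also have "\<dots> = ?E2 / (?l n / real n)" by simp
    finally show ?thesis using that(3) by simp
  qed
  have l_le: "?l n \<le> real n * EW" if "0 < n" for n
    using sum_weight_power_le[OF weights, of 1 n] assms(5) that by (simp add: total_weight_def assms(8))
  note limits = component_limits[where a = "EW / 2" and c = c and S = S and z = "mass F" and T = T and P = P and K = K]
  have good: "\<forall>\<^sub>F n in sequentially. edge_clocks (P n) {1..n} (mass F n) (T n) \<and>
      (\<Sum>e\<in>all_edges_on {1..n}. prod (mass F n) e) \<le> real n * (EW / 2) \<and> (\<Sum>i=1..n. (mass F n i)\<^sup>2) \<le> S"
    using ev
  proof eventually_elim
    case (elim n)
    then have "\<Lambda> n \<le> real n * (EW / 2)" using \<Lambda>_eq[of n] \<sigma>0[of n] l_le[of n] by simp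
    then show ?case using T(1) \<sigma>_le elim unfolding \<Lambda>_def \<sigma>_def by blast
  qed
  \<comment> \<open>The diagonal is eventually at most \<open>S\<close> and contributes at most S /
    (2 sqrt n); the rest is half the Riemann sum error of \<open>lim\<close>.\<close>
  have rate_lim: "(\<lambda>n. sqrt (real n) * (EW / 2 - (\<Sum>e\<in>all_edges_on {1..n}. prod (mass F n) e) / real n)) \<longlonglongrightarrow> 0"
  proof -
    have s0: "(\<lambda>n. \<sigma> n / (2 * sqrt (real n))) \<longlonglongrightarrow> 0"
    proof (rule Lim_null_comparison)
      show "\<forall>\<^sub>F n in sequentially. norm (\<sigma> n / (2 * sqrt (real n))) \<le> S / (2 * sqrt (real n))"
        using ev by eventually_elim (use \<sigma>_le \<sigma>0 in \<open>simp add: divide_right_mono\<close>)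
      show "(\<lambda>n. S / (2 * sqrt (real n))) \<longlonglongrightarrow> 0" by real_asymp
    qed
    have "(\<lambda>n. sqrt (real n) * (EW - ?l n / real n) / 2 + \<sigma> n / (2 * sqrt (real n))) \<longlonglongrightarrow> 0 / 2 + 0"
      by (intro tendsto_intros lim s0) simp
    moreover have "\<forall>\<^sub>F n in sequentially. sqrt (real n) * (EW - ?l n / real n) / 2 + \<sigma> n / (2 * sqrt (real n))
        = sqrt (real n) * (EW / 2 - \<Lambda> n / real n)"
      using ev
    proof eventually_elim
      case (elim n)
      have "\<sigma> n / (2 * sqrt (real n)) = sqrt (real n) * (\<sigma> n / real n) / 2"
        using elim real_sqrt_mult_self[of "real n"] by (simp add: field_simps)
      moreover have "\<Lambda> n = (?l n - \<sigma> n) / 2" using \<Lambda>_eq[of n] elim by simp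
      ultimately show ?case by (simp add: right_diff_distrib diff_divide_distrib)
    qed
    ultimately have "(\<lambda>n. sqrt (real n) * (EW / 2 - \<Lambda> n / real n)) \<longlonglongrightarrow> 0"
      using Lim_transform_eventually by force
    then show ?thesis unfolding \<Lambda>_def .
  qed
  have comp: "\<forall>\<^sub>F n in sequentially. \<forall>\<omega>\<in>space (P n). \<forall>t\<in>{0..c}.
      K n t \<omega> = num_components {1..n} {e \<in> all_edges_on {1..n}. T n e \<omega> \<le> ereal t}"
    using ev by eventually_elim (use T(2) assms(10) in auto)
  have a: "0 < EW / 2" using EW by simp
  show ?thesis
    using limits(1)[OF a assms(11) S(2) good rate_lim comp assms(1)]
      limits(2)[OF a assms(11) S(2) good rate_lim comp, of Q B]
    by (simp only: times_divide_eq_left times_divide_eq_right) blast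
qed

end
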